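(* Let $d\ge1$ and let $M$ be a simple, finite-intensity, non-equidistant point process in $\mathbb{R}^d$ which is invariant and ergodic under isometries of $\mathbb{R}^d$. Then: (i) $M$ has a factor graph in which almost surely each component is a locally finite one-ended tree. (ii) $M$ has a factor graph in which almost surely each component is a directed doubly infinite path. (iii) $M$ has a factor graph which is almost surely a perfect matching.
   Context: A point process $M$ on $\mathbb{R}^d$ is viewed as a random Borel measure; its support is $[M]=\{x\in\mathbb{R}^d: M(\{x\})=1\}$, and (random) elements of $[M]$ are called $M$-points. With $\|\cdot\|$ the Euclidean norm, $M$ is non-equidistant if (almost surely) there do not exist $M$-points $w,x,y,z$ with $\{w,x\}\ne\{y,z\}$ and $\|w-x\|=\|y-z\|>0$. A factor graph of $M$ is a mapping that assigns to a countable set $V\subseteq\mathbb{R}^d$ a (directed or undirected) graph $G=G(V)$ with vertex set $V$, defined for almost all $V$ with respect to the law of $[M]$, and commuting with all isometries $\theta$ of $\mathbb{R}^d$, i.e. $G(\theta V)=\theta G(V)$. One writes $G=G([M])$ for the resulting random graph; thus $G$ is a deterministic function of $M$ and the joint distribution of $(M,G)$ is invariant under isometries. The dependence on $V$ is understood to be measurable: the set of $(x,y,V)$ such that $G(V)$ has an edge from $x$ to $y$ is measurable, up to null sets. A graph is locally finite if no vertex has infinite degree. A graph is a tree if it is connected and has no cycles. The number of ends of a tree is the number of distinct singly infinite self-avoiding paths starting from any one vertex; a tree is one-ended if this number is $1$. A directed doubly infinite path is a directed graph isomorphic to the graph with vertex set $\mathbb{Z}$ and a directed edge from $n$ to $n+1$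 for each $n\in\mathbb{Z}$. A perfect matching is a graph in which every vertex has degree exactly $1$. *)

theory Defs
  imports
    "HOL-Probability.Probability"
    "Graph_Theory.Pair_Digraph"
    "Graph_Theory.Digraph_Component"
    "Graph_Theory.Digraph_Isomorphism"
begin

section \<open>Point processes\<close>

text \<open>
  The space of locally finite, integer-valued Borel measures, with the sigma-algebra generated by
  the evaluations at Borel sets (built in the same way as \<^const>\<open>subprob_algebra\<close>).
  A point process is a measurable map into this space. Membership in \<^term>\<open>\<nat>\<close>
  excludes the value infinity.
\<close>

definition is_point_measure :: "'a::euclidean_space measure \<Rightarrow> bool" where
  "is_point_measure \<mu> \<longleftrightarrow>
     sets \<mu> = sets borel \<and> (\<forall>B\<in>sets borel. bounded B \<longrightarrow> emeasure \<mu> B \<in> \<nat>)"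

definition point_measures :: "'a::euclidean_space measure measure" where
  "point_measures =
     (SUP B \<in> sets borel. vimage_algebra {\<mu>. is_point_measure \<mu>} (\<lambda>\<mu>. emeasure \<mu> B) borel)"

definition point_process :: "'w measure \<Rightarrow> ('w \<Rightarrow> 'a::euclidean_space measure) \<Rightarrow> bool" where
  "point_process P M \<longleftrightarrow> prob_space P \<and> M \<in> P \<rightarrow>\<^sub>M point_measures"

definition support :: "'a::euclidean_space measure \<Rightarrow> 'a set" where
  "support \<mu> = {x. emeasure \<mu> {x} = 1}"

definition simple_process :: "'w measure \<Rightarrow> ('w \<Rightarrow> 'a::euclidean_space measure) \<Rightarrow> bool" where
  "simple_process P M \<longleftrightarrow> (AE \<omega> in P. \<forall>x. emeasure (M \<omega>) {x} \<le> 1)"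

text \<open>The intensity of an invariant process is the expected number of points in a unit cube.\<close>

definition finite_intensity :: "'w measure \<Rightarrow> ('w \<Rightarrow> 'a::euclidean_space measure) \<Rightarrow> bool" where
  "finite_intensity P M \<longleftrightarrow> (\<integral>\<^sup>+ \<omega>. emeasure (M \<omega>) (cbox 0 One) \<partial>P) < \<infinity>"

definition non_equidistant :: "'w measure \<Rightarrow> ('w \<Rightarrow> 'a::euclidean_space measure) \<Rightarrow> bool" where
  "non_equidistant P M \<longleftrightarrow>
     (AE \<omega> in P. \<not> (\<exists>w\<in>support (M \<omega>). \<exists>x\<in>support (M \<omega>). \<exists>y\<in>support (M \<omega>). \<exists>z\<in>support (M \<omega>).
        {w, x} \<noteq> {y, z} \<and> norm (w - x) = norm (y - z) \<and> norm (y - z) > 0))"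

text \<open>In a Euclidean space, distance-preserving self-maps are automatically bijective.\<close>

definition isometry :: "('a::euclidean_space \<Rightarrow> 'a) \<Rightarrow> bool" where
  "isometry \<theta> \<longleftrightarrow> (\<forall>x y. dist (\<theta> x) (\<theta> y) = dist x y)"

definition isometry_invariant :: "'w measure \<Rightarrow> ('w \<Rightarrow> 'a::euclidean_space measure) \<Rightarrow> bool" where
  "isometry_invariant P M \<longleftrightarrow>
     (\<forall>\<theta>. isometry \<theta> \<longrightarrow>
        distr P point_measures (\<lambda>\<omega>. distr (M \<omega>) borel \<theta>) = distr P point_measures M)"

definition isometry_ergodic :: "'w measure \<Rightarrow> ('w \<Rightarrow> 'a::euclidean_space measure) \<Rightarrow> bool" where
  "isometry_ergodic P M \<longleftrightarrow>
     (\<forall>A\<in>sets point_measures.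
        (\<forall>\<theta>. isometry \<theta> \<longrightarrow> (\<lambda>\<mu>. distr \<mu> borel \<theta>) -` A \<inter> space point_measures = A) \<longrightarrow>
        measure (distr P point_measures M) A \<in> {0, 1})"

section \<open>Graphs\<close>

text \<open>
  An undirected graph is a loop-free symmetric digraph, each edge being a pair of opposite arcs.
  Consequently walks going back and forth along an edge are cycles in the sense of
  \<^const>\<open>pre_digraph.cycle\<close>, and the graph-theoretic cycles are those of length at least 3;
  for this reason \<^const>\<open>Digraph_Component.tree\<close> cannot be used. Connectedness is that of the
  underlying undirected graph, and it includes being nonempty.
\<close>

abbreviation undirected :: "'a pair_pre_digraph \<Rightarrow> bool" where
  "undirected g \<equiv> pair_bidirected_digraph g"

definition graph_components :: "('a, 'b) pre_digraph \<Rightarrow> ('a, 'b) pre_digraph set" where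
  "graph_components g = {H. pre_digraph.max_subgraph g Digraph_Component.connected H}"

definition locally_finite :: "('a, 'b) pre_digraph \<Rightarrow> bool" where
  "locally_finite g \<longleftrightarrow> (\<forall>v\<in>verts g. finite (in_arcs g v) \<and> finite (out_arcs g v))"

definition undirected_tree :: "('a, 'b) pre_digraph \<Rightarrow> bool" where
  "undirected_tree g \<longleftrightarrow>
     Digraph_Component.connected g \<and> \<not> (\<exists>p. pre_digraph.cycle g p \<and> 3 \<le> length p)"

definition rays :: "('a, 'b) pre_digraph \<Rightarrow> 'a \<Rightarrow> (nat \<Rightarrow> 'a) set" where
  "rays g v = {r. r 0 = v \<and> inj r \<and> (\<forall>n. (r n, r (Suc n)) \<in> arcs_ends g)}"

definition one_ended_tree :: "('a, 'b) pre_digraph \<Rightarrow> bool" where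
  "one_ended_tree g \<longleftrightarrow> undirected_tree g \<and> (\<forall>v\<in>verts g. card (rays g v) = 1)"

definition int_line :: "int pair_pre_digraph" where
  "int_line = \<lparr>pverts = UNIV, parcs = {(n, n + 1) | n. True}\<rparr>"

definition directed_biinfinite_path :: "('a, 'b) pre_digraph \<Rightarrow> bool" where
  "directed_biinfinite_path g \<longleftrightarrow> digraph_iso g (with_proj int_line)"

text \<open>In an undirected graph the degree of a vertex is its out-degree.\<close>

definition perfect_matching :: "'a pair_pre_digraph \<Rightarrow> bool" where
  "perfect_matching g \<longleftrightarrow> undirected g \<and> (\<forall>v\<in>pverts g. out_degree (with_proj g) v = 1)"

definition image_graph :: "('a \<Rightarrow> 'b) \<Rightarrow> 'a pair_pre_digraph \<Rightarrow> 'b pair_pre_digraph" where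
  "image_graph \<theta> g = \<lparr>pverts = \<theta> ` pverts g, parcs = map_prod \<theta> \<theta> ` parcs g\<rparr>"

section \<open>Factor graphs\<close>

text \<open>Countable sets, with the sigma-algebra generated by the numbers of points in Borel sets.\<close>

definition countable_sets :: "'a::euclidean_space set measure" where
  "countable_sets =
     (SUP B \<in> sets borel.
        vimage_algebra {V. countable V} (\<lambda>V. emeasure (count_space UNIV) (V \<inter> B)) borel)"

definition support_law ::
    "'w measure \<Rightarrow> ('w \<Rightarrow> 'a::euclidean_space measure) \<Rightarrow> 'a set measure" where
  "support_law P M = distr P countable_sets (\<lambda>\<omega>. support (M \<omega>))"

text \<open>
  A factor graph is a partial map, defined almost everywhere. Commuting with isometries is
  an equation between partial maps; in particular the domain is invariant under isometries.
  The last conjunct says that the set of \<open>(x, y, V)\<close> such that \<open>G V\<close> has an edge from \<open>x\<close> to \<open>y\<close>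
  agrees with a measurable set, up to a null set of \<open>V\<close>.
\<close>

definition factor_graph ::
    "'w measure \<Rightarrow> ('w \<Rightarrow> 'a::euclidean_space measure) \<Rightarrow>
      ('a set \<Rightarrow> 'a pair_pre_digraph option) \<Rightarrow> bool" where
  "factor_graph P M G \<longleftrightarrow>
     (\<forall>V g. G V = Some g \<longrightarrow> countable V \<and> pverts g = V \<and> pair_wf_digraph g) \<and>
     (AE V in support_law P M. V \<in> dom G) \<and>
     (\<forall>\<theta> V. isometry \<theta> \<longrightarrow> G (\<theta> ` V) = map_option (image_graph \<theta>) (G V)) \<and>
     (\<exists>E \<in> sets (borel \<Otimes>\<^sub>M borel \<Otimes>\<^sub>M countable_sets).
        AE V in support_law P M. \<forall>x y.
          (x, y, V) \<in> E \<longleftrightarrow> (\<exists>g. G V = Some g \<and> (x, y) \<in> parcs g))"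

end

theory Submission
  imports Defs
begin

text \<open>
The three factor graphs come from a single equivariant map on the points. Suppose every point \<open>x\<close> of a
configuration \<open>V\<close> carries a level in \<open>\<nat>\<close>, chosen equivariantly and unbounded on \<open>V\<close>, and let the parent
of \<open>x\<close> be the nearest point of higher level; it is unique because distances do not repeat. Levels increase
along parents, so there are no cycles, and since levels are natural numbers no path can descend for ever:
the only ray from a point climbs through its successive parents (\<open>rays_component\<close>). Hence each component is a
one-ended tree, and it remains to see that a point has finitely many children.

This is where probability enters, through mass transport (\<open>AE_finite_to_one\<close>): if every point sends
mass at most 1 by a translation-equivariant rule, then the expected mass received in a unit cube equals the
expected mass sent from it, which is at most the intensity. So an equivariant partial map on the points of
a stationary process of finite intensity is almost surely finite-to-one. Moreover a stationary configuration
is almost surely empty or infinite (\<open>AE_empty_or_infinite\<close>).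

Unbounded levels exist on every infinite configuration with distinct distances. The distance from a point to its
nearest neighbour is shared by at most two points, so these distances take infinitely many values and, after
being squeezed into \<open>[0, 1)\<close>, accumulate at some value; the least such value \<open>a\<close> is determined by \<open>V\<close>. The level of
\<open>x\<close> is the integer part of 1 divided by the distance of its squeezed value from \<open>a\<close> (\<open>level_unbounded\<close>).

The matching and the paths are obtained from the forest. A point has finitely many descendants; give it to
its parent if their number (itself included) is odd, and to itself otherwise. Each point is then given an
even number of points, because one plus the sum of the children's counts is its own count. These even classes
are paired off in order of distance from the point they are given to (\<open>perfect_matching_mates\<close>). For the
paths, visit the forest in postorder, siblings in order of distance from their parent. The postorder successor is
injective and never returns (\<open>left_unique_succ\<close>, \<open>succ_aperiodic\<close>). A point without predecessor would be
the root of an infinite successor orbit; sending all of that orbit to its root would contradict finiteness of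
fibres, so the successor is almost surely a bijection without finite orbits, that is, a union of copies
of the line of integers (\<open>directed_line_component\<close>).

Measurability is organised around one device: a locally finite set is enumerated by the members of a countable
base that contain exactly one of its points, so sums and quantifiers over its points are countable ones
(\<open>measurable_sum_over_points\<close>). All graphs are given by relations defined with such quantifiers
from distances, which makes both their measurability and their equivariance mechanical.
\<close>

section \<open>Locally finite configurations\<close>

definition lf_config :: "'a::euclidean_space set \<Rightarrow> bool" where
  "lf_config V \<longleftrightarrow> (\<forall>B. bounded B \<longrightarrow> finite (V \<inter> B))"

text \<open>
Point processes have locally finite supports, and the enumeration of the points constructed below relies on each
point being isolated.
\<close>

definition configs :: "'a::euclidean_space set measure" where
  "configs = restrict_space countable_sets {V. lf_config V}"

lemma space_countable_sets: "space countable_sets = {V. countable V}"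
  by (auto simp: countable_sets_def space_Sup_eq_UN)

lemma measurable_number_of_points:
  "B \<in> sets borel \<Longrightarrow>
    (\<lambda>V. emeasure (count_space UNIV) (V \<inter> B)) \<in> borel_measurable countable_sets"
  by (auto intro!: measurable_Sup1 measurable_vimage_algebra1 simp: countable_sets_def)

lemma measurable_countable_setsI:
  assumes "\<And>a. a \<in> space A \<Longrightarrow> countable (U a)"
    and "\<And>B. B \<in> sets borel \<Longrightarrow>
      (\<lambda>a. emeasure (count_space UNIV) (U a \<inter> B)) \<in> borel_measurable A"
  shows "U \<in> A \<rightarrow>\<^sub>M countable_sets"
  using assms by (auto intro!: measurable_Sup2 measurable_vimage_algebra2 simp: countable_sets_def)

lemma emeasure_count_finite_iff:
  "emeasure (count_space UNIV) X < \<infinity> \<longleftrightarrow> finite X"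
  by (auto simp: emeasure_count_space of_nat_less_top)

lemma lf_config_iff_balls:
  "lf_config V \<longleftrightarrow> (\<forall>n::nat. emeasure (count_space UNIV) (V \<inter> ball 0 (real n)) < \<infinity>)"
  unfolding emeasure_count_finite_iff lf_config_def
proof safe
  fix B :: "'a set" assume fin: "\<forall>n::nat. finite (V \<inter> ball 0 (real n))" and "bounded B"
  then obtain r where r: "B \<subseteq> ball 0 r" by (meson bounded_subset_ballD)
  obtain n :: nat where "r \<le> real n" using real_arch_simple by blast
  with r have "V \<inter> B \<subseteq> V \<inter> ball 0 (real n)" by fastforce
  with fin show "finite (V \<inter> B)" by (blast intro: finite_subset)
qed auto

lemma lf_config_imp_countable: "lf_config V \<Longrightarrow> countable V"
proof -
  assume "lf_config V"
  then have "countable (\<Union>n::nat. V \<inter> ball 0 (real n))"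
    by (intro countable_UN[OF _ countable_finite] countableI_type) (simp add: lf_config_def)
  moreover have "(\<Union>n::nat. V \<inter> ball 0 (real n)) = V"
    by (auto simp: reals_Archimedean2)
  ultimately show ?thesis by simp
qed

lemma sets_lf_config: "{V. lf_config V} \<in> sets countable_sets"
proof -
  have [measurable]: "(\<lambda>V. emeasure (count_space UNIV) (V \<inter> ball 0 (real n))) \<in>
      borel_measurable (countable_sets :: 'a set measure)" for n
    by (rule measurable_number_of_points) simp
  have "{V \<in> space (countable_sets :: 'a set measure). lf_config V} \<in> sets countable_sets"
    unfolding lf_config_iff_balls by measurable
  moreover have "{V \<in> space (countable_sets :: 'a set measure). lf_config V} = {V. lf_config V}"
    using lf_config_imp_countable by (auto simp: space_countable_sets)
  ultimately show ?thesis by simp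
qed

lemma space_configs: "space configs = {V. lf_config V}"
  using lf_config_imp_countable by (auto simp: configs_def space_restrict_space space_countable_sets)

lemma sets_configs_subset: "A \<in> sets configs \<Longrightarrow> A \<in> sets countable_sets"
  unfolding configs_def using sets_lf_config by (subst (asm) sets_restrict_space_iff) auto

lemma measurable_number_of_points_configs [measurable]:
  "B \<in> sets borel \<Longrightarrow> (\<lambda>V. emeasure (count_space UNIV) (V \<inter> B)) \<in> borel_measurable configs"
  unfolding configs_def by (intro measurable_restrict_space1 measurable_number_of_points)

lemma measurable_configsI:
  assumes "\<And>a. a \<in> space A \<Longrightarrow> lf_config (U a)"
    and "\<And>B. B \<in> sets borel \<Longrightarrow>
      (\<lambda>a. emeasure (count_space UNIV) (U a \<inter> B)) \<in> borel_measurable A"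
  shows "U \<in> A \<rightarrow>\<^sub>M configs"
  unfolding configs_def
  using assms by (intro measurable_restrict_space2 measurable_countable_setsI)
    (auto intro: lf_config_imp_countable)

text \<open>
A fixed enumeration of some countable base of the topology. Its indices serve as names for the points of a
configuration.
\<close>

definition base_set :: "nat \<Rightarrow> 'a::euclidean_space set" where
  "base_set = from_nat_into (SOME B. countable B \<and> topological_basis B)"

lemma base_set: "topological_basis (range (base_set :: nat \<Rightarrow> 'a::euclidean_space set))"
proof -
  define B :: "'a set set" where "B = (SOME B. countable B \<and> topological_basis B)"
  have B: "countable B" "topological_basis B"
    using someI_ex[OF ex_countable_basis] unfolding B_def by auto
  have "B \<noteq> {}"
    using B(2) topological_basisE[of B UNIV "0::'a"] by auto
  then show ?thesis
    using B by (simp add: base_set_def B_def[symmetric] range_from_nat_into)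
qed

lemma open_base_set: "open (base_set i)"
  by (rule topological_basis_open[OF base_set]) simp

lemma borel_base_set [measurable]: "base_set i \<in> sets borel"
  by (rule borel_open[OF open_base_set])

lemma base_set_near:
  assumes "open S" "x \<in> S" obtains i where "x \<in> base_set i" "base_set i \<subseteq> S"
  by (rule topological_basisE[OF base_set assms]) (blast intro: that)

lemma base_set_separates:
  fixes x y :: "'a::euclidean_space"
  assumes "y \<noteq> x"
  obtains j k where "y \<in> base_set j" "x \<in> base_set k"
    "(base_set j :: 'a set) \<inter> base_set k = {}"
proof -
  obtain S T where ST: "open S" "open T" "y \<in> S" "x \<in> T" "S \<inter> T = {}"
    using hausdorff[OF assms] by (elim exE conjE)
  obtain j where j: "y \<in> base_set j" "base_set j \<subseteq> S" by (rule base_set_near[OF ST(1,3)])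
  obtain k where k: "x \<in> base_set k" "base_set k \<subseteq> T" by (rule base_set_near[OF ST(2,4)])
  have "base_set j \<inter> base_set k \<subseteq> S \<inter> T" using j k by (intro Int_mono)
  then have "(base_set j :: 'a set) \<inter> base_set k = {}" unfolding ST(5) by simp
  then show thesis by (rule that[OF j(1) k(1)])
qed

definition isolates :: "nat \<Rightarrow> 'a::euclidean_space set \<Rightarrow> bool" where
  "isolates i V \<longleftrightarrow> emeasure (count_space UNIV) (V \<inter> base_set i) = 1"

text \<open>
The value 0 for sets that do not isolate a point is arbitrary.
\<close>

definition nth_point :: "nat \<Rightarrow> 'a::euclidean_space set \<Rightarrow> 'a" where
  "nth_point i V = (if isolates i V then the_elem (V \<inter> base_set i) else 0)"

text \<open>
Many members of the base isolate the same point; keeping only the first index makes the enumeration injective.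
\<close>

definition first_index :: "nat \<Rightarrow> 'a::euclidean_space set \<Rightarrow> bool" where
  "first_index i V \<longleftrightarrow> isolates i V \<and> (\<forall>j<i. \<not> (isolates j V \<and> nth_point j V = nth_point i V))"

lemma emeasure_count_eq_1_iff:
  "emeasure (count_space UNIV) X = 1 \<longleftrightarrow> (\<exists>x. X = {x})"
proof
  assume *: "emeasure (count_space UNIV) X = 1"
  have "emeasure (count_space UNIV) X < \<infinity>" unfolding * by simp
  then have "finite X" by (rule emeasure_count_finite_iff[THEN iffD1])
  with * have "card X = 1" by simp
  then show "\<exists>x. X = {x}" by (rule card_1_singletonE) blast
next
  assume "\<exists>x. X = {x}"
  then obtain x where "X = {x}" ..
  then show "emeasure (count_space UNIV) X = 1" by simp
qed

lemma isolates_iff: "isolates i V \<longleftrightarrow> (\<exists>x. V \<inter> base_set i = {x})"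
  by (simp add: isolates_def emeasure_count_eq_1_iff)

lemma isolates_nth_point: "isolates i V \<Longrightarrow> V \<inter> base_set i = {nth_point i V}"
  unfolding isolates_iff by (elim exE) (simp add: nth_point_def isolates_iff)

text \<open>
Local finiteness leaves only finitely many other points near \<open>x\<close>. Removing them from a ball around \<open>x\<close> gives an
open set, and some member of the base lies between \<open>x\<close> and that set.
\<close>

lemma bij_betw_nth_point:
  assumes "lf_config V" shows "bij_betw (\<lambda>i. nth_point i V) {i. first_index i V} V"
  unfolding bij_betw_def
proof (intro conjI equalityI subsetI)
  show "inj_on (\<lambda>i. nth_point i V) {i. first_index i V}"
    by (rule inj_onI) (metis first_index_def linorder_neqE_nat mem_Collect_eq)
  fix x assume "x \<in> (\<lambda>i. nth_point i V) ` {i. first_index i V}"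
  then show "x \<in> V" using isolates_nth_point by (fastforce simp: first_index_def)
next
  fix x assume x: "x \<in> V"
  define S where "S = ball x 1 - (V \<inter> ball x 1 - {x})"
  have "finite (V \<inter> ball x 1 - {x})" using assms by (simp add: lf_config_def)
  then have "open S" unfolding S_def by (intro open_Diff finite_imp_closed) auto
  moreover have "x \<in> S" by (simp add: S_def)
  ultimately obtain i where "x \<in> base_set i" "base_set i \<subseteq> S" by (rule base_set_near)
  with x have "V \<inter> base_set i = {x}" by (auto simp: S_def)
  then have ex: "isolates i V \<and> nth_point i V = x" by (auto simp: nth_point_def isolates_iff)
  define k where "k = (LEAST i. isolates i V \<and> nth_point i V = x)"
  have k: "isolates k V \<and> nth_point k V = x"
    unfolding k_def by (rule LeastI[of "\<lambda>i. isolates i V \<and> nth_point i V = x", OF ex])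
  moreover have "\<not> (isolates j V \<and> nth_point j V = x)" if "j < k" for j
    using not_less_Least[of j "\<lambda>i. isolates i V \<and> nth_point i V = x"] that unfolding k_def by blast
  ultimately have "first_index k V" unfolding first_index_def by simp
  with k show "x \<in> (\<lambda>i. nth_point i V) ` {i. first_index i V}"
    by (intro image_eqI[of _ _ k]) simp_all
qed

lemma pred_number_of_points [measurable]:
  "B \<in> sets borel \<Longrightarrow>
    Measurable.pred configs (\<lambda>V. emeasure (count_space UNIV) (V \<inter> B) = 1)"
  by (rule pred_eq_const1[OF measurable_number_of_points_configs]) simp_all

lemma measurable_isolates [measurable]: "Measurable.pred configs (isolates i)"
  unfolding isolates_def[abs_def] by (rule pred_number_of_points) (rule borel_base_set)

text \<open>
When the \<open>i\<close>-th base set isolates a point, that point lies in \<open>C\<close> exactly if one point of the configuration is in the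
intersection of the base set with \<open>C\<close>, an event about counts.
\<close>

lemma measurable_nth_point [measurable]: "nth_point i \<in> configs \<rightarrow>\<^sub>M borel"
proof (rule measurableI)
  fix C :: "'a set" assume C: "C \<in> sets borel"
  have eq: "nth_point i V \<in> C \<longleftrightarrow>
      (isolates i V \<and> emeasure (count_space UNIV) (V \<inter> (base_set i \<inter> C)) = 1) \<or>
      (\<not> isolates i V \<and> 0 \<in> C)" for V
  proof (cases "isolates i V")
    case True
    then have "V \<inter> base_set i = {nth_point i V}" by (rule isolates_nth_point)
    then have "V \<inter> (base_set i \<inter> C) = {nth_point i V} \<inter> C" by auto
    with True show ?thesis unfolding emeasure_count_eq_1_iff by auto
  qed (simp add: nth_point_def)
  note [measurable] = pred_number_of_points[OF sets.Int[OF borel_base_set C]]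
  have "{V \<in> space configs. nth_point i V \<in> C} \<in> sets configs" unfolding eq by measurable
  moreover have "nth_point i -` C \<inter> space configs = {V \<in> space configs. nth_point i V \<in> C}"
    by auto
  ultimately show "nth_point i -` C \<inter> space configs \<in> sets configs" by simp
qed simp

lemma pred_eq_borel [measurable (raw)]:
  fixes f g :: "'b \<Rightarrow> 'a::euclidean_space"
  assumes [measurable]: "f \<in> borel_measurable A" "g \<in> borel_measurable A"
  shows "Measurable.pred A (\<lambda>a. f a = g a)"
proof -
  have "Measurable.pred A (\<lambda>a. dist (f a) (g a) = 0)" by measurable
  then show ?thesis by simp
qed

lemma measurable_first_index [measurable]: "Measurable.pred configs (first_index i)"
  unfolding first_index_def[abs_def] by measurable

lemma nn_integral_config:
  assumes "lf_config V"
  shows "(\<integral>\<^sup>+x. h x \<partial>count_space V) = (\<Sum>i. if first_index i V then h (nth_point i V) else 0)"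
proof -
  have "(\<integral>\<^sup>+x. h x \<partial>count_space V) = (\<integral>\<^sup>+i. h (nth_point i V) \<partial>count_space {i. first_index i V})"
    by (rule nn_integral_bij_count_space[OF bij_betw_nth_point[OF assms], symmetric])
  also have "\<dots> = (\<integral>\<^sup>+i. h (nth_point i V) * indicator {i. first_index i V} i \<partial>count_space UNIV)"
    by (rule nn_integral_count_space_indicator) simp
  also have "\<dots> = (\<integral>\<^sup>+i. (if first_index i V then h (nth_point i V) else 0) \<partial>count_space UNIV)"
    by (intro nn_integral_cong) (simp add: indicator_def)
  finally show ?thesis unfolding nn_integral_count_space_nat .
qed

text \<open>
The enumeration turns the sum over a random set into a series of measurable terms. Existence, counting and
cardinality below are instances with an indicator as summand.
\<close>

lemma measurable_sum_over_points:
  fixes h :: "'b \<Rightarrow> 'a::euclidean_space \<Rightarrow> ennreal"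
  assumes U [measurable]: "U \<in> A \<rightarrow>\<^sub>M configs"
    and h [measurable]: "(\<lambda>(a, x). h a x) \<in> borel_measurable (A \<Otimes>\<^sub>M borel)"
  shows "(\<lambda>a. \<integral>\<^sup>+x. h a x \<partial>count_space (U a)) \<in> borel_measurable A"
proof -
  have lf: "lf_config (U a)" if "a \<in> space A" for a
    using measurable_space[OF U that] by (simp add: space_configs)
  have "(\<lambda>a. \<Sum>i. if first_index i (U a) then h a (nth_point i (U a)) else 0) \<in> borel_measurable A"
    by measurable
  then show ?thesis
    by (subst measurable_cong[OF nn_integral_config[OF lf]])
qed

text \<open>
Declared to the measurability prover, this lemma and its analogues below let it treat quantifiers over the points
of a random configuration like countable ones.
\<close>

lemma pred_bex_point [measurable (raw)]:
  fixes Q :: "'b \<Rightarrow> 'a::euclidean_space \<Rightarrow> bool"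
  assumes U: "U \<in> A \<rightarrow>\<^sub>M configs"
    and [measurable]: "Measurable.pred (A \<Otimes>\<^sub>M borel) (\<lambda>(a, x). Q a x)"
  shows "Measurable.pred A (\<lambda>a. \<exists>x\<in>U a. Q a x)"
proof -
  define F :: "'b \<Rightarrow> ennreal"
    where "F a = (\<integral>\<^sup>+x. (if Q a x then 1 else 0) \<partial>count_space (U a))" for a
  have [measurable]: "F \<in> borel_measurable A"
    unfolding F_def by (rule measurable_sum_over_points[OF U]) measurable
  have "(\<exists>x\<in>U a. Q a x) \<longleftrightarrow> F a \<noteq> 0" for a
    by (auto simp: F_def nn_integral_0_iff_AE AE_count_space)
  moreover have "Measurable.pred A (\<lambda>a. F a \<noteq> 0)" by measurable
  ultimately show ?thesis by simp
qed

lemma pred_ball_point [measurable (raw)]: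
  fixes Q :: "'b \<Rightarrow> 'a::euclidean_space \<Rightarrow> bool"
  assumes [measurable]: "U \<in> A \<rightarrow>\<^sub>M configs"
    and [measurable]: "Measurable.pred (A \<Otimes>\<^sub>M borel) (\<lambda>(a, x). Q a x)"
  shows "Measurable.pred A (\<lambda>a. \<forall>x\<in>U a. Q a x)"
proof -
  have "Measurable.pred A (\<lambda>a. \<not> (\<exists>x\<in>U a. \<not> Q a x))" by measurable
  then show ?thesis by simp
qed

lemma measurable_count_points:
  fixes Q :: "'b \<Rightarrow> 'a::euclidean_space \<Rightarrow> bool"
  assumes [measurable]: "U \<in> A \<rightarrow>\<^sub>M configs"
    and [measurable]: "Measurable.pred (A \<Otimes>\<^sub>M borel) (\<lambda>(a, x). Q a x)"
  shows "(\<lambda>a. emeasure (count_space UNIV) {x\<in>U a. Q a x}) \<in> borel_measurable A"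
proof -
  have "(\<lambda>a. \<integral>\<^sup>+x. (if Q a x then 1 else 0 :: ennreal) \<partial>count_space (U a)) \<in> borel_measurable A"
    by (rule measurable_sum_over_points[OF assms(1)]) measurable
  moreover have "(\<integral>\<^sup>+x. (if Q a x then 1 else 0) \<partial>count_space (U a)) =
      emeasure (count_space UNIV) {x\<in>U a. Q a x}" for a
  proof -
    have "(\<integral>\<^sup>+x. (if Q a x then 1 else 0) \<partial>count_space (U a)) =
        (\<integral>\<^sup>+x. (if Q a x then 1 else 0) * indicator (U a) x \<partial>count_space UNIV)"
      by (rule nn_integral_count_space_indicator) simp
    also have "\<dots> = (\<integral>\<^sup>+x. indicator {x\<in>U a. Q a x} x \<partial>count_space UNIV)"
      by (intro nn_integral_cong) (simp add: indicator_def)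
    finally show ?thesis by simp
  qed
  ultimately show ?thesis by simp
qed

lemma pred_finite_points [measurable (raw)]:
  fixes Q :: "'b \<Rightarrow> 'a::euclidean_space \<Rightarrow> bool"
  assumes [measurable]: "U \<in> A \<rightarrow>\<^sub>M configs"
    and [measurable]: "Measurable.pred (A \<Otimes>\<^sub>M borel) (\<lambda>(a, x). Q a x)"
  shows "Measurable.pred A (\<lambda>a. finite {x\<in>U a. Q a x})"
proof -
  note [measurable] = measurable_count_points[OF assms]
  have "Measurable.pred A (\<lambda>a. emeasure (count_space UNIV) {x\<in>U a. Q a x} < \<infinity>)" by measurable
  then show ?thesis by (simp only: emeasure_count_finite_iff)
qed

lemma measurable_card_points [measurable (raw)]:
  fixes Q :: "'b \<Rightarrow> 'a::euclidean_space \<Rightarrow> bool"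
  assumes [measurable]: "U \<in> A \<rightarrow>\<^sub>M configs"
    and [measurable]: "Measurable.pred (A \<Otimes>\<^sub>M borel) (\<lambda>(a, x). Q a x)"
  shows "(\<lambda>a. card {x\<in>U a. Q a x}) \<in> A \<rightarrow>\<^sub>M count_space UNIV"
proof -
  note [measurable] = measurable_count_points[OF assms]
  have *: "card X = nat \<lfloor>enn2real (emeasure (count_space UNIV) X)\<rfloor>" for X :: "'a set"
    by (cases "finite X") (auto simp: emeasure_count_space)
  show ?thesis unfolding * by measurable
qed

lemma pred_point [measurable (raw)]:
  fixes f :: "'b \<Rightarrow> 'a::euclidean_space"
  assumes [measurable]: "U \<in> A \<rightarrow>\<^sub>M configs" "f \<in> borel_measurable A"
  shows "Measurable.pred A (\<lambda>a. f a \<in> U a)"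
proof -
  have "Measurable.pred A (\<lambda>a. \<exists>y\<in>U a. y = f a)" by measurable
  then show ?thesis by simp
qed

section \<open>Mass transport\<close>

lemma isometry_translation: "isometry ((+) t)"
  by (simp add: isometry_def)

lemma isometry_inj: "isometry \<theta> \<Longrightarrow> inj \<theta>"
  unfolding isometry_def by (metis dist_eq_0_iff injI)

lemma lf_config_isometry_image:
  assumes \<theta>: "isometry \<theta>" and V: "lf_config V"
  shows "lf_config (\<theta> ` V)"
  unfolding lf_config_def
proof (intro allI impI)
  fix B :: "'a set" assume "bounded B"
  then obtain e where e: "\<And>x y. x \<in> B \<Longrightarrow> y \<in> B \<Longrightarrow> dist x y \<le> e"
    by (auto simp: bounded_two_points)
  have "bounded (\<theta> -` B)"
    unfolding bounded_two_points
    by (intro exI[of _ e] ballI) (metis e \<theta> isometry_def vimageE)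
  then have "finite (\<theta> ` (V \<inter> \<theta> -` B))" using V by (auto simp: lf_config_def)
  moreover have "\<theta> ` V \<inter> B = \<theta> ` (V \<inter> \<theta> -` B)" by auto
  ultimately show "finite (\<theta> ` V \<inter> B)" by simp
qed

lemma emeasure_count_inj_image:
  "inj f \<Longrightarrow> emeasure (count_space UNIV) (f ` X) = emeasure (count_space UNIV) X"
  using card_image[of f X] finite_image_iff[of f X] inj_on_subset[of f UNIV X]
  by (simp add: emeasure_count_space)

lemma measurable_translate [measurable]: "(`) ((+) t) \<in> configs \<rightarrow>\<^sub>M configs"
proof (rule measurable_configsI)
  fix B :: "'a set" assume "B \<in> sets borel"
  then have "(+) t -` B \<in> sets borel"
    using measurable_sets[of "(+) t" borel borel B] by simp
  then have "(\<lambda>V. emeasure (count_space UNIV) (V \<inter> (+) t -` B)) \<in> borel_measurable configs"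
    by (rule measurable_number_of_points_configs)
  moreover have "emeasure (count_space UNIV) ((+) t ` V \<inter> B) =
      emeasure (count_space UNIV) (V \<inter> (+) t -` B)" for V
  proof -
    have "(+) t ` V \<inter> B = (+) t ` (V \<inter> (+) t -` B)" by auto
    then show ?thesis by (simp add: emeasure_count_inj_image)
  qed
  ultimately show "(\<lambda>V. emeasure (count_space UNIV) ((+) t ` V \<inter> B)) \<in> borel_measurable configs"
    by simp
qed (simp add: space_configs lf_config_isometry_image isometry_translation)

text \<open>
The lower corner of the half-open unit cube of the integer grid that contains \<open>x\<close>. The values of this map
form the lattice, and \<open>cell x = z\<close> says that \<open>x\<close> lies in the cube at \<open>z\<close>.
\<close>

definition cell :: "'a::euclidean_space \<Rightarrow> 'a" where
  "cell x = (\<Sum>b\<in>Basis. of_int \<lfloor>x \<bullet> b\<rfloor> *\<^sub>R b)"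

lemma cell_inner: "b \<in> Basis \<Longrightarrow> cell x \<bullet> b = of_int \<lfloor>x \<bullet> b\<rfloor>"
  by (simp add: cell_def inner_sum_left inner_Basis if_distrib cong: if_cong)

lemma cell_add: "cell (cell z + x) = cell z + cell x"
  by (rule euclidean_eqI) (simp add: cell_inner inner_add_left floor_add_int[symmetric] add.commute)

lemma cell_cell: "cell (cell z) = cell z"
  by (rule euclidean_eqI) (simp add: cell_inner)

lemma cell_uminus_cell: "cell (- cell z) = - cell z"
  by (rule euclidean_eqI)
    (simp add: cell_inner inner_minus_left of_int_minus[symmetric] del: of_int_minus)

lemma measurable_cell [measurable]: "cell \<in> borel \<rightarrow>\<^sub>M borel"
  unfolding cell_def[abs_def] by measurable

lemma countable_range_cell: "countable (range (cell :: 'a::euclidean_space \<Rightarrow> 'a))"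
proof -
  have "range (cell :: 'a \<Rightarrow> 'a) \<subseteq>
      (\<lambda>f. \<Sum>b\<in>Basis. of_int (f b) *\<^sub>R b) ` (Basis \<rightarrow>\<^sub>E (UNIV :: int set))"
  proof (rule image_subsetI)
    fix x :: 'a
    show "cell x \<in> (\<lambda>f. \<Sum>b\<in>Basis. of_int (f b) *\<^sub>R b) ` (Basis \<rightarrow>\<^sub>E (UNIV :: int set))"
      by (rule image_eqI[of _ _ "restrict (\<lambda>b. \<lfloor>x \<bullet> b\<rfloor>) Basis"]) (auto simp: cell_def)
  qed
  moreover have "countable (Basis \<rightarrow>\<^sub>E (UNIV :: int set) :: ('a \<Rightarrow> int) set)"
    by (intro countable_PiE) auto
  ultimately show ?thesis by (blast intro: countable_subset)
qed

lemma cell_eq_0_imp_cbox: "cell x = 0 \<Longrightarrow> x \<in> cbox 0 One"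
proof -
  assume x: "cell x = 0"
  have "0 \<le> x \<bullet> b \<and> x \<bullet> b \<le> 1" if "b \<in> Basis" for b
  proof -
    have "real_of_int \<lfloor>x \<bullet> b\<rfloor> = 0" using cell_inner[OF that, of x] x by simp
    then have "\<lfloor>x \<bullet> b\<rfloor> = 0" by simp
    then show ?thesis by linarith
  qed
  then show ?thesis by (simp add: mem_box)
qed

text \<open>
Measurability of a relation in its three arguments jointly can be used under any further measurable
parameters, for instance inside quantifiers over points.
\<close>

lemma pred_relation:
  assumes R: "Measurable.pred (configs \<Otimes>\<^sub>M borel \<Otimes>\<^sub>M borel) (\<lambda>(V, x, y). R V x y)"
    and [measurable]: "U \<in> A \<rightarrow>\<^sub>M configs" "f \<in> A \<rightarrow>\<^sub>M borel" "g \<in> A \<rightarrow>\<^sub>M borel"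
  shows "Measurable.pred A (\<lambda>a. R (U a) (f a) (g a))"
proof -
  have "(\<lambda>a. (U a, f a, g a)) \<in> A \<rightarrow>\<^sub>M configs \<Otimes>\<^sub>M borel \<Otimes>\<^sub>M borel" by measurable
  from measurable_compose[OF this R] show ?thesis by simp
qed

text \<open>
Random configurations with translation-invariant law and finite intensity, all that mass transport needs.
\<close>

locale stationary_config = prob_space N for N :: "'a::euclidean_space set measure" +
  assumes sets_N: "sets N = sets configs"
    and stationary: "\<And>t. distr N configs ((`) ((+) t)) = N"
    and intensity: "(\<integral>\<^sup>+V. emeasure (count_space UNIV) (V \<inter> cbox 0 One) \<partial>N) < \<infinity>"
begin

lemma space_N: "space N = {V. lf_config V}"
  using sets_eq_imp_space_eq[OF sets_N] by (simp add: space_configs)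

lemma measurable_N: "measurable N = measurable configs"
  using measurable_cong_sets[OF sets_N refl] by blast

lemma nn_integral_translate:
  assumes "f \<in> borel_measurable configs"
  shows "(\<integral>\<^sup>+V. f ((+) t ` V) \<partial>N) = (\<integral>\<^sup>+V. f V \<partial>N)"
proof -
  have "(\<integral>\<^sup>+V. f V \<partial>N) = (\<integral>\<^sup>+V. f V \<partial>distr N configs ((`) ((+) t)))"
    by (simp only: stationary)
  also have "\<dots> = (\<integral>\<^sup>+V. f ((+) t ` V) \<partial>N)"
    using assms by (intro nn_integral_distr) (simp_all add: measurable_N measurable_translate)
  finally show ?thesis ..
qed

text \<open>
If a nonempty configuration inside a fixed ball had positive probability, then so would its translates by
multiples of twice the radius, with the same probability. These events are disjoint, so the probability is 0.
\<close>

lemma AE_empty_or_infinite: "AE V in N. V = {} \<or> infinite V"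
proof -
  obtain b :: 'a where b: "b \<in> Basis" by (meson ex_in_conv nonempty_Basis)
  define inside where "inside k V \<longleftrightarrow> (\<exists>x\<in>V. True) \<and> (\<forall>x\<in>V. norm x < real (Suc k))"
    for k and V :: "'a set"
  have [measurable]: "Measurable.pred configs (inside k)" for k
    unfolding inside_def[abs_def] by measurable
  have null: "AE V in N. \<not> inside k V" for k
  proof -
    \<comment> \<open>Nonempty configurations whose translate by \<open>2 j (k + 1)\<close> along a coordinate axis lies in the ball of radius \<open>k + 1\<close>.\<close>
    define S where "S j = {V \<in> space configs. inside k ((+) ((2 * real (Suc k) * real j) *\<^sub>R b) ` V)}" for j :: nat
    have S [measurable]: "S j \<in> sets N" for j
      unfolding sets_N S_def by measurable
    have prob_S: "measure N (S j) = measure N {V \<in> space configs. inside k V}" for j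
    proof -
      let ?t = "(2 * real (Suc k) * real j) *\<^sub>R b"
      have "measure N {V \<in> space configs. inside k V} =
          measure (distr N configs ((`) ((+) ?t))) {V \<in> space configs. inside k V}"
        by (simp only: stationary)
      also have "\<dots> = measure N ((`) ((+) ?t) -` {V \<in> space configs. inside k V} \<inter> space N)"
        by (rule measure_distr) (simp_all add: measurable_N measurable_translate)
      also have "(`) ((+) ?t) -` {V \<in> space configs. inside k V} \<inter> space N = S j"
        by (auto simp: S_def space_N space_configs lf_config_isometry_image isometry_translation)
      finally show ?thesis ..
    qed
    have "disjoint_family S"
      unfolding disjoint_family_on_def
    proof (intro ballI impI equalityI subsetI)
      fix i j :: nat and V assume ij: "i \<noteq> j" and V: "V \<in> S i \<inter> S j"
      then obtain x where x: "x \<in> V" by (auto simp: S_def inside_def)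
      let ?r = "real (Suc k)"
      have "norm ((2 * ?r * real i) *\<^sub>R b + x) < ?r" "norm ((2 * ?r * real j) *\<^sub>R b + x) < ?r"
        using V x by (auto simp: S_def inside_def)
      then have "norm (((2 * ?r * real i) *\<^sub>R b + x) - ((2 * ?r * real j) *\<^sub>R b + x)) < ?r + ?r"
        by (intro le_less_trans[OF norm_triangle_ineq4]) linarith
      also have "((2 * ?r * real i) *\<^sub>R b + x) - ((2 * ?r * real j) *\<^sub>R b + x) =
          (2 * ?r * (real i - real j)) *\<^sub>R b" by (simp add: algebra_simps)
      finally have "2 * ?r * \<bar>real i - real j\<bar> < 2 * ?r * 1"
        using b by (simp add: abs_mult)
      then have "\<bar>real i - real j\<bar> < 1" by (subst (asm) mult_less_cancel_left_pos) auto
      with ij show "V \<in> {}" by linarith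
    qed auto
    then have "(\<lambda>j. measure N (S j)) sums measure N (\<Union>j. S j)"
      by (intro finite_measure_UNION) auto
    then have "summable (\<lambda>j::nat. measure N {V \<in> space configs. inside k V})"
      by (auto simp: prob_S intro: sums_summable)
    then have "measure N {V \<in> space configs. inside k V} = 0"
      by (simp add: summable_const_iff)
    moreover have "{V \<in> space N. inside k V} \<in> sets N" unfolding sets_N space_N space_configs[symmetric] by measurable
    ultimately show ?thesis
      by (subst AE_iff_measurable[OF _ refl]) (simp_all add: emeasure_eq_measure space_N space_configs)
  qed
  have all_null: "AE V in N. \<forall>k. \<not> inside k V" by (subst AE_all_countable) (simp add: null)
  show ?thesis
  proof (rule AE_mp[OF all_null], intro AE_I2 impI, rule ccontr)
    fix V assume V: "\<forall>k. \<not> inside k V" and "\<not> (V = {} \<or> infinite V)"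
    then have "V \<noteq> {}" "bounded V" by (auto simp: finite_imp_bounded)
    then obtain r where r: "\<And>x. x \<in> V \<Longrightarrow> norm x \<le> r" by (auto simp: bounded_iff)
    obtain k :: nat where "r < real k" using reals_Archimedean2 by blast
    then have "inside k V" using r \<open>V \<noteq> {}\<close> by (fastforce simp: inside_def)
    with V show False by simp
  qed
qed

text \<open>
Mass transport. Let \<open>E z w\<close> be the expected number of pairs \<open>R V x y\<close> with \<open>x\<close> in the cube at \<open>z\<close> and \<open>y\<close> in the cube at
\<open>w\<close>. It depends on \<open>w - z\<close> only, so summing over the second or over the first index gives the same
value: the expected number of pairs leaving a cube equals the expected number entering it. The former is at most
the intensity because \<open>R\<close> is a partial function, so the latter is finite.
\<close>

lemma AE_finite_to_one:
  fixes R :: "'a set \<Rightarrow> 'a \<Rightarrow> 'a \<Rightarrow> bool"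
  assumes meas: "Measurable.pred (configs \<Otimes>\<^sub>M borel \<Otimes>\<^sub>M borel) (\<lambda>(V, x, y). R V x y)"
    and shift: "\<And>V t x y. R ((+) t ` V) (t + x) (t + y) = R V x y"
    and functional: "AE V in N. \<forall>x\<in>V. \<forall>y\<in>V. \<forall>y'\<in>V. R V x y \<longrightarrow> R V x y' \<longrightarrow> y = y'"
  shows "AE V in N. \<forall>y\<in>V. finite {x\<in>V. R V x y}"
proof -
  define L where "L = range (cell :: 'a \<Rightarrow> 'a)"
  have L: "countable L" and cell_L: "cell x \<in> L" for x
    by (simp_all add: L_def countable_range_cell)
  note [measurable (raw)] = pred_relation[OF meas]
  define m where "m z w V = (\<integral>\<^sup>+y. \<integral>\<^sup>+x. (if R V x y \<and> cell x = z \<and> cell y = w then 1 else 0 :: ennreal)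
      \<partial>count_space V \<partial>count_space V)" for z w V
  have m_meas: "m z w \<in> borel_measurable configs" for z w
    unfolding m_def[abs_def]
  proof (rule measurable_sum_over_points)
    show "(\<lambda>(V, y). \<integral>\<^sup>+x. (if R V x y \<and> cell x = z \<and> cell y = w then 1 else 0 :: ennreal)
        \<partial>count_space V) \<in> borel_measurable (configs \<Otimes>\<^sub>M borel)"
      unfolding split_def by (rule measurable_sum_over_points) measurable
  qed simp
  define E where "E z w = (\<integral>\<^sup>+V. m z w V \<partial>N)" for z w
  have E_shift: "E (t + z) (t + w) = E z w" if "t \<in> L" for t z w
  proof -
    have t: "cell (t + x) = t + cell x" for x
      using that cell_add by (auto simp: L_def)
    have "m (t + z) (t + w) ((+) t ` V) = m z w V" for V
    proof -
      have b: "bij_betw ((+) t) V ((+) t ` V)" by (simp add: bij_betw_def)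
      show ?thesis
        unfolding m_def nn_integral_bij_count_space[OF b, symmetric]
        by (simp add: shift t)
    qed
    then show ?thesis
      unfolding E_def using nn_integral_translate[OF m_meas[of "t + z" "t + w"], of t] by simp
  qed
  define out where "out V = (\<integral>\<^sup>+y. \<integral>\<^sup>+x. (if R V x y \<and> cell x = 0 then 1 else 0 :: ennreal)
      \<partial>count_space V \<partial>count_space V)" for V
  define inn where "inn w V = (\<integral>\<^sup>+y. \<integral>\<^sup>+x. (if R V x y \<and> cell y = w then 1 else 0 :: ennreal)
      \<partial>count_space V \<partial>count_space V)" for w V
  have count_L: "(\<integral>\<^sup>+w. (if P \<and> c = w then 1 else 0) \<partial>count_space L) = (if P then 1 else 0 :: ennreal)"
    if "c \<in> L" for c P
  proof -
    have "(\<integral>\<^sup>+w. (if P \<and> c = w then 1 else 0) \<partial>count_space L) =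
        (\<integral>\<^sup>+w. (if P then 1 else 0) * indicator {c} w \<partial>count_space L)"
      by (intro nn_integral_cong) (auto simp: indicator_def)
    also have "\<dots> = (if P then 1 else 0)"
      using that by (simp add: nn_integral_cmult_indicator)
    finally show ?thesis .
  qed
  have out_sum: "out V = (\<integral>\<^sup>+w. m 0 w V \<partial>count_space L)" for V
  proof -
    have "(\<integral>\<^sup>+w. m 0 w V \<partial>count_space L) = (\<integral>\<^sup>+y. \<integral>\<^sup>+w. \<integral>\<^sup>+x.
        (if R V x y \<and> cell x = 0 \<and> cell y = w then 1 else 0) \<partial>count_space V \<partial>count_space L \<partial>count_space V)"
      unfolding m_def by (intro nn_integral_count_space_nn_integral[OF L, symmetric]) simp
    also have "\<dots> = (\<integral>\<^sup>+y. \<integral>\<^sup>+x. \<integral>\<^sup>+w.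
        (if R V x y \<and> cell x = 0 \<and> cell y = w then 1 else 0) \<partial>count_space L \<partial>count_space V \<partial>count_space V)"
      by (intro nn_integral_cong nn_integral_count_space_nn_integral[OF L, symmetric]) simp
    also have "\<dots> = out V"
      unfolding out_def
      by (intro nn_integral_cong) (simp only: conj_assoc[symmetric] count_L[OF cell_L])
    finally show ?thesis ..
  qed
  have inn_sum: "inn w V = (\<integral>\<^sup>+z. m z w V \<partial>count_space L)" for w V
  proof -
    have "(\<integral>\<^sup>+z. m z w V \<partial>count_space L) = (\<integral>\<^sup>+y. \<integral>\<^sup>+z. \<integral>\<^sup>+x.
        (if R V x y \<and> cell x = z \<and> cell y = w then 1 else 0) \<partial>count_space V \<partial>count_space L \<partial>count_space V)"
      unfolding m_def by (intro nn_integral_count_space_nn_integral[OF L, symmetric]) simp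
    also have "\<dots> = (\<integral>\<^sup>+y. \<integral>\<^sup>+x. \<integral>\<^sup>+z.
        (if R V x y \<and> cell x = z \<and> cell y = w then 1 else 0) \<partial>count_space L \<partial>count_space V \<partial>count_space V)"
      by (intro nn_integral_cong nn_integral_count_space_nn_integral[OF L, symmetric]) simp
    also have "\<dots> = (\<integral>\<^sup>+y. \<integral>\<^sup>+x. \<integral>\<^sup>+z.
        (if (R V x y \<and> cell y = w) \<and> cell x = z then 1 else 0) \<partial>count_space L \<partial>count_space V \<partial>count_space V)"
      by (intro nn_integral_cong if_cong) auto
    also have "\<dots> = inn w V"
      unfolding inn_def by (intro nn_integral_cong) (simp only: count_L[OF cell_L])
    finally show ?thesis ..
  qed
  have out_le: "AE V in N. out V \<le> emeasure (count_space UNIV) (V \<inter> cbox 0 One)"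
  proof (rule AE_mp[OF functional], intro AE_I2 impI)
    fix V assume "V \<in> space N"
      and f: "\<forall>x\<in>V. \<forall>y\<in>V. \<forall>y'\<in>V. R V x y \<longrightarrow> R V x y' \<longrightarrow> y = y'"
    then have V: "countable V" by (simp add: space_N lf_config_imp_countable)
    have "out V = (\<integral>\<^sup>+x. \<integral>\<^sup>+y. (if R V x y \<and> cell x = 0 then 1 else 0) \<partial>count_space V \<partial>count_space V)"
      unfolding out_def by (intro nn_integral_count_space_nn_integral[OF V]) simp
    also have "\<dots> \<le> (\<integral>\<^sup>+x. indicator (cbox 0 One) x \<partial>count_space V)"
    proof (intro nn_integral_mono)
      fix x assume "x \<in> space (count_space V)"
      then have x: "x \<in> V" by simp
      let ?S = "{y \<in> V. R V x y \<and> cell x = 0}"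
      have S: "?S \<subseteq> {SOME y. y \<in> ?S}"
      proof
        fix y assume y: "y \<in> ?S"
        then have "(SOME y. y \<in> ?S) \<in> ?S" by (rule someI)
        with y f x show "y \<in> {SOME y. y \<in> ?S}" by blast
      qed
      have "(\<integral>\<^sup>+y. (if R V x y \<and> cell x = 0 then 1 else 0) \<partial>count_space V) =
          (\<integral>\<^sup>+y. indicator ?S y \<partial>count_space V)"
        by (intro nn_integral_cong) (simp add: indicator_def)
      also have "\<dots> = emeasure (count_space V) ?S" by simp
      also have "\<dots> \<le> indicator (cbox 0 One) x"
      proof (cases "?S = {}")
        case False
        then have "x \<in> cbox 0 One" by (auto intro: cell_eq_0_imp_cbox)
        moreover have "card ?S \<le> 1" using card_mono[OF _ S] by simp
        ultimately show ?thesis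
          using finite_subset[OF S] by (simp add: emeasure_count_space_finite)
      next
        case True
        show ?thesis unfolding True by simp
      qed
      finally show "(\<integral>\<^sup>+y. (if R V x y \<and> cell x = 0 then 1 else 0) \<partial>count_space V) \<le>
          indicator (cbox 0 One) x" .
    qed
    also have "\<dots> = emeasure (count_space UNIV) (V \<inter> cbox 0 One)"
    proof -
      have "(\<integral>\<^sup>+x. indicator (cbox 0 One) x \<partial>count_space V) =
          (\<integral>\<^sup>+x. indicator (cbox 0 One) x * indicator V x \<partial>count_space UNIV)"
        by (rule nn_integral_count_space_indicator) simp
      also have "\<dots> = (\<integral>\<^sup>+x. indicator (V \<inter> cbox 0 One) x \<partial>count_space UNIV)"
        by (intro nn_integral_cong) (simp split: split_indicator)
      finally show ?thesis by simp
    qed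
    finally show "out V \<le> emeasure (count_space UNIV) (V \<inter> cbox 0 One)" .
  qed
  have swap: "(\<integral>\<^sup>+V. \<integral>\<^sup>+w. f w V \<partial>count_space L \<partial>N) = (\<integral>\<^sup>+w. \<integral>\<^sup>+V. f w V \<partial>N \<partial>count_space L)"
    if "\<And>w. f w \<in> borel_measurable configs" for f
    using that by (intro nn_integral_count_space_nn_integral[OF L]) (simp add: measurable_N)
  \<comment> \<open>Both indices are translated by \<open>- z\<close>; then \<open>z\<close> is replaced by \<open>w - z\<close>.\<close>
  have reindex: "(\<integral>\<^sup>+z. E z w \<partial>count_space L) = (\<integral>\<^sup>+w. E 0 w \<partial>count_space L)" if w: "w \<in> L" for w
  proof -
    have neg: "- z \<in> L" "w - z \<in> L" if "z \<in> L" for z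
    proof -
      have z: "cell z = z" "cell w = w" using that w by (auto simp: L_def cell_cell)
      have neg_z: "cell (- z) = - z" using cell_uminus_cell[of z] by (simp add: z)
      with cell_L show "- z \<in> L" by metis
      have "cell (w - z) = w - z" using cell_add[of w "- z"] by (simp add: z neg_z)
      with cell_L show "w - z \<in> L" by metis
    qed
    have "bij_betw (\<lambda>z. w - z) L L"
      by (rule bij_betwI[of _ _ _ "\<lambda>z. w - z"]) (auto simp: neg)
    then have "(\<integral>\<^sup>+w. E 0 w \<partial>count_space L) = (\<integral>\<^sup>+z. E 0 (w - z) \<partial>count_space L)"
      by (rule nn_integral_bij_count_space[symmetric])
    also have "\<dots> = (\<integral>\<^sup>+z. E z w \<partial>count_space L)"
    proof (intro nn_integral_cong)
      fix z assume "z \<in> space (count_space L)"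
      then show "E 0 (w - z) = E z w" using E_shift[of z 0 "w - z"] by simp
    qed
    finally show ?thesis ..
  qed
  have inn_fin: "AE V in N. inn w V \<noteq> \<infinity>" if w: "w \<in> L" for w
  proof (rule nn_integral_PInf_AE)
    have "inn w \<in> borel_measurable configs"
      unfolding inn_def[abs_def]
    proof (rule measurable_sum_over_points)
      show "(\<lambda>(V, y). \<integral>\<^sup>+x. (if R V x y \<and> cell y = w then 1 else 0 :: ennreal)
          \<partial>count_space V) \<in> borel_measurable (configs \<Otimes>\<^sub>M borel)"
        unfolding split_def by (rule measurable_sum_over_points) measurable
    qed simp
    then show "inn w \<in> borel_measurable N" by (simp add: measurable_N)
    have "(\<integral>\<^sup>+V. inn w V \<partial>N) = (\<integral>\<^sup>+z. E z w \<partial>count_space L)"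
      unfolding inn_sum E_def by (rule swap) (rule m_meas)
    also have "\<dots> = (\<integral>\<^sup>+w. E 0 w \<partial>count_space L)" by (rule reindex[OF w])
    also have "\<dots> = (\<integral>\<^sup>+V. out V \<partial>N)"
      unfolding out_sum E_def by (rule swap[symmetric]) (rule m_meas)
    also have "\<dots> \<le> (\<integral>\<^sup>+V. emeasure (count_space UNIV) (V \<inter> cbox 0 One) \<partial>N)"
      by (rule nn_integral_mono_AE[OF out_le])
    also note intensity
    finally show "(\<integral>\<^sup>+V. inn w V \<partial>N) \<noteq> \<infinity>" by simp
  qed
  have all_fin: "AE V in N. \<forall>w\<in>L. inn w V \<noteq> \<infinity>"
    by (subst AE_ball_countable[OF L]) (intro ballI inn_fin)
  show ?thesis
  proof (rule AE_mp[OF all_fin], intro AE_I2 impI ballI)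
    fix V y assume fin: "\<forall>w\<in>L. inn w V \<noteq> \<infinity>" and y: "y \<in> V"
    have "emeasure (count_space V) {x\<in>V. R V x y} = (\<integral>\<^sup>+x. indicator {x\<in>V. R V x y} x \<partial>count_space V)"
      by simp
    also have "\<dots> = (\<integral>\<^sup>+x. (if R V x y \<and> cell y = cell y then 1 else 0) \<partial>count_space V)"
      by (intro nn_integral_cong) (simp add: indicator_def)
    also have "\<dots> \<le> inn (cell y) V"
      unfolding inn_def by (rule nn_integral_ge_point[OF y])
    also have "\<dots> < \<infinity>" using fin cell_L by (simp add: less_top)
    finally show "finite {x\<in>V. R V x y}"
      by (simp add: emeasure_count_space split: if_splits)
  qed
qed

end

section \<open>The point configuration of a point process\<close>

lemma lf_config_subset: "lf_config W \<Longrightarrow> V \<subseteq> W \<Longrightarrow> lf_config V"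
  unfolding lf_config_def by (meson Int_mono finite_subset order_refl)

lemma emeasure_count_config:
  assumes "lf_config V"
  shows "emeasure (count_space UNIV) V = (\<Sum>i. if first_index i V then 1 else 0)"
proof -
  have "(\<integral>\<^sup>+x. 1 \<partial>count_space V) = (\<integral>\<^sup>+x. 1 * indicator V x \<partial>count_space UNIV)"
    by (rule nn_integral_count_space_indicator) simp
  also have "\<dots> = emeasure (count_space UNIV) V"
    by (subst nn_integral_cmult_indicator) simp_all
  finally show ?thesis unfolding nn_integral_config[OF assms] ..
qed

text \<open>
Counts can be recovered from hitting events. A window contains exactly one point if it is hit but no two
disjoint base sets are hit inside it, and the number of points is the number of first indices.
\<close>

lemma measurable_configs_of_hits:
  fixes U :: "'b \<Rightarrow> 'a::euclidean_space set"
  assumes lf: "\<And>a. a \<in> space A \<Longrightarrow> lf_config (U a)"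
    and hit: "\<And>C. C \<in> sets borel \<Longrightarrow> Measurable.pred A (\<lambda>a. U a \<inter> C \<noteq> {})"
  shows "U \<in> A \<rightarrow>\<^sub>M configs"
proof (rule measurable_configsI[OF lf])
  fix B :: "'a set" assume B: "B \<in> sets borel"
  define hits where "hits C a \<longleftrightarrow> U a \<inter> (B \<inter> C) \<noteq> {}" for C a
  have [measurable]: "Measurable.pred A (hits C)" if "C \<in> sets borel" for C
    unfolding hits_def[abs_def] using that B by (intro hit) auto
  define sing where "sing i a \<longleftrightarrow> hits (base_set i) a \<and>
      \<not> (\<exists>j k. (base_set j :: 'a set) \<inter> base_set k = {} \<and>
           hits (base_set i \<inter> base_set j) a \<and> hits (base_set i \<inter> base_set k) a)" for i a
  have [measurable]: "Measurable.pred A (sing i)" for i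
    unfolding sing_def[abs_def] by measurable
  have single: "isolates i (U a \<inter> B) \<longleftrightarrow> sing i a" for i a
  proof
    assume "isolates i (U a \<inter> B)"
    then obtain x where "U a \<inter> B \<inter> base_set i = {x}" unfolding isolates_iff ..
    then have eq: "U a \<inter> (B \<inter> (base_set i \<inter> C)) = {x} \<inter> C" "U a \<inter> (B \<inter> base_set i) = {x}" for C
      by auto
    show "sing i a"
      unfolding sing_def hits_def eq
    proof (intro conjI notI)
      assume "\<exists>j k. (base_set j :: 'a set) \<inter> base_set k = {} \<and>
          {x} \<inter> base_set j \<noteq> {} \<and> {x} \<inter> base_set k \<noteq> {}"
      then obtain j k where jk: "(base_set j :: 'a set) \<inter> base_set k = {}"
        and xj: "{x} \<inter> base_set j \<noteq> {}" and xk: "{x} \<inter> base_set k \<noteq> {}" by (elim exE conjE)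
      have "x \<in> base_set j \<inter> base_set k" using xj xk by simp
      then have "x \<in> {}" unfolding jk .
      then show False by simp
    qed simp
  next
    assume s: "sing i a"
    then have "hits (base_set i) a" by (simp add: sing_def)
    then obtain x where x: "x \<in> U a \<inter> B \<inter> base_set i" unfolding hits_def by blast
    have "y = x" if y: "y \<in> U a \<inter> B \<inter> base_set i" for y
    proof (rule ccontr)
      assume "y \<noteq> x"
      then obtain j k where jk: "y \<in> base_set j" "x \<in> base_set k"
        "(base_set j :: 'a set) \<inter> base_set k = {}" by (rule base_set_separates)
      have "y \<in> U a \<inter> (B \<inter> (base_set i \<inter> base_set j))"
        "x \<in> U a \<inter> (B \<inter> (base_set i \<inter> base_set k))"
        using x y jk(1,2) by simp_all
      then have "hits (base_set i \<inter> base_set j) a" "hits (base_set i \<inter> base_set k) a"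
        unfolding hits_def by blast+
      with jk(3) have "(base_set j :: 'a set) \<inter> base_set k = {} \<and>
          hits (base_set i \<inter> base_set j) a \<and> hits (base_set i \<inter> base_set k) a"
        by (intro conjI)
      then have "\<exists>j k. (base_set j :: 'a set) \<inter> base_set k = {} \<and>
          hits (base_set i \<inter> base_set j) a \<and> hits (base_set i \<inter> base_set k) a"
        by (intro exI)
      with s show False unfolding sing_def by (elim conjE notE)
    qed
    with x have "U a \<inter> B \<inter> base_set i = {x}" by blast
    then show "isolates i (U a \<inter> B)" unfolding isolates_iff ..
  qed
  have fresh: "first_index i (U a \<inter> B) \<longleftrightarrow>
      sing i a \<and> (\<forall>j<i. \<not> (sing j a \<and> hits (base_set i \<inter> base_set j) a))" for i a
  proof -
    have "nth_point j (U a \<inter> B) = nth_point i (U a \<inter> B) \<longleftrightarrow> hits (base_set i \<inter> base_set j) a"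
      if "sing i a" "sing j a" for j
    proof -
      have "U a \<inter> B \<inter> base_set i = {nth_point i (U a \<inter> B)}"
        "U a \<inter> B \<inter> base_set j = {nth_point j (U a \<inter> B)}"
        using isolates_nth_point[of _ "U a \<inter> B"] that unfolding single by simp_all
      moreover have "U a \<inter> (B \<inter> (base_set i \<inter> base_set j)) =
          (U a \<inter> B \<inter> base_set i) \<inter> (U a \<inter> B \<inter> base_set j)" by blast
      ultimately show ?thesis unfolding hits_def by auto
    qed
    then show ?thesis unfolding first_index_def single by (simp cong: conj_cong)
  qed
  have "(\<lambda>a. \<Sum>i. if first_index i (U a \<inter> B) then 1 else 0 :: ennreal) \<in> borel_measurable A"
    unfolding fresh by measurable
  moreover have "emeasure (count_space UNIV) (U a \<inter> B) =
      (\<Sum>i. if first_index i (U a \<inter> B) then 1 else 0)" if "a \<in> space A" for a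
    by (intro emeasure_count_config lf_config_subset[OF lf[OF that]]) simp
  ultimately show "(\<lambda>a. emeasure (count_space UNIV) (U a \<inter> B)) \<in> borel_measurable A"
    by (subst measurable_cong) auto
qed

lemma space_point_measures: "space point_measures = {\<mu>. is_point_measure \<mu>}"
  by (auto simp: point_measures_def space_Sup_eq_UN)

lemma measurable_emeasure_point_measures:
  "B \<in> sets borel \<Longrightarrow> (\<lambda>\<mu>. emeasure \<mu> B) \<in> borel_measurable point_measures"
  by (auto intro!: measurable_Sup1 measurable_vimage_algebra1 simp: point_measures_def)

lemma measurable_point_measuresI:
  assumes "\<And>a. a \<in> space A \<Longrightarrow> is_point_measure (K a)"
    and "\<And>B. B \<in> sets borel \<Longrightarrow> (\<lambda>a. emeasure (K a) B) \<in> borel_measurable A"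
  shows "K \<in> A \<rightarrow>\<^sub>M point_measures"
  using assms by (auto intro!: measurable_Sup2 measurable_vimage_algebra2 simp: point_measures_def)

lemma Nats_ennreal_cases:
  assumes "x \<in> (\<nat> :: ennreal set)" obtains n :: nat where "x = of_nat n"
  using assms by (auto elim: Nats_cases)

lemma point_measure_in_Nats:
  "is_point_measure \<mu> \<Longrightarrow> B \<in> sets borel \<Longrightarrow> bounded B \<Longrightarrow> emeasure \<mu> B \<in> \<nat>"
  by (simp add: is_point_measure_def)

text \<open>
Integrality is only assumed on bounded sets; a set of smaller mass than 1 meets each ball in a null set.
\<close>

lemma point_measure_zero_or_ge_1:
  assumes "is_point_measure \<mu>" "B \<in> sets borel"
  shows "emeasure \<mu> B = 0 \<or> emeasure \<mu> B \<ge> 1"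
proof (rule disjCI)
  have [simp]: "sets \<mu> = sets borel" using assms by (simp add: is_point_measure_def)
  assume n1: "\<not> emeasure \<mu> B \<ge> 1"
  have null: "B \<inter> ball 0 (real n) \<in> null_sets \<mu>" for n :: nat
  proof -
    have "emeasure \<mu> (B \<inter> ball 0 (real n)) \<in> \<nat>"
      using assms by (intro point_measure_in_Nats) (auto intro: bounded_subset[OF bounded_ball])
    then obtain k :: nat where k: "emeasure \<mu> (B \<inter> ball 0 (real n)) = of_nat k"
      by (rule Nats_ennreal_cases)
    have "emeasure \<mu> (B \<inter> ball 0 (real n)) \<le> emeasure \<mu> B"
      using assms by (intro emeasure_mono) auto
    then have "of_nat k < (of_nat 1 :: ennreal)" 
      using n1 k by (metis le_less_trans not_le of_nat_1)
    then have "k = 0" by (simp only: of_nat_less_iff less_one)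
    then show ?thesis using assms k by (auto simp: null_sets_def)
  qed
  have "(\<Union>n. B \<inter> ball 0 (real n)) \<in> null_sets \<mu>" by (rule null_sets_UN) (rule null)
  moreover have "(\<Union>n. B \<inter> ball 0 (real n)) = B" by (auto simp: reals_Archimedean2)
  ultimately show "emeasure \<mu> B = 0" by (simp add: null_sets_def)
qed

text \<open>
On subsets of \<open>A\<close> the measure takes only the values 0 and 1. Discard all null base sets: what is left has
mass 1, and it cannot contain two points, since disjoint base sets around them would both have mass 1.
\<close>

lemma atom_of_measure_1:
  assumes \<mu>: "is_point_measure \<mu>" and A: "A \<in> sets borel" "emeasure \<mu> A = 1"
  obtains x where "x \<in> A" "emeasure \<mu> {x} = 1"
proof -
  have [simp]: "sets \<mu> = sets borel" using \<mu> by (simp add: is_point_measure_def)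
  define I where "I = {i. emeasure \<mu> (A \<inter> base_set i) = 0}"
  define Z where "Z = (\<Union>i\<in>I. A \<inter> base_set i)"
  have "Z \<in> null_sets \<mu>"
    unfolding Z_def using A by (intro null_sets_UN') (auto simp: I_def null_sets_def)
  then have mass: "emeasure \<mu> (A - Z) = 1"
    using A emeasure_Diff_null_set[of Z \<mu> A] by simp
  then have "A - Z \<noteq> {}" by (intro notI) simp
  then obtain x where x: "x \<in> A - Z" by blast
  have "y = x" if y: "y \<in> A - Z" for y
  proof (rule ccontr)
    assume "y \<noteq> x"
    then obtain j k where jk: "y \<in> base_set j" "x \<in> base_set k"
      "(base_set j :: 'a set) \<inter> base_set k = {}" by (rule base_set_separates)
    have "j \<notin> I" "k \<notin> I" using x y jk(1,2) by (auto simp: Z_def)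
    then have ge: "emeasure \<mu> (A \<inter> base_set j) \<ge> 1" "emeasure \<mu> (A \<inter> base_set k) \<ge> 1"
      using point_measure_zero_or_ge_1[OF \<mu>, of "A \<inter> base_set j"]
        point_measure_zero_or_ge_1[OF \<mu>, of "A \<inter> base_set k"] A by (auto simp: I_def)
    have "(1 :: ennreal) + 1 \<le> emeasure \<mu> (A \<inter> base_set j) + emeasure \<mu> (A \<inter> base_set k)"
      using ge by (rule add_mono)
    also have "\<dots> = emeasure \<mu> (A \<inter> base_set j \<union> A \<inter> base_set k)"
      using A jk(3) by (intro plus_emeasure) auto
    also have "\<dots> \<le> emeasure \<mu> A" using A by (intro emeasure_mono) auto
    finally show False using A by simp
  qed
  with x have "A - Z = {x}" by blast
  with mass x that show thesis by auto
qed

text \<open>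
An atom of mass 1 has small neighbourhoods of mass less than 2, hence of mass 1, and some base set fits between
the atom and the neighbourhood. Conversely, a set of mass 1 contains such an atom.
\<close>

lemma support_hits_iff:
  assumes \<mu>: "is_point_measure \<mu>" and C: "C \<in> sets borel"
  shows "support \<mu> \<inter> C \<noteq> {} \<longleftrightarrow> (\<exists>i. emeasure \<mu> (C \<inter> base_set i) = 1)"
proof
  have [simp]: "sets \<mu> = sets borel" using \<mu> by (simp add: is_point_measure_def)
  assume "support \<mu> \<inter> C \<noteq> {}"
  then obtain x where x: "emeasure \<mu> {x} = 1" "x \<in> C" by (auto simp: support_def)
  \<comment> \<open>Bounded neighbourhoods of the atom within \<open>C\<close>, of integer mass tending to 1.\<close>
  define D where "D n = C \<inter> ball x (1 / real (Suc n))" for n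
  have D: "emeasure \<mu> (D n) \<in> \<nat>" for n
    unfolding D_def using \<mu> C
    by (intro point_measure_in_Nats) (auto intro: bounded_subset[OF bounded_ball])
  have fin: "emeasure \<mu> (D n) \<noteq> \<infinity>" for n
    using D[of n] by (auto elim!: Nats_cases)
  have "(\<lambda>n. emeasure \<mu> (D n)) \<longlonglongrightarrow> emeasure \<mu> (\<Inter>n. D n)"
  proof (rule Lim_emeasure_decseq)
    show "decseq D"
      unfolding decseq_def D_def
    proof (intro allI impI Int_mono order_refl subset_ball)
      fix i j :: nat assume "i \<le> j"
      then show "1 / real (Suc j) \<le> 1 / real (Suc i)" by (simp add: frac_le)
    qed
  qed (use C fin in \<open>auto simp: D_def\<close>)
  also have "(\<Inter>n. D n) = {x}"
  proof (intro equalityI subsetI)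
    fix y assume y: "y \<in> (\<Inter>n. D n)"
    show "y \<in> {x}"
    proof (rule ccontr)
      assume "y \<notin> {x}"
      then obtain n where "inverse (real (Suc n)) < dist x y"
        using reals_Archimedean[of "dist x y"] by auto
      moreover have "y \<in> D n" using y by blast
      ultimately show False by (simp add: D_def inverse_eq_divide)
    qed
  qed (use x in \<open>auto simp: D_def\<close>)
  finally have "(\<lambda>n. emeasure \<mu> (D n)) \<longlonglongrightarrow> 1" using x by simp
  then have "\<forall>\<^sub>F n in sequentially. emeasure \<mu> (D n) < 2"
    by (rule order_tendstoD) simp
  then obtain n where n: "emeasure \<mu> (D n) < 2" by (auto simp: eventually_sequentially)
  obtain k :: nat where k: "emeasure \<mu> (D n) = of_nat k" using D[of n] by (rule Nats_ennreal_cases)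
  have "of_nat k < (of_nat 2 :: ennreal)" using n k by simp
  then have "k < 2" by (simp only: of_nat_less_iff)
  then have le: "emeasure \<mu> (D n) \<le> 1" using k by (cases k) auto
  obtain i where i: "x \<in> base_set i" "base_set i \<subseteq> ball x (1 / real (Suc n))"
    using base_set_near[of "ball x (1 / real (Suc n))" x] by auto
  have "emeasure \<mu> (C \<inter> base_set i) \<le> emeasure \<mu> (D n)"
    using i C by (intro emeasure_mono) (auto simp: D_def)
  moreover have "emeasure \<mu> {x} \<le> emeasure \<mu> (C \<inter> base_set i)"
    using i x C by (intro emeasure_mono) auto
  ultimately show "\<exists>i. emeasure \<mu> (C \<inter> base_set i) = 1"
    using le x by (intro exI[of _ i] antisym) auto
next
  assume "\<exists>i. emeasure \<mu> (C \<inter> base_set i) = 1"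
  then obtain i where i: "emeasure \<mu> (C \<inter> base_set i) = 1" ..
  obtain x where "x \<in> C \<inter> base_set i" "emeasure \<mu> {x} = 1"
    by (rule atom_of_measure_1[OF \<mu> _ i]) (use C in auto)
  then show "support \<mu> \<inter> C \<noteq> {}" by (auto simp: support_def)
qed

text \<open>
Used for local finiteness of the support and for its intensity.
\<close>

lemma emeasure_support_le:
  assumes \<mu>: "is_point_measure \<mu>" and B: "B \<in> sets borel"
  shows "emeasure (count_space UNIV) (support \<mu> \<inter> B) \<le> emeasure \<mu> B"
proof -
  have [simp]: "sets \<mu> = sets borel" using \<mu> by (simp add: is_point_measure_def)
  have card_le: "of_nat (card F) \<le> emeasure \<mu> B" if F: "finite F" "F \<subseteq> support \<mu> \<inter> B" for F
  proof -
    have "of_nat (card F) = (\<Sum>x\<in>F. emeasure \<mu> {x})"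
      using F by (simp add: support_def subset_eq)
    also have "\<dots> = emeasure \<mu> F"
      using F by (intro emeasure_eq_sum_singleton[symmetric]) auto
    also have "\<dots> \<le> emeasure \<mu> B" using F B by (intro emeasure_mono) auto
    finally show ?thesis .
  qed
  show ?thesis
  proof (cases "finite (support \<mu> \<inter> B)")
    case True
    then show ?thesis using card_le by (simp add: emeasure_count_space)
  next
    case False
    have "of_nat n \<le> emeasure \<mu> B" for n :: nat
    proof -
      obtain F where "finite F" "card F = n" "F \<subseteq> support \<mu> \<inter> B"
        using infinite_arbitrarily_large[OF False] by blast
      then show ?thesis using card_le by blast
    qed
    then have "emeasure \<mu> B = \<infinity>"
      using ennreal_Ex_less_of_nat[of "emeasure \<mu> B"]
      by (metis infinity_ennreal_def not_le top.not_eq_extremum)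
    then show ?thesis by simp
  qed
qed

lemma lf_config_support:
  assumes \<mu>: "is_point_measure \<mu>" shows "lf_config (support \<mu>)"
  unfolding lf_config_iff_balls
proof
  fix n :: nat
  have "emeasure \<mu> (ball 0 (real n)) \<in> \<nat>" using \<mu> by (simp add: is_point_measure_def)
  then have "emeasure \<mu> (ball 0 (real n)) < \<infinity>" by (auto elim!: Nats_cases simp: of_nat_less_top)
  with emeasure_support_le[OF \<mu>, of "ball 0 (real n)"]
  show "emeasure (count_space UNIV) (support \<mu> \<inter> ball 0 (real n)) < \<infinity>" by simp
qed

lemma measurable_support: "support \<in> point_measures \<rightarrow>\<^sub>M configs"
proof (rule measurable_configs_of_hits)
  fix C :: "'a set" assume C: "C \<in> sets borel"
  have [measurable]: "(\<lambda>\<mu>. emeasure \<mu> (C \<inter> base_set i)) \<in> borel_measurable point_measures" for i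
    using C by (intro measurable_emeasure_point_measures) auto
  have "Measurable.pred point_measures (\<lambda>\<mu>. \<exists>i. emeasure \<mu> (C \<inter> base_set i) = 1)" by measurable
  moreover have "Measurable.pred point_measures (\<lambda>\<mu>. support \<mu> \<inter> C \<noteq> {}) \<longleftrightarrow>
      Measurable.pred point_measures (\<lambda>\<mu>. \<exists>i. emeasure \<mu> (C \<inter> base_set i) = 1)"
    by (rule measurable_cong) (simp add: support_hits_iff[OF _ C] space_point_measures)
  ultimately show "Measurable.pred point_measures (\<lambda>\<mu>. support \<mu> \<inter> C \<noteq> {})" by simp
qed (simp add: space_point_measures lf_config_support)

definition config_law :: "'w measure \<Rightarrow> ('w \<Rightarrow> 'a::euclidean_space measure) \<Rightarrow> 'a set measure" where
  "config_law P M = distr P configs (\<lambda>\<omega>. support (M \<omega>))"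

lemma support_distr_translation:
  assumes \<mu>: "sets \<mu> = sets borel"
  shows "support (distr \<mu> borel ((+) t)) = (+) t ` support \<mu>"
proof -
  have "emeasure (distr \<mu> borel ((+) t)) {x} = emeasure \<mu> {x - t}" for x
  proof -
    have "(+) t \<in> \<mu> \<rightarrow>\<^sub>M borel" by (simp add: measurable_cong_sets[OF \<mu> refl])
    then have "emeasure (distr \<mu> borel ((+) t)) {x} = emeasure \<mu> ((+) t -` {x} \<inter> space \<mu>)"
      by (rule emeasure_distr) simp
    also have "(+) t -` {x} \<inter> space \<mu> = {x - t}"
      using sets_eq_imp_space_eq[OF \<mu>] by auto
    finally show ?thesis .
  qed
  then have "support (distr \<mu> borel ((+) t)) = {x. x - t \<in> support \<mu>}"
    by (simp add: support_def)
  also have "\<dots> = (+) t ` support \<mu>" by (auto intro: image_eqI[of _ _ "_ - t"])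
  finally show ?thesis .
qed

lemma measurable_distr_translate:
  "(\<lambda>\<mu>. distr \<mu> borel ((+) t)) \<in> point_measures \<rightarrow>\<^sub>M (point_measures :: 'a::euclidean_space measure measure)"
proof -
  have vimage: "(+) t -` B \<in> sets borel" if "B \<in> sets borel" for B :: "'a set"
    using measurable_sets[of "(+) t" borel borel B] that by simp
  have em: "emeasure (distr \<mu> borel ((+) t)) B = emeasure \<mu> ((+) t -` B)"
    if "is_point_measure \<mu>" "B \<in> sets borel" for \<mu> and B :: "'a set"
  proof -
    have \<mu>: "sets \<mu> = sets borel" using that by (simp add: is_point_measure_def)
    have "(+) t \<in> \<mu> \<rightarrow>\<^sub>M borel" by (simp add: measurable_cong_sets[OF \<mu> refl])
    then show ?thesis
      using that sets_eq_imp_space_eq[OF \<mu>] by (simp add: emeasure_distr)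
  qed
  have bounded: "bounded ((+) t -` B)" if "bounded B" for B
  proof -
    have "(+) t -` B = (+) (- t) ` B" by (auto intro: image_eqI[of _ _ "t + _"])
    then show ?thesis using bounded_translation[OF that, of "- t"] by simp
  qed
  show ?thesis
  proof (rule measurable_point_measuresI)
    fix \<mu> :: "'a measure" assume "\<mu> \<in> space point_measures"
    then have \<mu>: "is_point_measure \<mu>" by (simp add: space_point_measures)
    show "is_point_measure (distr \<mu> borel ((+) t))"
      unfolding is_point_measure_def
      using point_measure_in_Nats[OF \<mu>] by (simp add: em[OF \<mu>] vimage bounded)
  next
    fix B :: "'a set" assume B: "B \<in> sets borel"
    have "(\<lambda>\<mu>. emeasure \<mu> ((+) t -` B)) \<in> borel_measurable point_measures"
      by (rule measurable_emeasure_point_measures[OF vimage[OF B]])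
    then show "(\<lambda>\<mu>. emeasure (distr \<mu> borel ((+) t)) B) \<in> borel_measurable point_measures"
      using B by (subst measurable_cong[of _ _ "\<lambda>\<mu>. emeasure \<mu> ((+) t -` B)"])
        (auto simp: em space_point_measures)
  qed
qed

lemma measurable_support_process:
  "point_process P M \<Longrightarrow> (\<lambda>\<omega>. support (M \<omega>)) \<in> P \<rightarrow>\<^sub>M configs"
  unfolding point_process_def by (rule measurable_compose[OF _ measurable_support]) simp

text \<open>
Taking the support commutes with translations, so invariance passes from the process to its configuration, and
the intensity only decreases.
\<close>

lemma stationary_config_law:
  fixes M :: "'w \<Rightarrow> 'a::euclidean_space measure"
  assumes pp: "point_process P M" and int: "finite_intensity P M" and inv: "isometry_invariant P M"
  shows "stationary_config (config_law P M)"
proof -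
  interpret prob_space P using pp by (simp add: point_process_def)
  have M [measurable]: "M \<in> P \<rightarrow>\<^sub>M point_measures" using pp by (simp add: point_process_def)
  have pm: "is_point_measure (M \<omega>)" if "\<omega> \<in> space P" for \<omega>
    using measurable_space[OF M that] by (simp add: space_point_measures)
  note supp = measurable_support_process[OF pp]
  interpret N: prob_space "config_law P M"
    unfolding config_law_def by (rule prob_space_distr[OF supp])
  show ?thesis
  proof unfold_locales
    show "sets (config_law P M) = sets configs" by (simp add: config_law_def)
    show "distr (config_law P M) configs ((`) ((+) t)) = config_law P M" for t
    proof -
      have "distr (config_law P M) configs ((`) ((+) t)) =
          distr P configs (\<lambda>\<omega>. (+) t ` support (M \<omega>))"
        unfolding config_law_def by (subst distr_distr[OF measurable_translate supp]) (simp add: o_def)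
      also have "\<dots> = distr P configs (\<lambda>\<omega>. support (distr (M \<omega>) borel ((+) t)))"
        using pm by (intro distr_cong refl support_distr_translation[symmetric]) (simp add: is_point_measure_def)
      also have "\<dots> = distr (distr P point_measures (\<lambda>\<omega>. distr (M \<omega>) borel ((+) t))) configs support"
        by (subst distr_distr[OF measurable_support measurable_compose[OF M measurable_distr_translate]])
          (simp add: o_def)
      also have "\<dots> = distr (distr P point_measures M) configs support"
        using inv isometry_translation[of t] by (simp add: isometry_invariant_def)
      also have "\<dots> = config_law P M"
        unfolding config_law_def by (subst distr_distr[OF measurable_support M]) (simp add: o_def)
      finally show ?thesis .
    qed
    have "(\<integral>\<^sup>+V. emeasure (count_space UNIV) (V \<inter> cbox 0 One) \<partial>config_law P M) =
        (\<integral>\<^sup>+\<omega>. emeasure (count_space UNIV) (support (M \<omega>) \<inter> cbox 0 One) \<partial>P)"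
      unfolding config_law_def
      by (intro nn_integral_distr[OF supp] measurable_number_of_points_configs) simp
    also have "\<dots> \<le> (\<integral>\<^sup>+\<omega>. emeasure (M \<omega>) (cbox 0 One) \<partial>P)"
      by (intro nn_integral_mono emeasure_support_le pm) auto
    also have "\<dots> < \<infinity>" using int by (simp add: finite_intensity_def)
    finally show "(\<integral>\<^sup>+V. emeasure (count_space UNIV) (V \<inter> cbox 0 One) \<partial>config_law P M) < \<infinity>" .
  qed
qed

section \<open>Factor graphs defined by relations\<close>

lemma measurable_configs_countable_sets: "(\<lambda>V. V) \<in> configs \<rightarrow>\<^sub>M countable_sets"
  unfolding configs_def by (rule measurable_restrict_space1) simp

text \<open>
The law on all countable sets gives no mass to sets that are not locally finite, so null sets for the law on
locally finite configurations remain null sets.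
\<close>

lemma AE_support_law:
  assumes pp: "point_process P M" and Q: "AE V in config_law P M. Q V"
  shows "AE V in support_law P M. Q V"
proof -
  note supp = measurable_support_process[OF pp]
  have law: "support_law P M = distr (config_law P M) countable_sets (\<lambda>V. V)"
    unfolding config_law_def support_law_def
    by (subst distr_distr[OF measurable_configs_countable_sets supp]) (simp add: o_def)
  have id: "(\<lambda>V. V) \<in> config_law P M \<rightarrow>\<^sub>M countable_sets"
    using measurable_configs_countable_sets unfolding config_law_def by simp
  obtain Z where Z: "{V \<in> space (config_law P M). \<not> Q V} \<subseteq> Z" "emeasure (config_law P M) Z = 0"
    "Z \<in> sets (config_law P M)" by (rule AE_E[OF Q])
  define Z' where "Z' = Z \<union> (space countable_sets - {V. lf_config V})"
  have Z': "Z' \<in> sets countable_sets"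
    using Z(3) unfolding Z'_def config_law_def
    by (intro sets.Un sets.Diff sets.top sets_lf_config sets_configs_subset) simp
  have "emeasure (support_law P M) Z' = emeasure (config_law P M) (Z' \<inter> space (config_law P M))"
    unfolding law by (subst emeasure_distr[OF id Z']) (simp add: vimage_def)
  also have "Z' \<inter> space (config_law P M) = Z"
    using sets.sets_into_space[OF Z(3)] by (auto simp: Z'_def config_law_def space_configs)
  finally have "Z' \<in> null_sets (support_law P M)"
    using Z(2) Z' by (simp add: null_sets_def support_law_def)
  then show ?thesis
    by (rule AE_I') (use Z(1) in \<open>auto simp: Z'_def config_law_def support_law_def space_configs\<close>)
qed

lemma measurable_lf_part:
  "(\<lambda>V. if lf_config V then V else {}) \<in> countable_sets \<rightarrow>\<^sub>M configs"
proof (rule measurable_configsI)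
  fix B :: "'a set" assume B: "B \<in> sets borel"
  have "{V \<in> space countable_sets. lf_config (V :: 'a set)} = {V. lf_config V}"
    by (auto simp: space_countable_sets intro: lf_config_imp_countable)
  then have "(\<lambda>V. if lf_config V then emeasure (count_space UNIV) (V \<inter> B) else 0) \<in>
      borel_measurable countable_sets"
    by (intro measurable_If measurable_number_of_points[OF B]) (simp_all add: sets_lf_config)
  then show "(\<lambda>V. emeasure (count_space UNIV) ((if lf_config V then V else {}) \<inter> B)) \<in>
      borel_measurable countable_sets"
    by (rule measurable_cong[THEN iffD1, rotated]) simp
qed (simp add: lf_config_def)

text \<open>
Reduces a factor graph to an equivariant, jointly measurable relation and an isometry-invariant class of
configurations of full probability, outside of which the graph is left undefined. The measurable
edge set evaluates the relation after replacing sets that are not locally finite by the empty set.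
\<close>

lemma factor_graph_of_relation:
  fixes M :: "'w \<Rightarrow> 'a::euclidean_space measure" and R :: "'a set \<Rightarrow> 'a \<Rightarrow> 'a \<Rightarrow> bool"
  assumes pp: "point_process P M"
    and good_lf: "\<And>V. good V \<Longrightarrow> lf_config V"
    and good_AE: "AE V in config_law P M. good V"
    and good_iso: "\<And>\<theta> V. isometry \<theta> \<Longrightarrow> good (\<theta> ` V) = good V"
    and R_in: "\<And>V x y. R V x y \<Longrightarrow> x \<in> V \<and> y \<in> V"
    and R_iso: "\<And>\<theta> V x y. isometry \<theta> \<Longrightarrow> R (\<theta> ` V) (\<theta> x) (\<theta> y) = R V x y"
    and R_meas: "Measurable.pred (configs \<Otimes>\<^sub>M borel \<Otimes>\<^sub>M borel) (\<lambda>(V, x, y). R V x y)"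
  shows "factor_graph P M
    (\<lambda>V. if good V then Some \<lparr>pverts = V, parcs = {(x, y). R V x y}\<rparr> else None)"
    (is "factor_graph P M ?G")
  unfolding factor_graph_def
proof (intro conjI allI impI)
  fix V g assume g: "?G V = Some g"
  then have good: "good V" and g: "g = \<lparr>pverts = V, parcs = {(x, y). R V x y}\<rparr>"
    by (auto split: if_splits)
  show "countable V" by (rule lf_config_imp_countable[OF good_lf[OF good]])
  show "pverts g = V" by (simp add: g)
  show "pair_wf_digraph g" using R_in by unfold_locales (auto simp: g)
next
  show "AE V in support_law P M. V \<in> dom ?G"
    by (rule AE_mp[OF AE_support_law[OF pp good_AE]]) auto
next
  fix \<theta> :: "'a \<Rightarrow> 'a" and V assume \<theta>: "isometry \<theta>"
  have "{(x, y). R (\<theta> ` V) x y} = map_prod \<theta> \<theta> ` {(x, y). R V x y}"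
  proof (intro equalityI subsetI)
    fix p assume "p \<in> {(x, y). R (\<theta> ` V) x y}"
    then obtain x y where p: "p = (x, y)" "R (\<theta> ` V) x y" by auto
    then obtain x' y' where "x = \<theta> x'" "y = \<theta> y'" using R_in by blast
    with p R_iso[OF \<theta>] show "p \<in> map_prod \<theta> \<theta> ` {(x, y). R V x y}" by force
  qed (use R_iso[OF \<theta>] in auto)
  then show "?G (\<theta> ` V) = map_option (image_graph \<theta>) (?G V)"
    by (simp add: good_iso[OF \<theta>] image_graph_def)
next
  define r :: "'a set \<Rightarrow> 'a set" where "r V = (if lf_config V then V else {})" for V
  have [measurable]: "r \<in> countable_sets \<rightarrow>\<^sub>M configs"
    unfolding r_def[abs_def] by (rule measurable_lf_part)
  note [measurable (raw)] = pred_relation[OF R_meas]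
  define E where "E = {p \<in> space (borel \<Otimes>\<^sub>M borel \<Otimes>\<^sub>M countable_sets).
    R (r (snd (snd p))) (fst p) (fst (snd p))}"
  show "\<exists>E\<in>sets (borel \<Otimes>\<^sub>M borel \<Otimes>\<^sub>M countable_sets). AE V in support_law P M.
      \<forall>x y. ((x, y, V) \<in> E) = (\<exists>g. ?G V = Some g \<and> (x, y) \<in> parcs g)"
  proof (rule bexI[of _ E])
    show "E \<in> sets (borel \<Otimes>\<^sub>M borel \<Otimes>\<^sub>M countable_sets)" unfolding E_def by measurable
    show "AE V in support_law P M. \<forall>x y. ((x, y, V) \<in> E) =
        (\<exists>g. ?G V = Some g \<and> (x, y) \<in> parcs g)"
    proof (rule AE_mp[OF AE_support_law[OF pp good_AE]], intro AE_I2 impI allI)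
      fix V x y assume "good V"
      then show "((x, y, V) \<in> E) = (\<exists>g. ?G V = Some g \<and> (x, y) \<in> parcs g)"
        using good_lf[of V] lf_config_imp_countable[of V]
        by (simp add: E_def r_def space_pair_measure space_countable_sets)
    qed
  qed
qed

section \<open>Components of a graph\<close>

text \<open>
The subgraph induced on the vertices that can be reached from \<open>v\<close> along arcs in either direction.
\<close>

definition component_at :: "'a pair_pre_digraph \<Rightarrow> 'a \<Rightarrow> 'a pair_pre_digraph" where
  "component_at g v = (let W = {w. (v, w) \<in> (parcs g \<union> (parcs g)\<inverse>)\<^sup>*}
     in \<lparr>pverts = W, parcs = parcs g \<inter> W \<times> W\<rparr>)"

lemma pverts_component_at:
  "pverts (component_at g v) = {w. (v, w) \<in> (parcs g \<union> (parcs g)\<inverse>)\<^sup>*}"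
  by (simp add: component_at_def Let_def)

lemma parcs_component_at:
  "(x, y) \<in> parcs (component_at g v) \<longleftrightarrow> (x, y) \<in> parcs g \<and> x \<in> pverts (component_at g v)"
  by (auto simp: component_at_def Let_def intro: rtrancl_into_rtrancl)

lemma component_at_closed:
  assumes "w \<in> pverts (component_at g v)" "(w, w') \<in> parcs g \<or> (w', w) \<in> parcs g"
  shows "w' \<in> pverts (component_at g v)"
  using assms by (auto simp: pverts_component_at intro: rtrancl_into_rtrancl)

lemma component_at_subset:
  assumes "pair_wf_digraph g" "v \<in> pverts g" "w \<in> pverts (component_at g v)"
  shows "w \<in> pverts g"
proof -
  have "(v, w) \<in> (parcs g \<union> (parcs g)\<inverse>)\<^sup>*" using assms(3) by (simp add: pverts_component_at)
  then show ?thesis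
    by induction (use assms(1,2) in \<open>auto dest: pair_wf_digraph.in_arcsD1 pair_wf_digraph.in_arcsD2\<close>)
qed

text \<open>
Walks in the whole graph that start in the component stay in it, so they are walks of the component.
\<close>

lemma connected_component_at: "Digraph_Component.connected (with_proj (component_at g v))"
proof -
  define W where "W = pverts (component_at g v)"
  define S where "S = parcs (mk_symmetric (with_proj (component_at g v)))"
  have S: "(x, y) \<in> S \<longleftrightarrow> ((x, y) \<in> parcs g \<or> (y, x) \<in> parcs g) \<and> x \<in> W" for x y
  proof -
    have "(x, y) \<in> S \<longleftrightarrow> (x, y) \<in> parcs (component_at g v) \<or> (y, x) \<in> parcs (component_at g v)"
      unfolding S_def parcs_mk_symmetric with_proj_simps
      by (auto intro: bexI[of _ "(x, y)"] bexI[of _ "(y, x)"])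
    then show ?thesis
      unfolding W_def by (auto simp: parcs_component_at intro: component_at_closed)
  qed
  have sym: "sym S"
    unfolding sym_def S W_def by (auto intro: component_at_closed)
  have v: "v \<in> W" by (simp add: W_def pverts_component_at)
  have reach: "(v, w) \<in> rtrancl_on W S" if "w \<in> W" for w
  proof -
    have "(v, w) \<in> (parcs g \<union> (parcs g)\<inverse>)\<^sup>*" using that by (simp add: W_def pverts_component_at)
    then show ?thesis
    proof induction
      case (step y z)
      have "y \<in> W" using step.IH by (rule in_rtrancl_on_in_F)
      moreover have "z \<in> W" 
        using step.hyps(2) component_at_closed[OF \<open>y \<in> W\<close>[unfolded W_def], of z]
        by (auto simp: W_def)
      ultimately show ?case
        using step by (intro rtrancl_on_into_rtrancl_on[OF step.IH]) (auto simp: S)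
    qed (use v in auto)
  qed
  have "(u, w) \<in> rtrancl_on W S" if "u \<in> W" "w \<in> W" for u w
    using rtrancl_on_trans[OF symD[OF rtrancl_on_sym[OF sym] reach[OF that(1)]] reach[OF that(2)]] .
  then show ?thesis
    using v unfolding Digraph_Component.connected_def strongly_connected_def reachable_def
    by (auto simp: W_def S_def)
qed

text \<open>
A maximal connected subgraph is contained in the connected subgraph induced on all vertices reachable from
one of its vertices, and therefore equals it.
\<close>

lemma graph_components_component_at:
  assumes g: "pair_wf_digraph g" and C: "C \<in> graph_components (with_proj g)"
  shows "\<exists>v\<in>pverts g. C = with_proj (component_at g v)"
proof -
  have sub: "subgraph C (with_proj g)" and conn: "Digraph_Component.connected C"
    and max: "\<And>H. H \<noteq> C \<Longrightarrow> subgraph C H \<Longrightarrow> subgraph H (with_proj g) \<Longrightarrow>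
      \<not> Digraph_Component.connected H"
    using C unfolding graph_components_def pre_digraph.max_subgraph_def by auto
  have wf_C: "wf_digraph C" and comp: "compatible (with_proj g) C"
    and arcs_C: "arcs C \<subseteq> parcs g" and verts_C: "verts C \<subseteq> pverts g"
    using sub by (auto simp: subgraph_def)
  have tail: "tail C = fst" and head: "head C = snd" using comp by (auto simp: compatible_def)
  obtain v where v: "v \<in> verts C"
    using conn by (auto simp: Digraph_Component.connected_def strongly_connected_def)
  let ?K = "with_proj (component_at g v)"
  have wf_K: "wf_digraph ?K"
    by unfold_locales (auto simp: parcs_component_at intro: component_at_closed)
  have "subgraph ?K (with_proj g)"
    unfolding subgraph_def
  proof (intro conjI)
    show "verts ?K \<subseteq> verts (with_proj g)" using component_at_subset[OF g] v verts_C by auto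
    show "arcs ?K \<subseteq> arcs (with_proj g)" by (auto simp: parcs_component_at)
    show "wf_digraph (with_proj g)" using sub by (simp add: subgraph_def)
  qed (auto intro: wf_K)
  moreover have "subgraph C ?K"
  proof -
    have reach: "verts C \<subseteq> pverts (component_at g v)"
    proof
      fix w assume "w \<in> verts C"
      then have "(v, w) \<in> rtrancl_on (verts C) (parcs (mk_symmetric C))"
        using conn v by (auto simp: Digraph_Component.connected_def strongly_connected_def reachable_def)
      then have "(v, w) \<in> (parcs (mk_symmetric C))\<^sup>*" by (rule rtrancl_on_rtranclI)
      moreover have "parcs (mk_symmetric C) \<subseteq> parcs g \<union> (parcs g)\<inverse>"
        using arcs_C by (auto simp: parcs_mk_symmetric tail head)
      ultimately have "(v, w) \<in> (parcs g \<union> (parcs g)\<inverse>)\<^sup>*"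
        using rtrancl_mono[THEN subsetD] by metis
      then show "w \<in> pverts (component_at g v)" by (simp add: pverts_component_at)
    qed
    moreover have "arcs C \<subseteq> parcs (component_at g v)"
    proof
      fix e assume e: "e \<in> arcs C"
      then have "fst e \<in> verts C" using wf_digraph.tail_in_verts[OF wf_C e] by (simp add: tail)
      with e arcs_C reach show "e \<in> parcs (component_at g v)"
        by (cases e) (auto simp: parcs_component_at)
    qed
    ultimately show ?thesis
      using wf_C wf_K by (auto simp: subgraph_def compatible_def tail head)
  qed
  ultimately have "?K = C" using max[of ?K] connected_component_at[of g v] by argo
  with v verts_C show ?thesis by (intro bexI[of _ v]) auto
qed

section \<open>Forests with levels\<close>

text \<open>
The relation \<open>p x y\<close> says that \<open>y\<close> is the parent of \<open>x\<close>. Every vertex has a parent, so there are no roots: climbing never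
ends, while levels in the natural numbers limit every descent.
\<close>

locale leveled_forest =
  fixes V :: "'a set" and p :: "'a \<Rightarrow> 'a \<Rightarrow> bool" and level :: "'a \<Rightarrow> nat"
  assumes p_in: "p x y \<Longrightarrow> x \<in> V \<and> y \<in> V"
    and p_level: "p x y \<Longrightarrow> level x < level y"
    and p_total: "x \<in> V \<Longrightarrow> \<exists>y. p x y"
    and p_unique: "p x y \<Longrightarrow> p x y' \<Longrightarrow> y = y'"
    and p_finite: "finite {x. p x y}"
begin

lemma p_irrefl: "\<not> p x x"
  using p_level[of x x] by auto

text \<open>
Undirected edges between children and parents.
\<close>

definition tree_graph :: "'a pair_pre_digraph" where
  "tree_graph = \<lparr>pverts = V, parcs = {(x, y). p x y \<or> p y x}\<rparr>"

lemma undirected_tree_graph: "undirected tree_graph"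
proof unfold_locales
  show "symmetric (with_proj tree_graph)"
    unfolding symmetric_def with_proj_simps sym_def by (simp add: tree_graph_def)
next
  fix e assume "e \<in> parcs tree_graph"
  then have e: "p (fst e) (snd e) \<or> p (snd e) (fst e)" by (cases e) (simp add: tree_graph_def)
  then show "fst e \<in> pverts tree_graph" "snd e \<in> pverts tree_graph"
    using p_in by (simp_all add: tree_graph_def) blast+
  show "fst e \<noteq> snd e" using e p_irrefl by metis
qed

lemma wf_tree_graph: "pair_wf_digraph tree_graph"
  by unfold_locales (use p_in in \<open>auto simp: tree_graph_def\<close>)

definition parent :: "'a \<Rightarrow> 'a" where
  "parent x = (THE y. p x y)"

lemma p_parent: "x \<in> V \<Longrightarrow> p x (parent x)"
  unfolding parent_def using p_total p_unique by (metis theI)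

lemma p_iff_parent: "p x y \<longleftrightarrow> x \<in> V \<and> y = parent x"
  using p_in[of x y] p_parent[of x] p_unique[of x y "parent x"] by auto

lemma parent_ray: "x \<in> V \<Longrightarrow> (parent ^^ n) x \<in> V"
  by (induction n) (use p_in p_parent in auto)

lemma level_parent_ray: "x \<in> V \<Longrightarrow> strict_mono (\<lambda>n. level ((parent ^^ n) x))"
  by (rule strict_mono_Suc_iff[THEN iffD2]) (use p_level p_parent parent_ray in auto)

text \<open>
Once a self-avoiding path steps down to a child it cannot step up again, since that would lead back to the
vertex it came from. So it would descend for ever, which levels forbid; hence it always climbs.
\<close>

lemma rays_component:
  assumes K: "K = component_at tree_graph v" and v: "v \<in> V" and u: "u \<in> pverts K"
  shows "rays (with_proj K) u = {\<lambda>n. (parent ^^ n) u}"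
proof (intro equalityI subsetI)
  have uV: "u \<in> V" using component_at_subset[OF wf_tree_graph, of v u] u v K by (simp add: tree_graph_def)
  fix r assume "r \<in> {\<lambda>n. (parent ^^ n) u}"
  then have r: "r = (\<lambda>n. (parent ^^ n) u)" by simp
  have step: "p (r n) (r (Suc n))" for n using p_parent[OF parent_ray[OF uV, of n]] r by simp
  have rW: "r n \<in> pverts K" for n
  proof (induction n)
    case (Suc n)
    then show ?case
      using component_at_closed[of "r n" tree_graph v "r (Suc n)"] step by (simp add: K tree_graph_def)
  qed (use u r in simp)
  have "inj r"
    unfolding r
  proof (rule injI)
    fix m n assume "(parent ^^ m) u = (parent ^^ n) u"
    then have "level ((parent ^^ m) u) = level ((parent ^^ n) u)" by simp
    then show "m = n" using strict_mono_eq[OF level_parent_ray[OF uV]] by simp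
  qed
  then show "r \<in> rays (with_proj K) u"
    using rW step r by (auto simp: rays_def K parcs_component_at tree_graph_def)
next
  fix r assume "r \<in> rays (with_proj K) u"
  then have r0: "r 0 = u" and inj: "inj r" and edge: "\<And>n. p (r n) (r (Suc n)) \<or> p (r (Suc n)) (r n)"
    by (auto simp: rays_def K parcs_component_at tree_graph_def)
  have up: "p (r n) (r (Suc n))" for n
  proof (rule ccontr)
    assume down: "\<not> p (r n) (r (Suc n))"
    have "p (r (n + Suc k)) (r (n + k))" for k
    proof (induction k)
      case 0
      then show ?case using edge[of n] down by simp
    next
      case (Suc k)
      have "\<not> p (r (n + Suc k)) (r (n + Suc (Suc k)))"
      proof
        assume "p (r (n + Suc k)) (r (n + Suc (Suc k)))"
        then have "r (n + Suc (Suc k)) = r (n + k)" by (rule p_unique[OF _ Suc.IH])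
        then show False using injD[OF inj] by fastforce
      qed
      then show ?case using edge[of "n + Suc k"] by simp
    qed
    then have "level (r (n + Suc k)) < level (r (n + k))" for k using p_level by blast
    then have "\<exists>f :: nat \<Rightarrow> nat. \<forall>k. f (Suc k) < f k" by (intro exI[of _ "\<lambda>k. level (r (n + k))"]) simp
    then show False using wf_less_than unfolding wf_iff_no_infinite_down_chain by simp
  qed
  have "r n = (parent ^^ n) u" for n
  proof (induction n)
    case (Suc n)
    have "r (Suc n) = parent (r n)" using up[of n] p_iff_parent[of "r n"] by simp
    with Suc show ?case by simp
  qed (simp add: r0)
  then show "r \<in> {\<lambda>n. (parent ^^ n) u}" by auto
qed

text \<open>
On a cycle, a vertex of least level can only be joined to its parent, so its two neighbours on the cycle
coincide, which is impossible for length at least 3.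
\<close>

lemma no_long_cycle:
  assumes K: "K = component_at tree_graph v"
  shows "\<not> (pre_digraph.cycle (with_proj K) q \<and> 3 \<le> length q)"
proof
  assume "pre_digraph.cycle (with_proj K) q \<and> 3 \<le> length q"
  then obtain u where q: "set q \<subseteq> parcs K" "pcas u q u" "distinct (tl (pawalk_verts u q))" "q \<noteq> []"
    and len: "3 \<le> length q"
    by (auto simp: pre_digraph.cycle_def pre_digraph.awalk_def cas_with_proj_eq awalk_verts_with_proj_eq)
  have verts: "tl (pawalk_verts u q) = map snd q" if "pcas u q w" for u w and q :: "('a \<times> 'a) list"
    using that
  proof (induction q arbitrary: u)
    case (Cons e q)
    then show ?case by (cases q) auto
  qed simp
  have consec: "fst (q ! i) = (if i = 0 then u else snd (q ! (i - 1)))" if "i < length q" "pcas u q w"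
    for i u w and q :: "('a \<times> 'a) list"
    using that
  proof (induction q arbitrary: u i)
    case (Cons e q)
    then show ?case by (cases i) (auto simp: nth_Cons' split: if_splits)
  qed simp
  have final: "snd (last q) = w" if "pcas u q w" "q \<noteq> []" for u w and q :: "('a \<times> 'a) list"
    using that by (induction q arbitrary: u) auto
  define n where "n = length q"
  define c where "c i = snd (q ! i)" for i
  have n: "3 \<le> n" and dist: "inj_on c {..<n}"
    using len q(3) verts[OF q(2)] by (auto simp: n_def c_def distinct_conv_nth inj_on_def)
  have edge: "p (c i) (c j) \<or> p (c j) (c i)" if "j < n" "i = (if j = 0 then n - 1 else j - 1)" for i j
  proof -
    have "q ! j \<in> parcs K" using q(1) that(1) by (auto simp: n_def)
    moreover have "q ! j = (c i, c j)"
      using consec[OF _ q(2), of j] that final[OF q(2,4)] q(4)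
      by (auto simp: c_def n_def last_conv_nth prod_eq_iff)
    ultimately show ?thesis by (simp add: K parcs_component_at tree_graph_def)
  qed
  obtain i where i: "i < n" "\<And>j. j < n \<Longrightarrow> level (c i) \<le> level (c j)"
    using ex_has_least_nat[of "\<lambda>i. i < n" 0 "\<lambda>i. level (c i)"] n by auto
  \<comment> \<open>The positions before and after \<open>i\<close> on the cycle.\<close>
  define a where "a = (if i = 0 then n - 1 else i - 1)"
  define b where "b = (if i = n - 1 then 0 else Suc i)"
  have a: "a < n" "i = (if a = n - 1 then 0 else Suc a)" and b: "b < n" "i = (if b = 0 then n - 1 else b - 1)"
    using i(1) n by (auto simp: a_def b_def)
  have "p (c i) (c a)"
    using edge[OF i(1) a_def] i(2)[OF a(1)] p_level[of "c a" "c i"] by linarith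
  moreover have "p (c i) (c b)"
    using edge[OF b] i(2)[OF b(1)] p_level[of "c b" "c i"] by linarith
  ultimately have "c a = c b" by (rule p_unique)
  then have "a = b" using inj_onD[OF dist, of a b] a(1) b(1) by simp
  then show False using i(1) n by (simp add: a_def b_def split: if_splits)
qed

lemma component_one_ended_tree:
  assumes C: "C \<in> graph_components (with_proj tree_graph)"
  shows "locally_finite C \<and> one_ended_tree C"
proof -
  obtain v where v: "v \<in> V" and C': "C = with_proj (component_at tree_graph v)"
    using graph_components_component_at[OF wf_tree_graph C] by (auto simp: tree_graph_def)
  have "locally_finite C"
    unfolding locally_finite_def
  proof (intro ballI conjI)
    fix w
    have fin: "finite {x. p x w \<or> p w x}"
    proof -
      have "{x. p w x} \<subseteq> {parent w}" by (auto simp: p_iff_parent)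
      then have "finite {x. p w x}" by (rule finite_subset) simp
      then show ?thesis using p_finite[of w] by (simp add: Collect_disj_eq)
    qed
    have "in_arcs C w \<subseteq> (\<lambda>x. (x, w)) ` {x. p x w \<or> p w x}"
      by (auto simp: in_arcs_def C' parcs_component_at tree_graph_def)
    then show "finite (in_arcs C w)" by (rule finite_subset) (intro finite_imageI fin)
    have "out_arcs C w \<subseteq> (\<lambda>x. (w, x)) ` {x. p x w \<or> p w x}"
      by (auto simp: out_arcs_def C' parcs_component_at tree_graph_def)
    then show "finite (out_arcs C w)" by (rule finite_subset) (intro finite_imageI fin)
  qed
  moreover have "one_ended_tree C"
    unfolding one_ended_tree_def undirected_tree_def C'
    using connected_component_at no_long_cycle[OF refl] rays_component[OF refl v] by auto
  ultimately show ?thesis ..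
qed

end

section \<open>A perfect matching of a forest\<close>

text \<open>
Orbits of a partial function are linearly ordered: of two points on the orbit of \<open>x\<close>, the later is on the orbit of the
earlier.
\<close>

lemma relpowp_right_unique_diff:
  assumes "right_unique R" "(R ^^ m) x y" "(R ^^ n) x z" "m \<le> n"
  shows "(R ^^ (n - m)) y z"
proof -
  have "(R ^^ (m + (n - m))) x z" using assms by simp
  then obtain w where "(R ^^ m) x w" "(R ^^ (n - m)) w z" by (auto simp: relpowp_add)
  moreover have "w = y"
    using relpowp_right_unique[OF _ \<open>(R ^^ m) x w\<close> assms(2)] right_uniqueD[OF assms(1)] by blast
  ultimately show ?thesis by simp
qed

definition descendants :: "'a set \<Rightarrow> ('a \<Rightarrow> 'a \<Rightarrow> bool) \<Rightarrow> 'a \<Rightarrow> 'a set" where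
  "descendants V p y = {x\<in>V. \<exists>k. (p ^^ k) x y}"

text \<open>
A vertex with an odd number of descendants (itself included) is given to its parent, any other vertex is
given to itself.
\<close>

definition hub :: "'a set \<Rightarrow> ('a \<Rightarrow> 'a \<Rightarrow> bool) \<Rightarrow> 'a \<Rightarrow> 'a \<Rightarrow> bool" where
  "hub V p x y \<longleftrightarrow> x \<in> V \<and> (if odd (card (descendants V p x)) then p x y else x = y)"

definition hub_rank :: "'a::metric_space set \<Rightarrow> ('a \<Rightarrow> 'a \<Rightarrow> bool) \<Rightarrow> 'a \<Rightarrow> 'a \<Rightarrow> nat" where
  "hub_rank V p x y = card {z\<in>V. hub V p z y \<and> dist z y < dist x y}"

definition mates :: "'a::metric_space set \<Rightarrow> ('a \<Rightarrow> 'a \<Rightarrow> bool) \<Rightarrow> 'a \<Rightarrow> 'a \<Rightarrow> bool" where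
  "mates V p x x' \<longleftrightarrow> x \<noteq> x' \<and>
     (\<exists>y\<in>V. hub V p x y \<and> hub V p x' y \<and> hub_rank V p x y div 2 = hub_rank V p x' y div 2)"

text \<open>
Ranks are \<open>0, \<dots>, n - 1\<close> with \<open>n\<close> even; the partner of rank \<open>2 k\<close> is rank \<open>2 k + 1\<close>.
\<close>

lemma even_set_paired_by_rank:
  fixes key :: "'a \<Rightarrow> real" and S :: "'a set" and rk :: "'a \<Rightarrow> nat"
  assumes S: "finite S" "even (card S)" "inj_on key S" and x: "x \<in> S"
  defines "rk \<equiv> \<lambda>x. card {z\<in>S. key z < key x}"
  shows "\<exists>!x'. x' \<in> S \<and> x' \<noteq> x \<and> rk x' div 2 = rk x div 2"
proof -
  have buddy: "k \<noteq> r \<and> k div 2 = r div 2 \<longleftrightarrow> k = (if even r then r + 1 else r - 1)" for k r :: nat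
  proof (cases "even r")
    case True
    then obtain j where "r = 2 * j" by (elim evenE)
    then show ?thesis by auto
  next
    case False
    then obtain j where "r = 2 * j + 1" by (elim oddE)
    then show ?thesis by auto
  qed
  have mono: "rk y < rk z" if "y \<in> S" "z \<in> S" "key y < key z" for y z
  proof -
    have "y \<in> {w\<in>S. key w < key z}" "y \<notin> {w\<in>S. key w < key y}" using that by auto
    moreover have "{w\<in>S. key w < key y} \<subseteq> {w\<in>S. key w < key z}" using that(3) by auto
    ultimately have "{w\<in>S. key w < key y} \<subset> {w\<in>S. key w < key z}" by (metis psubsetI)
    then show ?thesis unfolding rk_def by (rule psubset_card_mono[rotated]) (use S(1) in simp)
  qed
  have inj: "inj_on rk S"
  proof (rule inj_onI, rule ccontr)
    fix y z assume yz: "y \<in> S" "z \<in> S" "rk y = rk z" "y \<noteq> z"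
    then have "key y \<noteq> key z" using inj_onD[OF S(3), of y z] by auto
    then show False using mono[of y z] mono[of z y] yz by linarith
  qed
  have lt: "rk y < card S" if "y \<in> S" for y
  proof -
    have "y \<notin> {w\<in>S. key w < key y}" by simp
    with that have "{w\<in>S. key w < key y} \<subset> S" by auto
    then show ?thesis unfolding rk_def by (rule psubset_card_mono[OF S(1)])
  qed
  have "rk ` S = {..<card S}"
    by (rule card_subset_eq) (use lt in \<open>auto simp: card_image[OF inj]\<close>)
  \<comment> \<open>The rank of the partner.\<close>
  define m where "m = (if even (rk x) then rk x + 1 else rk x - 1)"
  have "m < card S"
  proof (cases "even (rk x)")
    case True
    then have "rk x + 1 \<noteq> card S" using S(2) by (metis even_plus_one_iff)
    with True show ?thesis using lt[OF x] by (simp add: m_def)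
  next
    case False
    then show ?thesis using lt[OF x] by (simp add: m_def)
  qed
  then have "m \<in> rk ` S" using \<open>rk ` S = {..<card S}\<close> by simp
  then obtain x' where x': "x' \<in> S" "rk x' = m" by auto
  have m_iff: "k \<noteq> rk x \<and> k div 2 = rk x div 2 \<longleftrightarrow> k = m" for k
    unfolding m_def using buddy[of k "rk x"] .
  show ?thesis
  proof (rule ex1I[of _ x'])
    show "x' \<in> S \<and> x' \<noteq> x \<and> rk x' div 2 = rk x div 2" using x' m_iff[of "rk x'"] by auto
    fix z assume z: "z \<in> S \<and> z \<noteq> x \<and> rk z div 2 = rk x div 2"
    then have "rk z \<noteq> rk x" using inj_onD[OF inj, of z x] x by auto
    with z have "rk z = m" using m_iff[of "rk z"] by simp
    then show "z = x'" using inj_onD[OF inj, of z x'] z x' by simp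
  qed
qed

text \<open>
Distances to the parent distinguish siblings, so the children of a vertex are ordered without any choice.
\<close>

locale metric_forest = leveled_forest V p level
  for V :: "'a::metric_space set" and p level +
  assumes sibling_dist: "p x y \<Longrightarrow> p x' y \<Longrightarrow> dist x y = dist x' y \<Longrightarrow> x = x'"
begin

lemma level_relpowp: "(p ^^ k) x y \<Longrightarrow> level x + k \<le> level y"
proof (induction k arbitrary: y)
  case (Suc k)
  then obtain z where "(p ^^ k) x z" "p z y" by (auto elim: relpowp_Suc_E)
  then show ?case using Suc.IH[of z] p_level[of z y] by linarith
qed simp

lemma right_unique_p: "right_unique p"
  using p_unique by (rule right_uniqueI)

lemma descendants_eq:
  assumes "y \<in> V"
  shows "descendants V p y = insert y (\<Union>x\<in>{x. p x y}. descendants V p x)"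
proof (intro equalityI subsetI)
  fix z assume "z \<in> descendants V p y"
  then obtain k where z: "z \<in> V" "(p ^^ k) z y" by (auto simp: descendants_def)
  show "z \<in> insert y (\<Union>x\<in>{x. p x y}. descendants V p x)"
  proof (cases k)
    case (Suc n)
    then obtain w where "(p ^^ n) z w" "p w y" using z by (auto elim: relpowp_Suc_E)
    then show ?thesis using z by (auto simp: descendants_def)
  qed (use z in simp)
next
  fix z assume "z \<in> insert y (\<Union>x\<in>{x. p x y}. descendants V p x)"
  then show "z \<in> descendants V p y"
  proof
    assume "z = y"
    then show ?thesis using assms by (auto simp: descendants_def intro: exI[of _ 0])
  next
    assume "z \<in> (\<Union>x\<in>{x. p x y}. descendants V p x)"
    then obtain x k where "p x y" "z \<in> V" "(p ^^ k) z x" by (auto simp: descendants_def)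
    then show ?thesis using relpowp_Suc_I[of k p z x y] unfolding descendants_def by blast
  qed
qed

text \<open>
Descendants have smaller level, so the recursion over children stops, and it branches finitely.
\<close>

lemma finite_descendants: "finite (descendants V p y)"
proof (induction "level y" arbitrary: y rule: less_induct)
  case less
  show ?case
  proof (cases "y \<in> V")
    case True
    have "finite (\<Union>x\<in>{x. p x y}. descendants V p x)"
      using p_finite[of y] less p_level by (intro finite_UN_I) auto
    then show ?thesis by (simp add: descendants_eq[OF True])
  next
    case False
    have "descendants V p y \<subseteq> {y}"
    proof
      fix x assume "x \<in> descendants V p y"
      then obtain k where k: "x \<in> V" "(p ^^ k) x y" by (auto simp: descendants_def)
      then show "x \<in> {y}" using False p_in by (cases k) (auto elim: relpowp_Suc_E)
    qed
    then show ?thesis by (rule finite_subset) simp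
  qed
qed

lemma descendants_disjoint:
  assumes "p x y" "p x' y" "x \<noteq> x'"
  shows "descendants V p x \<inter> descendants V p x' = {}"
proof -
  have False if "(p ^^ m) z x" "(p ^^ n) z x'" "m \<le> n" "p x y" "p x' y" "x \<noteq> x'" for z m n x x'
  proof -
    have d: "(p ^^ (n - m)) x x'" using relpowp_right_unique_diff[OF right_unique_p] that by blast
    show False
    proof (cases "n - m")
      case 0
      with d that(6) show False by simp
    next
      case (Suc k)
      then obtain w where "p x w" "(p ^^ k) w x'" using d relpowp_Suc_D2 by metis
      then have "level y \<le> level x'" using p_unique[OF that(4)] level_relpowp[of k w x'] by fastforce
      with p_level[OF that(5)] show False by simp
    qed
  qed
  note contra = this
  show ?thesis
  proof (intro equals0I)
    fix z assume "z \<in> descendants V p x \<inter> descendants V p x'"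
    then obtain m n where mn: "(p ^^ m) z x" "(p ^^ n) z x'" by (auto simp: descendants_def)
    show False
      using contra[OF mn _ assms] contra[OF mn(2,1) _ assms(2,1) assms(3)[symmetric]] by linarith
  qed
qed

lemma card_descendants:
  assumes "y \<in> V"
  shows "card (descendants V p y) = Suc (\<Sum>x\<in>{x. p x y}. card (descendants V p x))"
proof -
  have "y \<notin> descendants V p x" if "p x y" for x
    using that level_relpowp[of _ y x] p_level[of x y] by (fastforce simp: descendants_def)
  then have "card (descendants V p y) = Suc (card (\<Union>x\<in>{x. p x y}. descendants V p x))"
    using p_finite[of y] finite_descendants by (simp add: descendants_eq[OF assms])
  also have "card (\<Union>x\<in>{x. p x y}. descendants V p x) = (\<Sum>x\<in>{x. p x y}. card (descendants V p x))"
    by (rule card_UN_disjoint) (use p_finite finite_descendants descendants_disjoint in auto)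
  finally show ?thesis .
qed

text \<open>
The class of \<open>y\<close> consists of its children with odd counts, together with \<open>y\<close> itself if its own count is even. Since
the count of \<open>y\<close> is one plus the sum over its children, it is even exactly if the number of odd children
is odd. So the class is even in both cases.
\<close>

lemma hub_class:
  assumes y: "y \<in> V"
  shows "finite {x. hub V p x y}" "even (card {x. hub V p x y})"
    "inj_on (\<lambda>x. dist x y) {x. hub V p x y}"
proof -
  define K where "K = {x. p x y \<and> odd (card (descendants V p x))}"
  have K: "finite K" "y \<notin> K" using p_finite[of y] p_irrefl by (auto simp: K_def)
  have eq: "{x. hub V p x y} = (if odd (card (descendants V p y)) then K else insert y K)"
    using y p_in by (auto simp: hub_def K_def)
  show fin: "finite {x. hub V p x y}" unfolding eq using K by simp
  have "odd (card (descendants V p y)) \<longleftrightarrow> even (card K)"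
    unfolding card_descendants[OF y] K_def
    using even_sum_iff[OF p_finite[of y], of "\<lambda>x. card (descendants V p x)"] by simp
  then show "even (card {x. hub V p x y})" unfolding eq using K by simp
  have "inj_on (\<lambda>x. dist x y) (insert y K)"
    unfolding inj_on_def K_def using sibling_dist p_irrefl by auto
  then show "inj_on (\<lambda>x. dist x y) {x. hub V p x y}"
    unfolding eq by (auto intro: inj_on_subset)
qed

lemma hub_ex1: "x \<in> V \<Longrightarrow> \<exists>!y. hub V p x y"
  unfolding hub_def using p_total[of x] p_unique[of x] by auto

lemma hub_in: "hub V p x y \<Longrightarrow> x \<in> V \<and> y \<in> V"
  unfolding hub_def using p_in by (auto split: if_splits)

lemma mates_ex1:
  assumes x: "x \<in> V" shows "\<exists>!x'. mates V p x x'"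
proof -
  obtain y where y: "hub V p x y" and y_unique: "\<And>y'. hub V p x y' \<Longrightarrow> y' = y"
    using hub_ex1[OF x] by (elim ex1E) blast
  have yV: "y \<in> V" using hub_in[OF y] by simp
  have rank: "hub_rank V p z y = card {w \<in> {x. hub V p x y}. dist w y < dist z y}" for z
    unfolding hub_rank_def using hub_in by (intro arg_cong[where f=card]) auto
  have iff: "mates V p x x' \<longleftrightarrow> x' \<in> {x. hub V p x y} \<and> x' \<noteq> x \<and>
      hub_rank V p x' y div 2 = hub_rank V p x y div 2" for x'
  proof
    assume "mates V p x x'"
    then obtain y' where y': "x \<noteq> x'" "hub V p x y'" "hub V p x' y'"
      "hub_rank V p x y' div 2 = hub_rank V p x' y' div 2" unfolding mates_def by (elim conjE bexE)
    have "y' = y" using y_unique[OF y'(2)] .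
    with y' show "x' \<in> {x. hub V p x y} \<and> x' \<noteq> x \<and>
      hub_rank V p x' y div 2 = hub_rank V p x y div 2" by simp
  next
    assume "x' \<in> {x. hub V p x y} \<and> x' \<noteq> x \<and>
      hub_rank V p x' y div 2 = hub_rank V p x y div 2"
    then show "mates V p x x'" unfolding mates_def using y yV by (intro conjI bexI[of _ y]) auto
  qed
  have "\<exists>!x'. x' \<in> {x. hub V p x y} \<and> x' \<noteq> x \<and>
      card {w \<in> {x. hub V p x y}. dist w y < dist x' y} div 2 =
      card {w \<in> {x. hub V p x y}. dist w y < dist x y} div 2"
    by (rule even_set_paired_by_rank[OF hub_class[OF yV]]) (use y in simp)
  then show ?thesis unfolding iff rank .
qed

lemma mates_sym: "mates V p x y \<Longrightarrow> mates V p y x"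
  unfolding mates_def by metis

lemma mates_in: "mates V p x y \<Longrightarrow> x \<in> V \<and> y \<in> V"
  unfolding mates_def using hub_in by metis

text \<open>
The classes partition the vertices into finite even sets, each of which is paired off by rank.
\<close>

lemma perfect_matching_mates: "perfect_matching \<lparr>pverts = V, parcs = {(x, y). mates V p x y}\<rparr>"
  (is "perfect_matching ?g")
proof -
  have "undirected ?g"
  proof unfold_locales
    show "symmetric (with_proj ?g)"
      unfolding symmetric_def with_proj_simps sym_def using mates_sym by auto
  next
    fix e assume "e \<in> parcs ?g"
    then have e: "mates V p (fst e) (snd e)" by (cases e) simp
    show "fst e \<in> pverts ?g" "snd e \<in> pverts ?g" using mates_in[OF e] by simp_all
    show "fst e \<noteq> snd e" using e by (simp add: mates_def)
  qed
  moreover have "out_degree (with_proj ?g) x = 1" if x: "x \<in> V" for x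
  proof -
    obtain x' where x': "mates V p x x'" and unique: "\<And>z. mates V p x z \<Longrightarrow> z = x'"
      using mates_ex1[OF x] by (elim ex1E) blast
    have "out_arcs (with_proj ?g) x = {(x, x')}"
    proof (intro equalityI subsetI)
      fix e assume "e \<in> out_arcs (with_proj ?g) x"
      then have "fst e = x" "mates V p (fst e) (snd e)" by (auto simp: out_arcs_def)
      with unique[of "snd e"] show "e \<in> {(x, x')}" by (simp add: prod_eq_iff)
    qed (use x' in \<open>simp add: out_arcs_def\<close>)
    then show ?thesis by (simp add: out_degree_def)
  qed
  ultimately show ?thesis by (simp add: perfect_matching_def)
qed

end

section \<open>Postorder of a forest\<close>

definition first_child :: "'a::metric_space set \<Rightarrow> ('a \<Rightarrow> 'a \<Rightarrow> bool) \<Rightarrow> 'a \<Rightarrow> 'a \<Rightarrow> bool" where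
  "first_child V p y c \<longleftrightarrow> p c y \<and> (\<forall>z\<in>V. p z y \<longrightarrow> dist c y \<le> dist z y)"

definition leaf :: "'a set \<Rightarrow> ('a \<Rightarrow> 'a \<Rightarrow> bool) \<Rightarrow> 'a \<Rightarrow> bool" where
  "leaf V p y \<longleftrightarrow> y \<in> V \<and> \<not> (\<exists>z\<in>V. p z y)"

text \<open>
The vertex of the subtree of \<open>y\<close> that is visited first: descend to the first child until a leaf is reached. For
a leaf \<open>y\<close> this is \<open>y\<close>.
\<close>

definition first_leaf :: "'a::metric_space set \<Rightarrow> ('a \<Rightarrow> 'a \<Rightarrow> bool) \<Rightarrow> 'a \<Rightarrow> 'a \<Rightarrow> bool" where
  "first_leaf V p y l \<longleftrightarrow> leaf V p l \<and> (\<exists>k. (first_child V p ^^ k) y l)"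

definition next_sibling :: "'a::metric_space set \<Rightarrow> ('a \<Rightarrow> 'a \<Rightarrow> bool) \<Rightarrow> 'a \<Rightarrow> 'a \<Rightarrow> bool" where
  "next_sibling V p x c \<longleftrightarrow> (\<exists>y\<in>V. p x y \<and> p c y \<and> dist x y < dist c y \<and>
     (\<forall>z\<in>V. p z y \<longrightarrow> dist x y < dist z y \<longrightarrow> dist c y \<le> dist z y))"

text \<open>
After \<open>x\<close> comes the subtree of the next sibling, starting with its first leaf, or the parent if no siblings
are left.
\<close>

definition postorder_succ :: "'a::metric_space set \<Rightarrow> ('a \<Rightarrow> 'a \<Rightarrow> bool) \<Rightarrow> 'a \<Rightarrow> 'a \<Rightarrow> bool" where
  "postorder_succ V p x z \<longleftrightarrow> (\<exists>c\<in>V. next_sibling V p x c \<and> first_leaf V p c z) \<or>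
     (p x z \<and> \<not> (\<exists>c\<in>V. next_sibling V p x c))"

text \<open>
The backward counterpart, for relations with at most one predecessor.
\<close>

lemma relpowp_left_unique_diff:
  assumes "left_unique R" "(R ^^ m) x z" "(R ^^ n) y z" "m \<le> n"
  shows "(R ^^ (n - m)) y x"
proof -
  have "(R ^^ ((n - m) + m)) y z" using assms by simp
  then obtain w where "(R ^^ (n - m)) y w" "(R ^^ m) w z" by (auto simp: relpowp_add)
  moreover have "w = x"
    using relpowp_left_unique[OF _ \<open>(R ^^ m) w z\<close> assms(2)] left_uniqueD[OF assms(1)] by blast
  ultimately show ?thesis by simp
qed

context metric_forest
begin

abbreviation "R \<equiv> first_child V p"
abbreviation "succ \<equiv> postorder_succ V p"

lemma finite_dist_min:
  assumes "finite S" "S \<noteq> {}"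
  obtains c where "c \<in> S" "\<And>z. z \<in> S \<Longrightarrow> dist c y \<le> dist z (y :: 'a)"
proof -
  have "Min ((\<lambda>x. dist x y) ` S) \<in> (\<lambda>x. dist x y) ` S" using assms by (intro Min_in) auto
  then obtain c where c: "c \<in> S" "dist c y = Min ((\<lambda>x. dist x y) ` S)" by auto
  have "dist c y \<le> dist z y" if "z \<in> S" for z
    using that assms by (simp add: c(2))
  with c(1) that show thesis by blast
qed

lemma first_child_ex: "p z y \<Longrightarrow> \<exists>c. R y c"
proof -
  assume z: "p z y"
  obtain c where "c \<in> {x. p x y}" "\<And>z. z \<in> {x. p x y} \<Longrightarrow> dist c y \<le> dist z y"
    using finite_dist_min[OF p_finite[of y], of y] z by blast
  then show ?thesis by (intro exI[of _ c]) (simp add: first_child_def)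
qed

lemma first_child_p: "R y c \<Longrightarrow> p c y"
  by (simp add: first_child_def)

lemma right_unique_first_child: "right_unique R"
proof (rule right_uniqueI)
  fix y c c' assume "R y c" "R y c'"
  then have "p c y" "p c' y" "dist c y \<le> dist c' y" "dist c' y \<le> dist c y"
    using p_in by (auto simp: first_child_def)
  then show "c = c'" by (intro sibling_dist[of c y c']) auto
qed

lemma left_unique_first_child: "left_unique R"
  using first_child_p p_unique by (blast intro: left_uniqueI)

lemma first_leaf_ex: "y \<in> V \<Longrightarrow> \<exists>l. first_leaf V p y l"
proof (induction "level y" arbitrary: y rule: less_induct)
  case less
  show ?case
  proof (cases "leaf V p y")
    case True
    then show ?thesis by (auto simp: first_leaf_def intro!: exI[of _ 0] exI[of _ y])
  next
    case False
    then obtain z where "p z y" using less.prems by (auto simp: leaf_def)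
    then obtain c where c: "R y c" using first_child_ex by blast
    then have "level c < level y" "c \<in> V" using first_child_p[OF c] p_level p_in by auto
    then obtain l where "first_leaf V p c l" using less.hyps[of c] by blast
    then obtain k where "leaf V p l" "(R ^^ k) c l" by (auto simp: first_leaf_def)
    then show ?thesis using relpowp_Suc_I2[of R, OF c] unfolding first_leaf_def by blast
  qed
qed

lemma first_leaf_unique:
  assumes "first_leaf V p y l" "first_leaf V p y l'" shows "l = l'"
proof -
  have wlog: "a = b" if "leaf V p a" "(R ^^ m) y a" "(R ^^ n) y b" "m \<le> n" for a b m n
  proof -
    have d: "(R ^^ (n - m)) a b" by (rule relpowp_right_unique_diff[OF right_unique_first_child that(2-4)])
    show ?thesis
    proof (cases "n - m")
      case 0
      with d show ?thesis by simp
    next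
      case (Suc k)
      with d obtain w where "R a w" using relpowp_Suc_D2 by metis
      then have "p w a" "w \<in> V" using first_child_p p_in by blast+
      with that(1) show ?thesis by (auto simp: leaf_def)
    qed
  qed
  obtain m n where mn: "leaf V p l" "(R ^^ m) y l" "leaf V p l'" "(R ^^ n) y l'"
    using assms by (auto simp: first_leaf_def)
  show ?thesis
    using wlog[OF mn(1,2,4)] wlog[OF mn(3,4,2)] by (cases "m \<le> n") auto
qed

text \<open>
From a leaf, the chain of first children can be followed upwards in one way only; it stops at the first
vertex that is not a first child.
\<close>

lemma first_leaf_inj:
  assumes "first_leaf V p c l" "first_leaf V p c' l"
    and top: "\<And>w. \<not> R w c" "\<And>w. \<not> R w c'"
  shows "c = c'"
proof -
  have wlog: "a = b" if "\<And>w. \<not> R w a" "(R ^^ m) a l" "(R ^^ n) b l" "m \<le> n" for a b m n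
  proof -
    have d: "(R ^^ (n - m)) b a" by (rule relpowp_left_unique_diff[OF left_unique_first_child that(2-4)])
    show ?thesis
    proof (cases "n - m")
      case (Suc k)
      with d obtain w where "R w a" by (auto elim: relpowp_Suc_E)
      with that(1) show ?thesis by blast
    qed (use d in simp)
  qed
  obtain m n where mn: "(R ^^ m) c l" "(R ^^ n) c' l" using assms(1,2) by (auto simp: first_leaf_def)
  show ?thesis
    using wlog[OF top(1) mn] wlog[OF top(2) mn(2,1)] by (cases "m \<le> n") auto
qed

lemma next_sibling_ex:
  assumes "p x y" "p z y" "dist x y < dist z y" shows "\<exists>c. next_sibling V p x c"
proof -
  let ?S = "{z. p z y \<and> dist x y < dist z y}"
  have "finite ?S" by (rule finite_subset[OF _ p_finite[of y]]) auto
  then obtain c where "c \<in> ?S" "\<And>z. z \<in> ?S \<Longrightarrow> dist c y \<le> dist z y"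
    using finite_dist_min[of ?S y] assms by blast
  then show ?thesis
    using assms(1) p_in by (intro exI[of _ c]) (auto simp: next_sibling_def intro!: bexI[of _ y])
qed

lemma next_siblingD:
  assumes "next_sibling V p x c"
  obtains y where "p x y" "p c y" "dist x y < dist c y" "x \<in> V" "c \<in> V"
    "\<And>z. p z y \<Longrightarrow> dist x y < dist z y \<Longrightarrow> dist c y \<le> dist z y"
  using assms p_in unfolding next_sibling_def by metis

lemma next_sibling_unique:
  assumes "next_sibling V p x c" "next_sibling V p x c'" shows "c = c'"
proof -
  obtain y where y: "p x y" "p c y" "dist x y < dist c y"
    "\<And>z. p z y \<Longrightarrow> dist x y < dist z y \<Longrightarrow> dist c y \<le> dist z y" using next_siblingD[OF assms(1)] by metis
  obtain y' where y': "p x y'" "p c' y'" "dist x y' < dist c' y'"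
    "\<And>z. p z y' \<Longrightarrow> dist x y' < dist z y' \<Longrightarrow> dist c' y' \<le> dist z y'" using next_siblingD[OF assms(2)] by metis
  have "y' = y" using p_unique[OF y'(1) y(1)] .
  with y y' show ?thesis by (intro sibling_dist[of c y c'] antisym) auto
qed

lemma next_sibling_inj:
  assumes "next_sibling V p x c" "next_sibling V p x' c" shows "x = x'"
proof -
  obtain y where y: "p x y" "p c y" "dist x y < dist c y"
    "\<And>z. p z y \<Longrightarrow> dist x y < dist z y \<Longrightarrow> dist c y \<le> dist z y" using next_siblingD[OF assms(1)] by metis
  obtain y' where y': "p x' y'" "p c y'" "dist x' y' < dist c y'"
    "\<And>z. p z y' \<Longrightarrow> dist x' y' < dist z y' \<Longrightarrow> dist c y' \<le> dist z y'" using next_siblingD[OF assms(2)] by metis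
  have [simp]: "y' = y" using p_unique[OF y'(2) y(2)] .
  have "\<not> dist x y < dist x' y" using y(4)[of x'] y' by auto
  moreover have "\<not> dist x' y < dist x y" using y'(4)[of x] y by auto
  ultimately show ?thesis using y y' by (intro sibling_dist[of x y x']) auto
qed

text \<open>
Makes \<open>first_leaf_inj\<close> applicable to the subtrees entered by the successor.
\<close>

lemma next_sibling_not_first_child:
  assumes "next_sibling V p x c" shows "\<not> R w c"
proof
  assume w: "R w c"
  obtain y where y: "p x y" "p c y" "dist x y < dist c y" "x \<in> V" using next_siblingD[OF assms] by metis
  have "w = y" using p_unique[OF first_child_p[OF w] y(2)] .
  with w y show False by (auto simp: first_child_def)
qed

lemma next_sibling_in: "next_sibling V p x c \<Longrightarrow> x \<in> V \<and> c \<in> V"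
  using next_siblingD by metis

lemma first_leaf_in: "first_leaf V p c l \<Longrightarrow> l \<in> V"
  by (simp add: first_leaf_def leaf_def)

lemma succ_in: "succ x z \<Longrightarrow> x \<in> V \<and> z \<in> V"
  unfolding postorder_succ_def using next_sibling_in first_leaf_in p_in by blast

lemma succ_ex: "x \<in> V \<Longrightarrow> \<exists>z. succ x z"
  unfolding postorder_succ_def using first_leaf_ex p_total by blast

lemma right_unique_succ: "right_unique succ"
proof (rule right_uniqueI)
  fix x z z' assume "succ x z" "succ x z'"
  then show "z = z'"
    unfolding postorder_succ_def
    using next_sibling_unique first_leaf_unique p_unique by metis
qed

text \<open>
A leaf is entered only from the preceding sibling of the top of its chain of first children, any other vertex only
from its last child.
\<close>

lemma left_unique_succ: "left_unique succ"
proof (rule left_uniqueI)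
  have no_mix: False if "first_leaf V p c z" "p x z" for c z x
    using that p_in by (auto simp: first_leaf_def leaf_def)
  have last: "x = x'" if "p x z" "p x' z" "\<not> (\<exists>c\<in>V. next_sibling V p x c)" "\<not> (\<exists>c\<in>V. next_sibling V p x' c)"
    for x x' z
  proof -
    have "\<not> dist x z < dist x' z" using next_sibling_ex[OF that(1,2)] next_sibling_in that(3) by blast
    moreover have "\<not> dist x' z < dist x z" using next_sibling_ex[OF that(2,1)] next_sibling_in that(4) by blast
    ultimately show ?thesis using that by (intro sibling_dist[of x z x']) auto
  qed
  fix x x' z assume x: "succ x z" and x': "succ x' z"
  show "x = x'"
  proof (cases "p x z \<and> \<not> (\<exists>c\<in>V. next_sibling V p x c)")
    case True
    then have "p x' z \<and> \<not> (\<exists>c\<in>V. next_sibling V p x' c)"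
      using x' no_mix unfolding postorder_succ_def by blast
    with True show ?thesis by (intro last) auto
  next
    case False
    then obtain c where c: "next_sibling V p x c" "first_leaf V p c z"
      using x unfolding postorder_succ_def by blast
    then obtain c' where c': "next_sibling V p x' c'" "first_leaf V p c' z"
      using x' no_mix unfolding postorder_succ_def by blast
    have "c = c'"
      using first_leaf_inj[OF c(2) c'(2)] next_sibling_not_first_child c(1) c'(1) by blast
    with c c' next_sibling_inj show ?thesis by blast
  qed
qed

text \<open>
From \<open>x\<close>, the successor visits the subtrees of the later siblings one after the other and then the parent.
Within a subtree the same holds by induction on the level of the parent; the inner induction is on the number of
later siblings.
\<close>

lemma succ_reaches_parent: "p x y \<Longrightarrow> succ\<^sup>*\<^sup>* x y"
proof (induction "level y" arbitrary: x y rule: less_induct)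
  case less
  have climb: "succ\<^sup>*\<^sup>* l c" if "(R ^^ k) c l" "level c < level y" for k c l
    using that
  proof (induction k arbitrary: c)
    case (Suc k)
    obtain c1 where c1: "R c c1" "(R ^^ k) c1 l" using Suc.prems(1) by (rule relpowp_Suc_E2)
    have "p c1 c" using first_child_p[OF c1(1)] .
    then have "succ\<^sup>*\<^sup>* c1 c" "level c1 < level y" using less.hyps Suc.prems(2) p_level[of c1 c] by auto
    with Suc.IH[OF c1(2)] show ?case by (meson rtranclp_trans)
  qed simp
  show ?case
    using less.prems
  proof (induction "card {z. p z y \<and> dist x y < dist z y}" arbitrary: x rule: less_induct)
    case less': (less x)
    show ?case
    proof (cases "\<exists>c\<in>V. next_sibling V p x c")
      case False
      then have "succ x y" using less'.prems by (simp add: postorder_succ_def)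
      then show ?thesis by (rule r_into_rtranclp)
    next
      case True
      then obtain c where c: "next_sibling V p x c" "c \<in> V" by blast
      obtain y' where y': "p x y'" "p c y'" "dist x y' < dist c y'" using next_siblingD[OF c(1)] by metis
      have [simp]: "y' = y" using p_unique[OF y'(1) less'.prems] .
      obtain l where l: "first_leaf V p c l" using first_leaf_ex[OF c(2)] by blast
      then obtain k where k: "(R ^^ k) c l" by (auto simp: first_leaf_def)
      have "succ x l" using c l unfolding postorder_succ_def by blast
      moreover have "succ\<^sup>*\<^sup>* l c" using climb[OF k] p_level[OF y'(2)] by simp
      moreover have "succ\<^sup>*\<^sup>* c y"
      proof (rule less'.hyps)
        have "finite {z. p z y \<and> dist x y < dist z y}"
          by (rule finite_subset[OF _ p_finite[of y]]) auto
        then show "card {z. p z y \<and> dist c y < dist z y} < card {z. p z y \<and> dist x y < dist z y}"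
          using y' by (intro psubset_card_mono) auto
      qed (use y' in simp)
      ultimately show ?thesis by (meson converse_rtranclp_into_rtranclp rtranclp_trans)
    qed
  qed
qed

text \<open>
A finite orbit would be closed under parents, but a vertex of greatest level in it has a parent of higher level.
\<close>

lemma succ_aperiodic:
  assumes "(succ ^^ n) x x" shows "n = 0"
proof (rule ccontr)
  assume n: "n \<noteq> 0"
  then obtain w where "succ w x" using assms by (cases n) (auto elim: relpowp_Suc_E)
  then have xV: "x \<in> V" using succ_in by blast
  \<comment> \<open>A periodic orbit is exhausted by its first \<open>n\<close> steps.\<close>
  have fold: "\<exists>k<n. (succ ^^ k) x y" if "(succ ^^ m) x y" for m y
    using that
  proof (induction m rule: less_induct)
    case (less m)
    show ?case
    proof (cases "m < n")
      case False
      then have "(succ ^^ (m - n)) x y"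
        using relpowp_right_unique_diff[OF right_unique_succ assms less.prems] by simp
      then show ?thesis using less.IH[of "m - n"] False n by simp
    qed (use less.prems in blast)
  qed
  define T where "T = {y. succ\<^sup>*\<^sup>* x y}"
  have sub: "T \<subseteq> (\<Union>k<n. {y. (succ ^^ k) x y})"
  proof
    fix y assume "y \<in> T"
    then obtain m where "(succ ^^ m) x y" by (auto simp: T_def rtranclp_power)
    from fold[OF this] show "y \<in> (\<Union>k<n. {y. (succ ^^ k) x y})" by auto
  qed
  have fin_k: "finite {y. (succ ^^ k) x y}" for k
  proof (cases "\<exists>y. (succ ^^ k) x y")
    case True
    then obtain y where y: "(succ ^^ k) x y" ..
    have "{y. (succ ^^ k) x y} \<subseteq> {y}"
      using relpowp_right_unique[OF _ _ y] right_uniqueD[OF right_unique_succ] by blast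
    then show ?thesis by (rule finite_subset) simp
  qed simp
  have fin: "finite T" by (rule finite_subset[OF sub]) (intro finite_UN_I fin_k finite_lessThan)
  have OV: "y \<in> V" if "y \<in> T" for y
    using that xV unfolding T_def mem_Collect_eq by (induction rule: rtranclp_induct) (use succ_in in blast)+
  have "x \<in> T" by (simp add: T_def)
  then have "Max (level ` T) \<in> level ` T" using fin by (intro Max_in) auto
  then obtain y where y: "y \<in> T" "level y = Max (level ` T)" by auto
  obtain y' where y': "p y y'" using p_total[OF OV[OF y(1)]] by blast
  have "y' \<in> T" using y(1) succ_reaches_parent[OF y'] unfolding T_def by (simp add: rtranclp_trans[of succ x y y'])
  then have "level y' \<le> level y" using fin y(2) by simp
  with p_level[OF y'] show False by simp
qed

text \<open>
With \<open>succ_orbit_root_unique\<close>, this makes sending each vertex of such an orbit to the root of the orbit a partial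
map that is not finite-to-one.
\<close>

lemma infinite_succ_orbit:
  assumes "z \<in> V" shows "infinite {x\<in>V. \<exists>k. (succ ^^ k) z x}"
proof -
  have ex: "\<exists>x. (succ ^^ k) z x \<and> x \<in> V" for k
  proof (induction k)
    case (Suc k)
    then show ?case using succ_ex succ_in by (metis relpowp_Suc_I)
  qed (use assms in simp)
  then obtain f where f: "\<And>k. (succ ^^ k) z (f k)" "\<And>k. f k \<in> V" by metis
  have "inj f"
  proof (rule injI)
    have wlog: "m = n" if "f m = f n" "m \<le> n" for m n
    proof -
      have "(succ ^^ (n - m)) (f m) (f m)"
        using relpowp_right_unique_diff[OF right_unique_succ f(1) f(1) that(2)] that(1) by simp
      then show ?thesis using succ_aperiodic that(2) by fastforce
    qed
    fix m n assume "f m = f n"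
    then show "m = n" using wlog[of m n] wlog[of n m] by (cases "m \<le> n") auto
  qed
  then have "infinite (range f)" by (rule range_inj_infinite)
  moreover have "range f \<subseteq> {x\<in>V. \<exists>k. (succ ^^ k) z x}" using f by auto
  ultimately show ?thesis by (rule infinite_super[rotated])
qed

lemma succ_orbit_root_unique:
  assumes "(succ ^^ m) y x" "(succ ^^ n) y' x" "\<not> (\<exists>w\<in>V. succ w y)" "\<not> (\<exists>w\<in>V. succ w y')"
  shows "y = y'"
proof -
  have wlog: "a = b" if "(succ ^^ m) a x" "(succ ^^ n) b x" "\<not> (\<exists>w\<in>V. succ w a)" "m \<le> n" for a b m n
  proof -
    have d: "(succ ^^ (n - m)) b a" by (rule relpowp_left_unique_diff[OF left_unique_succ that(1,2,4)])
    show ?thesis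
    proof (cases "n - m")
      case (Suc k)
      with d obtain w where "succ w a" by (auto elim: relpowp_Suc_E)
      with that(3) succ_in show ?thesis by blast
    qed (use d in simp)
  qed
  show ?thesis using wlog[OF assms(1,2,3)] wlog[OF assms(2,1,4)] by (cases "m \<le> n") auto
qed

end

text \<open>
Following \<open>s\<close> forwards and its inverse backwards from \<open>v\<close> gives an enumeration of the component of \<open>v\<close> by the
integers, which is injective because there are no periodic points.
\<close>

lemma directed_line_component:
  fixes s :: "'a \<Rightarrow> 'a \<Rightarrow> bool"
  assumes s_in: "\<And>x y. s x y \<Longrightarrow> x \<in> V \<and> y \<in> V"
    and total: "\<And>x. x \<in> V \<Longrightarrow> \<exists>y. s x y" and onto: "\<And>y. y \<in> V \<Longrightarrow> \<exists>x. s x y"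
    and right: "right_unique s" and left: "left_unique s"
    and aperiodic: "\<And>n x. (s ^^ n) x x \<Longrightarrow> n = 0"
    and C: "C \<in> graph_components (with_proj \<lparr>pverts = V, parcs = {(x, y). s x y}\<rparr>)"
  shows "directed_biinfinite_path C"
proof -
  let ?g = "\<lparr>pverts = V, parcs = {(x, y). s x y}\<rparr>"
  have wf: "pair_wf_digraph ?g" by unfold_locales (use s_in in auto)
  obtain v where v: "v \<in> V" and C': "C = with_proj (component_at ?g v)"
    using graph_components_component_at[OF wf C] by auto
  define F where "F x = (SOME y. s x y)" for x
  define B where "B y = (SOME x. s x y)" for y
  have F: "s x (F x)" if "x \<in> V" for x unfolding F_def using total[OF that] by (rule someI_ex)
  have B: "s (B x) x" if "x \<in> V" for x unfolding B_def using onto[OF that] by (rule someI_ex)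
  \<comment> \<open>The bi-infinite orbit of \<open>v\<close>.\<close>
  define c where "c n = (if 0 \<le> n then (F ^^ nat n) v else (B ^^ nat (- n)) v)" for n :: int
  have FV: "(F ^^ n) v \<in> V" for n by (induction n) (use v F s_in in auto)
  have BV: "(B ^^ n) v \<in> V" for n by (induction n) (use v B s_in in auto)
  have cV: "c n \<in> V" for n by (simp add: c_def FV BV)
  have step: "s (c n) (c (n + 1))" for n
  proof (cases "0 \<le> n")
    case True
    then have "c (n + 1) = F (c n)" by (simp add: c_def nat_add_distrib)
    then show ?thesis using F[OF cV] by simp
  next
    case False
    then have "nat (- n) = Suc (nat (- (n + 1)))" by simp
    then have "c n = B (c (n + 1))" using False by (cases "n = -1") (simp_all add: c_def)
    then show ?thesis using B[OF cV] by simp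
  qed
  have steps: "(s ^^ k) (c n) (c (n + int k))" for n k
  proof (induction k)
    case (Suc k)
    show ?case using relpowp_Suc_I[OF Suc, of "c (n + int (Suc k))"] step[of "n + int k"] by (simp add: algebra_simps)
  qed simp
  have "inj c"
  proof (rule injI)
    have wlog: "m = n" if "c m = c n" "m \<le> n" for m n
      using steps[of "nat (n - m)" m] aperiodic[of "nat (n - m)" "c m"] that by simp
    fix m n assume "c m = c n"
    then show "m = n" using wlog[of m n] wlog[of n m] by (cases "m \<le> n") auto
  qed
  have s_c: "s x y \<longleftrightarrow> (\<exists>n. x = c n \<and> y = c (n + 1))" if "x \<in> range c" for x y
    using that step right_uniqueD[OF right] by blast
  have range_c: "pverts (component_at ?g v) = range c"
  proof (intro equalityI subsetI)
    fix w assume "w \<in> pverts (component_at ?g v)"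
    then have "(v, w) \<in> (parcs ?g \<union> (parcs ?g)\<inverse>)\<^sup>*" by (simp only: pverts_component_at mem_Collect_eq)
    then show "w \<in> range c"
    proof induction
      case base
      show ?case by (rule range_eqI[of _ _ 0]) (simp add: c_def)
    next
      case (step y z)
      then obtain n where y: "y = c n" by auto
      from step.hyps(2) consider "s y z" | "s z y" by auto
      then show ?case
      proof cases
        case 1
        then have "z = c (n + 1)" using right_uniqueD[OF right] \<open>\<And>n. s (c n) (c (n + 1))\<close> y by blast
        then show ?thesis by simp
      next
        case 2
        have "s (c (n - 1)) (c n)" using \<open>\<And>n. s (c n) (c (n + 1))\<close>[of "n - 1"] by simp
        then have "z = c (n - 1)" using left_uniqueD[OF left] 2 y by blast
        then show ?thesis by simp
      qed
    qed
  next
    fix w assume "w \<in> range c"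
    then obtain n where w: "w = c n" by auto
    have "c n \<in> pverts (component_at ?g v)"
    proof (induction n rule: int_induct[where k=0])
      case base
      show ?case by (simp add: c_def pverts_component_at)
    next
      case (step1 i)
      then show ?case using component_at_closed[OF step1(2), of "c (i + 1)"] step[of i] by simp
    next
      case (step2 i)
      then show ?case using component_at_closed[OF step2(2), of "c (i - 1)"] step[of "i - 1"] by simp
    qed
    with w show "w \<in> pverts (component_at ?g v)" by simp
  qed
  define d where "d = the_inv c"
  have d: "d (c n) = n" for n unfolding d_def by (rule the_inv_f_f[OF \<open>inj c\<close>])
  have arcs: "parcs (component_at ?g v) = range (\<lambda>n. (c n, c (n + 1)))"
    using s_c step by (auto simp: parcs_component_at range_c)
  define iso where "iso = \<lparr>iso_verts = d, iso_arcs = map_prod d d, iso_head = snd, iso_tail = fst\<rparr>"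
  have "pre_digraph.digraph_isomorphism C iso"
    unfolding pre_digraph.digraph_isomorphism_def
  proof (intro conjI ballI)
    show "wf_digraph C" using C by (simp add: graph_components_def pre_digraph.max_subgraph_def subgraph_def)
    show "inj_on (iso_verts iso) (verts C)"
      by (auto simp: C' range_c iso_def d inj_on_def)
    show "inj_on (iso_arcs iso) (arcs C)"
      by (auto simp: C' arcs iso_def d inj_on_def)
  qed (auto simp: C' iso_def)
  moreover have "with_proj int_line = app_iso iso C"
    by (auto simp: app_iso_def C' range_c arcs iso_def with_proj_def int_line_def image_image d)
  ultimately show ?thesis by (auto simp: directed_biinfinite_path_def digraph_iso_def)
qed

section \<open>Equivariant and measurable relations\<close>

abbreviation measurable_relation :: "('a::euclidean_space set \<Rightarrow> 'a \<Rightarrow> 'a \<Rightarrow> bool) \<Rightarrow> bool" where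
  "measurable_relation R \<equiv>
     Measurable.pred (configs \<Otimes>\<^sub>M borel \<Otimes>\<^sub>M borel) (\<lambda>(V, x, y). R V x y)"

text \<open>
Membership of the points is not asked for: isometries are injective, so relations built from membership,
distances and quantifiers over \<open>V\<close> satisfy this for arbitrary points.
\<close>

definition equivariant :: "('a::euclidean_space set \<Rightarrow> 'a \<Rightarrow> 'a \<Rightarrow> bool) \<Rightarrow> bool" where
  "equivariant R \<longleftrightarrow> (\<forall>\<theta> V x y. isometry \<theta> \<longrightarrow> R (\<theta> ` V) (\<theta> x) (\<theta> y) = R V x y)"

lemma equivariantD: "equivariant R \<Longrightarrow> isometry \<theta> \<Longrightarrow> R (\<theta> ` V) (\<theta> x) (\<theta> y) = R V x y"
  by (simp add: equivariant_def)

lemma Collect_image_eq: "{z \<in> f ` V. P z} = f ` {z \<in> V. P (f z)}"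
  by auto

lemma finite_Collect_isometry:
  "isometry \<theta> \<Longrightarrow> finite {z \<in> \<theta> ` V. P z} \<longleftrightarrow> finite {z \<in> V. P (\<theta> z)}"
  unfolding Collect_image_eq
  by (rule finite_image_iff) (blast intro: isometry_inj inj_on_subset)

lemma finite_isometry_image: "isometry \<theta> \<Longrightarrow> finite (\<theta> ` V) \<longleftrightarrow> finite V"
  using finite_Collect_isometry[of \<theta> V "\<lambda>_. True"] by simp

lemma card_Collect_isometry:
  "isometry \<theta> \<Longrightarrow> card {z \<in> \<theta> ` V. P z} = card {z \<in> V. P (\<theta> z)}"
  unfolding Collect_image_eq
  by (rule card_image) (blast intro: isometry_inj inj_on_subset)

lemma dist_isometry: "isometry \<theta> \<Longrightarrow> dist (\<theta> x) (\<theta> y) = dist x y"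
  by (simp add: isometry_def)

lemma isometry_eq_iff: "isometry \<theta> \<Longrightarrow> \<theta> x = \<theta> y \<longleftrightarrow> x = y"
  using isometry_inj by (rule inj_eq)

lemma isometry_mem_iff: "isometry \<theta> \<Longrightarrow> \<theta> x \<in> \<theta> ` V \<longleftrightarrow> x \<in> V"
  using isometry_inj by (rule inj_image_mem_iff)

lemmas isometry_simps = finite_Collect_isometry card_Collect_isometry dist_isometry
  isometry_eq_iff isometry_mem_iff

lemma equivariant_relpowp:
  assumes R: "equivariant R" and R_in: "\<And>V x y. R V x y \<Longrightarrow> x \<in> V \<and> y \<in> V"
  shows "equivariant (\<lambda>V. R V ^^ k)"
  unfolding equivariant_def
proof (intro allI impI)
  fix \<theta> :: "'a \<Rightarrow> 'a" and V x y assume \<theta>: "isometry \<theta>"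
  show "(R (\<theta> ` V) ^^ k) (\<theta> x) (\<theta> y) = (R V ^^ k) x y"
  proof (induction k arbitrary: y)
    case (Suc k)
    have "(R (\<theta> ` V) ^^ Suc k) (\<theta> x) (\<theta> y) \<longleftrightarrow>
        (\<exists>z\<in>\<theta> ` V. (R (\<theta> ` V) ^^ k) (\<theta> x) z \<and> R (\<theta> ` V) z (\<theta> y))"
      using R_in[of "\<theta> ` V"] by (auto simp: OO_def)
    also have "\<dots> \<longleftrightarrow> (\<exists>z\<in>V. (R V ^^ k) x z \<and> R V z y)"
      using Suc equivariantD[OF R \<theta>] by simp
    also have "\<dots> \<longleftrightarrow> (R V ^^ Suc k) x y"
      using R_in[of V] by (auto simp: OO_def)
    finally show ?case .
  qed (simp add: isometry_eq_iff[OF \<theta>])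
qed

lemma measurable_relpowp:
  assumes R: "measurable_relation R" and R_in: "\<And>V x y. R V x y \<Longrightarrow> x \<in> V \<and> y \<in> V"
  shows "measurable_relation (\<lambda>V. R V ^^ k)"
proof (induction k)
  case 0
  show ?case unfolding split_def relpowp.simps by measurable
next
  case (Suc k)
  note [measurable (raw)] = pred_relation[OF Suc] pred_relation[OF R]
  have "(R V ^^ Suc k) x y \<longleftrightarrow> (\<exists>z\<in>V. (R V ^^ k) x z \<and> R V z y)" for V x y
    using R_in[of V] by (auto simp: OO_def)
  moreover have "measurable_relation (\<lambda>V x y. \<exists>z\<in>V. (R V ^^ k) x z \<and> R V z y)"
    unfolding split_def by measurable
  ultimately show ?case by presburger
qed

lemma pred_finite_config [measurable (raw)]:
  assumes "U \<in> A \<rightarrow>\<^sub>M configs"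
  shows "Measurable.pred A (\<lambda>a. finite (U a))"
  using pred_finite_points[OF assms, of "\<lambda>_ _. True"] by simp

lemma pred_less_nat [measurable (raw)]:
  fixes f g :: "'b \<Rightarrow> nat"
  assumes [measurable]: "f \<in> A \<rightarrow>\<^sub>M count_space UNIV" "g \<in> A \<rightarrow>\<^sub>M count_space UNIV"
  shows "Measurable.pred A (\<lambda>a. f a < g a)"
proof -
  have "Measurable.pred A (\<lambda>a. real (f a) < real (g a))" by measurable
  then show ?thesis by simp
qed

lemma pred_eq_nat [measurable (raw)]:
  fixes f g :: "'b \<Rightarrow> nat"
  assumes [measurable]: "f \<in> A \<rightarrow>\<^sub>M count_space UNIV" "g \<in> A \<rightarrow>\<^sub>M count_space UNIV"
  shows "Measurable.pred A (\<lambda>a. f a = g a)"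
proof -
  have "Measurable.pred A (\<lambda>a. \<not> f a < g a \<and> \<not> g a < f a)" by measurable
  then show ?thesis by (simp add: not_less eq_iff conj_commute)
qed

section \<open>Levels and nearest higher points\<close>

text \<open>
The distance to the nearest other point. The value 0 for a point without others is a default.
\<close>

definition gap :: "'a::metric_space set \<Rightarrow> 'a \<Rightarrow> real" where
  "gap V x = (if \<exists>y\<in>V. y \<noteq> x then Inf (dist x ` (V - {x})) else 0)"

text \<open>
An order isomorphism from \<open>[0, \<infinity>)\<close> to \<open>[0, 1)\<close>, so that an infinite set of values has an accumulation point even
when the gaps are unbounded.
\<close>

definition squeezed_gap :: "'a::metric_space set \<Rightarrow> 'a \<Rightarrow> real" where
  "squeezed_gap V x = gap V x / (1 + gap V x)"

text \<open>
The least accumulation point of the squeezed gaps, counted with multiplicity: below smaller thresholds there are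
only finitely many points.
\<close>

definition accumulation :: "'a::metric_space set \<Rightarrow> real" where
  "accumulation V = (if finite V then 0 else Sup {t. finite {x\<in>V. squeezed_gap V x < t}})"

text \<open>
A point whose squeezed gap equals the accumulation value gets level 0, as division by zero yields 0.
\<close>

definition level :: "'a::metric_space set \<Rightarrow> 'a \<Rightarrow> nat" where
  "level V x = nat \<lfloor>1 / \<bar>squeezed_gap V x - accumulation V\<bar>\<rfloor>"

definition nearest_higher :: "'a::metric_space set \<Rightarrow> 'a \<Rightarrow> 'a \<Rightarrow> bool" where
  "nearest_higher V x y \<longleftrightarrow> x \<in> V \<and> y \<in> V \<and> level V x < level V y \<and>
     (\<forall>z\<in>V. level V x < level V z \<longrightarrow> dist x y \<le> dist x z)"

lemma gap_isometry: "isometry \<theta> \<Longrightarrow> gap (\<theta> ` V) (\<theta> x) = gap V x"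
proof -
  assume \<theta>: "isometry \<theta>"
  have "\<theta> ` V - {\<theta> x} = \<theta> ` (V - {x})" using isometry_eq_iff[OF \<theta>] by auto
  then have "dist (\<theta> x) ` (\<theta> ` V - {\<theta> x}) = dist x ` (V - {x})"
    by (simp add: image_image dist_isometry[OF \<theta>])
  then show ?thesis by (simp add: gap_def isometry_eq_iff[OF \<theta>])
qed

lemma squeezed_gap_isometry: "isometry \<theta> \<Longrightarrow> squeezed_gap (\<theta> ` V) (\<theta> x) = squeezed_gap V x"
  by (simp add: squeezed_gap_def gap_isometry)

lemma accumulation_isometry: "isometry \<theta> \<Longrightarrow> accumulation (\<theta> ` V) = accumulation V"
  unfolding accumulation_def
  by (simp only: finite_Collect_isometry squeezed_gap_isometry finite_isometry_image)

lemma level_isometry: "isometry \<theta> \<Longrightarrow> level (\<theta> ` V) (\<theta> x) = level V x"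
  by (simp add: level_def squeezed_gap_isometry accumulation_isometry)

lemma equivariant_nearest_higher: "equivariant nearest_higher"
  unfolding equivariant_def nearest_higher_def
  by (simp add: level_isometry isometry_simps)

lemma gap_less_iff: "gap V x < c \<longleftrightarrow>
    (if \<exists>y\<in>V. y \<noteq> x then \<exists>y\<in>V. y \<noteq> x \<and> dist x y < c else 0 < c)"
proof (cases "\<exists>y\<in>V. y \<noteq> x")
  case True
  have "bdd_below (dist x ` (V - {x}))" by (rule bdd_belowI[of _ 0]) auto
  then have "Inf (dist x ` (V - {x})) < c \<longleftrightarrow> (\<exists>d\<in>dist x ` (V - {x}). d < c)"
    using True by (intro cInf_less_iff) auto
  with True show ?thesis by (auto simp: gap_def)
qed (simp add: gap_def)

lemma measurable_gap [measurable (raw)]: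
  assumes [measurable]: "U \<in> A \<rightarrow>\<^sub>M configs" "f \<in> A \<rightarrow>\<^sub>M borel"
  shows "(\<lambda>a. gap (U a) (f a)) \<in> borel_measurable A"
proof (rule borel_measurableI_less)
  fix c
  show "{a \<in> space A. gap (U a) (f a) < c} \<in> sets A"
    unfolding gap_less_iff by measurable
qed

lemma measurable_squeezed_gap [measurable (raw)]:
  assumes [measurable]: "U \<in> A \<rightarrow>\<^sub>M configs" "f \<in> A \<rightarrow>\<^sub>M borel"
  shows "(\<lambda>a. squeezed_gap (U a) (f a)) \<in> borel_measurable A"
  unfolding squeezed_gap_def by measurable

lemma gap_nonneg: "0 \<le> gap V x"
  using gap_less_iff[of V x 0] by (auto simp: not_less[symmetric] split: if_splits dest: less_le_trans)

lemma squeezed_gap_bounds: "0 \<le> squeezed_gap V x" "squeezed_gap V x < 1"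
  using gap_nonneg[of V x] by (simp_all add: squeezed_gap_def)

text \<open>
The supremum in the definition of \<open>accumulation\<close> is that of a nonempty bounded set of thresholds, closed
downwards.
\<close>

lemma finite_sublevel_thresholds:
  fixes V :: "'a::metric_space set"
  assumes V: "infinite V"
  defines "S \<equiv> {t. finite {x\<in>V. squeezed_gap V x < t}}"
  shows "0 \<in> S" "bdd_above S" "\<And>t t'. t \<in> S \<Longrightarrow> t' \<le> t \<Longrightarrow> t' \<in> S"
    "accumulation V = Sup S"
proof -
  have empty: "{x\<in>V. squeezed_gap V x < 0} = {}"
    using squeezed_gap_bounds(1)[of V] by (auto simp: not_less[symmetric])
  show "0 \<in> S" unfolding S_def mem_Collect_eq empty by simp
  show down: "t' \<in> S" if "t \<in> S" "t' \<le> t" for t t'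
    using that unfolding S_def mem_Collect_eq
    by (elim finite_subset[rotated]) auto
  have "{x\<in>V. squeezed_gap V x < 1} = V" using squeezed_gap_bounds(2) by auto
  then have "1 \<notin> S" unfolding S_def using V by simp
  then show "bdd_above S" using down by (intro bdd_aboveI[of _ 1]) (metis linear)
  show "accumulation V = Sup S" unfolding accumulation_def S_def using V by simp
qed

text \<open>
Rational thresholds suffice, which gives measurability.
\<close>

lemma le_accumulation_iff:
  assumes V: "infinite V"
  shows "c \<le> accumulation V \<longleftrightarrow>
    (\<forall>q. of_rat q < c \<longrightarrow> finite {x\<in>V. squeezed_gap V x < of_rat q})"
proof -
  note S = finite_sublevel_thresholds[OF V]
  let ?S = "{t. finite {x\<in>V. squeezed_gap V x < t}}"
  show ?thesis
  proof
    assume c: "c \<le> accumulation V"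
    show "\<forall>q. of_rat q < c \<longrightarrow> finite {x\<in>V. squeezed_gap V x < of_rat q}"
    proof (intro allI impI)
      fix q assume "real_of_rat q < c"
      then have "real_of_rat q < Sup ?S" using c S(4) by simp
      then obtain t where "t \<in> ?S" "real_of_rat q < t" using S(1) by (elim less_cSupE) auto
      then have "real_of_rat q \<in> ?S" using S(3) less_imp_le by blast
      then show "finite {x\<in>V. squeezed_gap V x < of_rat q}" by simp
    qed
  next
    assume fin: "\<forall>q. of_rat q < c \<longrightarrow> finite {x\<in>V. squeezed_gap V x < of_rat q}"
    show "c \<le> accumulation V"
    proof (rule ccontr)
      assume "\<not> c \<le> accumulation V"
      then obtain q where q: "accumulation V < real_of_rat q" "real_of_rat q < c"
        using of_rat_dense[of "accumulation V" c] by auto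
      then have "real_of_rat q \<in> ?S" using fin by simp
      then have "real_of_rat q \<le> accumulation V" unfolding S(4) using S(2) by (rule cSup_upper)
      with q show False by simp
    qed
  qed
qed

lemma measurable_accumulation [measurable (raw)]:
  assumes [measurable]: "U \<in> A \<rightarrow>\<^sub>M configs"
  shows "(\<lambda>a. accumulation (U a)) \<in> borel_measurable A"
proof (rule borel_measurableI_ge)
  fix c
  have iff: "c \<le> accumulation V \<longleftrightarrow> (if finite V then c \<le> 0 else
      (\<forall>q. of_rat q < c \<longrightarrow> finite {x\<in>V. squeezed_gap V x < of_rat q}))" for V :: "'b set"
    using le_accumulation_iff[of V c] by (simp add: accumulation_def)
  show "{a \<in> space A. c \<le> accumulation (U a)} \<in> sets A"
    unfolding iff by measurable
qed

lemma measurable_level [measurable (raw)]: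
  assumes [measurable]: "U \<in> A \<rightarrow>\<^sub>M configs" "f \<in> A \<rightarrow>\<^sub>M borel"
  shows "(\<lambda>a. level (U a) (f a)) \<in> A \<rightarrow>\<^sub>M count_space UNIV"
  unfolding level_def by measurable

lemma measurable_nearest_higher: "measurable_relation nearest_higher"
  unfolding nearest_higher_def split_def by measurable

lemma nearest_higher_in: "nearest_higher V x y \<Longrightarrow> x \<in> V \<and> y \<in> V"
  by (simp add: nearest_higher_def)

definition distinct_distances :: "'a::euclidean_space set \<Rightarrow> bool" where
  "distinct_distances V \<longleftrightarrow> \<not> (\<exists>w\<in>V. \<exists>x\<in>V. \<exists>y\<in>V. \<exists>z\<in>V.
     {w, x} \<noteq> {y, z} \<and> norm (w - x) = norm (y - z) \<and> norm (y - z) > 0)"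

text \<open>
The form in which distinctness of distances is used: two pairs at the same positive distance are equal.
\<close>

lemma distinct_distancesD:
  assumes "distinct_distances V" "w \<in> V" "x \<in> V" "y \<in> V" "z \<in> V" "dist w x = dist y z" "w \<noteq> x"
  shows "{w, x} = {y, z}"
proof -
  have "norm (w - x) = norm (y - z)" "norm (y - z) > 0"
    using assms(6,7) by (metis dist_norm zero_less_dist_iff)+
  then show ?thesis using assms unfolding distinct_distances_def by metis
qed

lemma gap_attained:
  assumes V: "lf_config V" "infinite V" and x: "x \<in> V"
  shows "\<exists>y\<in>V. y \<noteq> x \<and> gap V x = dist x y"
proof -
  have "infinite (V - {x})" using V(2) by simp
  then obtain y0 where y0: "y0 \<in> V" "y0 \<noteq> x" by (metis Diff_iff finite.emptyI ex_in_conv singletonI)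
  let ?S = "{y\<in>V. y \<noteq> x \<and> dist x y \<le> dist x y0}"
  have "?S \<subseteq> V \<inter> cball x (dist x y0)" by auto
  then have fin: "finite ?S" by (rule finite_subset) (use V(1) in \<open>simp add: lf_config_def\<close>)
  define d where "d = Min (dist x ` ?S)"
  have "d \<in> dist x ` ?S" unfolding d_def using fin y0 by (intro Min_in) auto
  then obtain y where y: "y \<in> V" "y \<noteq> x" "dist x y = d" by auto
  have "d \<le> dist x z" if "z \<in> V" "z \<noteq> x" for z
  proof (cases "dist x z \<le> dist x y0")
    case True
    then show ?thesis unfolding d_def using fin that by (intro Min_le) auto
  next
    case False
    have "d \<le> dist x y0" unfolding d_def using fin y0 by (intro Min_le) auto
    with False show ?thesis by simp
  qed
  then have "Inf (dist x ` (V - {x})) = d"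
    using y by (intro cInf_eq_minimum) auto
  then have "gap V x = d" using y0 by (auto simp: gap_def)
  with y show ?thesis by blast
qed

text \<open>
Two points with the same gap form, with their nearest neighbours, pairs at the same distance. These pairs
are equal, so at most two points share a gap.
\<close>

lemma finite_equal_gap:
  assumes V: "lf_config V" "infinite V" "distinct_distances V"
  shows "finite {x\<in>V. gap V x = r}"
proof (cases "\<exists>x0\<in>V. gap V x0 = r")
  case True
  then obtain x0 where x0: "x0 \<in> V" "gap V x0 = r" by blast
  obtain y0 where y0: "y0 \<in> V" "y0 \<noteq> x0" "gap V x0 = dist x0 y0"
    using gap_attained[OF V(1,2) x0(1)] by blast
  have "{x\<in>V. gap V x = r} \<subseteq> {x0, y0}"
  proof
    fix x assume "x \<in> {x\<in>V. gap V x = r}"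
    then have x: "x \<in> V" "gap V x = r" by simp_all
    obtain y where y: "y \<in> V" "y \<noteq> x" "gap V x = dist x y"
      using gap_attained[OF V(1,2) x(1)] by blast
    have "{x, y} = {x0, y0}"
      by (rule distinct_distancesD[OF V(3)]) (use x y x0 y0 in simp_all)
    then show "x \<in> {x0, y0}" by blast
  qed
  then show ?thesis by (rule finite_subset) simp
next
  case False
  then have "{x\<in>V. gap V x = r} = {}" by blast
  then show ?thesis by (simp only: finite.emptyI)
qed

lemma squeezed_gap_inj: "squeezed_gap V x = squeezed_gap V y \<Longrightarrow> gap V x = gap V y"
  using gap_nonneg[of V x] gap_nonneg[of V y] by (simp add: squeezed_gap_def field_simps)

text \<open>
Infinitely many points have their squeezed gap within any \<open>e > 0\<close> of the accumulation value, and only finitely many attain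
it. So some point comes within \<open>e\<close> without attaining it, and its level is at least the integer part of \<open>1 / e\<close>.
\<close>

lemma level_unbounded:
  assumes V: "lf_config V" "infinite V" "distinct_distances V"
  shows "\<exists>x\<in>V. n < level V x"
proof -
  define e where "e = 1 / real (Suc n)"
  have e: "0 < e" by (simp add: e_def)
  note S = finite_sublevel_thresholds[OF V(2)]
  let ?g = "squeezed_gap V" and ?a = "accumulation V"
  have "?a + e \<notin> {t. finite {x\<in>V. ?g x < t}}"
  proof
    assume "?a + e \<in> {t. finite {x\<in>V. ?g x < t}}"
    then have "?a + e \<le> ?a" unfolding S(4) using S(2) by (rule cSup_upper)
    with e show False by simp
  qed
  then have above: "infinite {x\<in>V. ?g x < ?a + e}" by simp
  have "?a - e < Sup {t. finite {x\<in>V. ?g x < t}}" using e S(4) by simp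
  then obtain t where t: "t \<in> {t. finite {x\<in>V. ?g x < t}}" "?a - e < t"
    using S(1) by (elim less_cSupE) auto
  then have below: "finite {x\<in>V. ?g x < ?a - e}"
    by (intro finite_subset[of "{x\<in>V. ?g x < ?a - e}" "{x\<in>V. ?g x < t}"]) auto
  have at: "finite {x\<in>V. ?g x = ?a}"
  proof (cases "\<exists>x0\<in>V. ?g x0 = ?a")
    case True
    then obtain x0 where "?g x0 = ?a" by blast
    have "{x\<in>V. ?g x = ?a} \<subseteq> {x\<in>V. gap V x = gap V x0}"
    proof
      fix x assume "x \<in> {x\<in>V. ?g x = ?a}"
      then have "x \<in> V" "?g x = ?g x0" using \<open>?g x0 = ?a\<close> by simp_all
      then show "x \<in> {x\<in>V. gap V x = gap V x0}" using squeezed_gap_inj[of V x x0] by simp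
    qed
    then show ?thesis by (rule finite_subset) (rule finite_equal_gap[OF V])
  next
    case False
    then have "{x\<in>V. ?g x = ?a} = {}" by blast
    then show ?thesis by (simp only: finite.emptyI)
  qed
  have "infinite ({x\<in>V. ?g x < ?a + e} - ({x\<in>V. ?g x < ?a - e} \<union> {x\<in>V. ?g x = ?a}))"
    by (intro Diff_infinite_finite finite_UnI below at above)
  then have "{x\<in>V. ?g x < ?a + e} - ({x\<in>V. ?g x < ?a - e} \<union> {x\<in>V. ?g x = ?a}) \<noteq> {}"
    by (intro notI) simp
  then obtain x where x: "x \<in> V" "?g x < ?a + e" "\<not> ?g x < ?a - e" "?g x \<noteq> ?a" by blast
  have "0 < \<bar>?g x - ?a\<bar>" "\<bar>?g x - ?a\<bar> \<le> e" using x by auto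
  then have "1 / e \<le> 1 / \<bar>?g x - ?a\<bar>" by (intro divide_left_mono) auto
  then have "real (Suc n) \<le> 1 / \<bar>?g x - ?a\<bar>" by (simp add: e_def)
  then have "int (Suc n) \<le> \<lfloor>1 / \<bar>?g x - ?a\<bar>\<rfloor>" by (simp add: le_floor_iff)
  then have "n < level V x" unfolding level_def by linarith
  with x show ?thesis by blast
qed

text \<open>
There are points of higher level, and by local finiteness only finitely many within a given distance.
\<close>

lemma nearest_higher_total:
  assumes V: "lf_config V" "infinite V" "distinct_distances V" and x: "x \<in> V"
  shows "\<exists>y. nearest_higher V x y"
proof -
  obtain y0 where y0: "y0 \<in> V" "level V x < level V y0" using level_unbounded[OF V] by blast
  let ?S = "{y\<in>V. level V x < level V y \<and> dist x y \<le> dist x y0}"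
  have "?S \<subseteq> V \<inter> cball x (dist x y0)" by auto
  then have fin: "finite ?S" by (rule finite_subset) (use V(1) in \<open>simp add: lf_config_def\<close>)
  define d where "d = Min (dist x ` ?S)"
  have "d \<in> dist x ` ?S" unfolding d_def using fin y0 by (intro Min_in) auto
  then obtain y where y: "y \<in> V" "level V x < level V y" "dist x y = d" by auto
  have "d \<le> dist x z" if "z \<in> V" "level V x < level V z" for z
  proof (cases "dist x z \<le> dist x y0")
    case True
    then show ?thesis unfolding d_def using fin that by (intro Min_le) auto
  next
    case False
    have "d \<le> dist x y0" unfolding d_def using fin y0 by (intro Min_le) auto
    with False show ?thesis by simp
  qed
  with y x have "nearest_higher V x y" by (simp add: nearest_higher_def)
  then show ?thesis ..
qed

lemma nearest_higher_unique:
  assumes V: "distinct_distances V" and y: "nearest_higher V x y" "nearest_higher V x y'"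
  shows "y = y'"
proof -
  have y1: "x \<in> V" "y \<in> V" "level V x < level V y"
    and y2: "y' \<in> V" "level V x < level V y'" using y by (simp_all add: nearest_higher_def)
  have "dist x y \<le> dist x y'" "dist x y' \<le> dist x y"
    using y y1 y2 by (simp_all add: nearest_higher_def)
  then have "dist x y = dist x y'" by simp
  moreover have "x \<noteq> y" using y1 by auto
  ultimately have "{x, y} = {x, y'}"
    by (rule distinct_distancesD[OF V y1(1,2,1) y2(1)])
  then show ?thesis by (auto simp: doubleton_eq_iff)
qed

lemma nearest_higher_sibling_dist:
  assumes V: "distinct_distances V"
    and xx': "nearest_higher V x y" "nearest_higher V x' y" "dist x y = dist x' y"
  shows "x = x'"
proof -
  have "{x, y} = {x', y}"
    by (rule distinct_distancesD[OF V _ _ _ _ xx'(3)]) (use xx' in \<open>auto simp: nearest_higher_def\<close>)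
  then show ?thesis by (auto simp: doubleton_eq_iff)
qed

text \<open>
The configurations on which nearest higher points form a forest; the empty one is included because the
point process may be empty.
\<close>

definition forest_config :: "'a::euclidean_space set \<Rightarrow> bool" where
  "forest_config V \<longleftrightarrow> lf_config V \<and> distinct_distances V \<and> (V = {} \<or> infinite V) \<and>
     (\<forall>y\<in>V. finite {x\<in>V. nearest_higher V x y})"

lemma metric_forest_nearest_higher:
  assumes V: "forest_config V"
  shows "metric_forest V (nearest_higher V) (level V)"
proof
  fix x y
  show "nearest_higher V x y \<Longrightarrow> x \<in> V \<and> y \<in> V" by (rule nearest_higher_in)
  show "nearest_higher V x y \<Longrightarrow> level V x < level V y" by (simp add: nearest_higher_def)
  show "x \<in> V \<Longrightarrow> \<exists>y. nearest_higher V x y"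
    using V nearest_higher_total[of V x] by (auto simp: forest_config_def)
  show "finite {x. nearest_higher V x y}"
  proof (cases "y \<in> V")
    case True
    then have "finite {x\<in>V. nearest_higher V x y}" using V by (simp add: forest_config_def)
    also have "{x\<in>V. nearest_higher V x y} = {x. nearest_higher V x y}" by (auto simp: nearest_higher_def)
    finally show ?thesis .
  qed (simp add: nearest_higher_def)
  fix x' y'
  show "nearest_higher V x y \<Longrightarrow> nearest_higher V x y' \<Longrightarrow> y = y'"
    using V nearest_higher_unique[of V x y y'] by (simp add: forest_config_def)
  show "nearest_higher V x y \<Longrightarrow> nearest_higher V x' y \<Longrightarrow> dist x y = dist x' y \<Longrightarrow> x = x'"
    using V nearest_higher_sibling_dist[of V x y x'] by (simp add: forest_config_def)
qed

section \<open>Matching and successor on configurations\<close>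

lemmas [measurable (raw)] = pred_relation[OF measurable_nearest_higher]
lemmas nearest_higher_isometry = equivariantD[OF equivariant_nearest_higher]

lemma equivariant_nearest_higher_iterate: "equivariant (\<lambda>V. nearest_higher V ^^ k)"
  by (rule equivariant_relpowp[OF equivariant_nearest_higher]) (rule nearest_higher_in)

lemma measurable_nearest_higher_iterate: "measurable_relation (\<lambda>V. nearest_higher V ^^ k)"
  by (rule measurable_relpowp[OF measurable_nearest_higher]) (rule nearest_higher_in)

definition config_mates :: "'a::euclidean_space set \<Rightarrow> 'a \<Rightarrow> 'a \<Rightarrow> bool" where
  "config_mates V = mates V (nearest_higher V)"

definition config_succ :: "'a::euclidean_space set \<Rightarrow> 'a \<Rightarrow> 'a \<Rightarrow> bool" where
  "config_succ V = postorder_succ V (nearest_higher V)"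

lemma card_descendants_isometry:
  "isometry \<theta> \<Longrightarrow> card (descendants (\<theta> ` V) (nearest_higher (\<theta> ` V)) (\<theta> x)) =
    card (descendants V (nearest_higher V) x)"
  by (simp add: descendants_def card_Collect_isometry
      equivariantD[OF equivariant_nearest_higher_iterate])

lemma hub_isometry: "isometry \<theta> \<Longrightarrow> hub (\<theta> ` V) (nearest_higher (\<theta> ` V)) (\<theta> x) (\<theta> y) =
    hub V (nearest_higher V) x y"
  by (simp add: hub_def card_descendants_isometry nearest_higher_isometry isometry_simps)

lemma hub_rank_isometry:
  "isometry \<theta> \<Longrightarrow> hub_rank (\<theta> ` V) (nearest_higher (\<theta> ` V)) (\<theta> x) (\<theta> y) =
    hub_rank V (nearest_higher V) x y"
  by (simp add: hub_rank_def card_Collect_isometry hub_isometry dist_isometry)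

lemma equivariant_config_mates: "equivariant config_mates"
  unfolding equivariant_def config_mates_def mates_def
  by (simp add: hub_isometry hub_rank_isometry isometry_eq_iff)

lemma measurable_card_descendants [measurable (raw)]:
  assumes [measurable]: "U \<in> A \<rightarrow>\<^sub>M configs" "f \<in> A \<rightarrow>\<^sub>M borel"
  shows "(\<lambda>a. card (descendants (U a) (nearest_higher (U a)) (f a))) \<in> A \<rightarrow>\<^sub>M count_space UNIV"
proof -
  note [measurable (raw)] = pred_relation[OF measurable_nearest_higher_iterate]
  show ?thesis unfolding descendants_def by measurable
qed

lemma pred_hub [measurable (raw)]:
  assumes [measurable]: "U \<in> A \<rightarrow>\<^sub>M configs" "f \<in> A \<rightarrow>\<^sub>M borel" "g \<in> A \<rightarrow>\<^sub>M borel"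
  shows "Measurable.pred A (\<lambda>a. hub (U a) (nearest_higher (U a)) (f a) (g a))"
proof -
  have "Measurable.pred A (\<lambda>a. f a \<in> U a \<and>
    (odd (card (descendants (U a) (nearest_higher (U a)) (f a))) \<longrightarrow> nearest_higher (U a) (f a) (g a)) \<and>
    (\<not> odd (card (descendants (U a) (nearest_higher (U a)) (f a))) \<longrightarrow> f a = g a))"
    by measurable
  then show ?thesis by (simp add: hub_def if_bool_eq_conj)
qed

lemma measurable_hub_rank [measurable (raw)]:
  assumes [measurable]: "U \<in> A \<rightarrow>\<^sub>M configs" "f \<in> A \<rightarrow>\<^sub>M borel" "g \<in> A \<rightarrow>\<^sub>M borel"
  shows "(\<lambda>a. hub_rank (U a) (nearest_higher (U a)) (f a) (g a)) \<in> A \<rightarrow>\<^sub>M count_space UNIV"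
  unfolding hub_rank_def by measurable

lemma measurable_config_mates: "measurable_relation config_mates"
  unfolding config_mates_def mates_def split_def by measurable

lemma equivariant_first_child: "equivariant (\<lambda>V. first_child V (nearest_higher V))"
  unfolding equivariant_def first_child_def
  by (simp add: nearest_higher_isometry dist_isometry)

lemma measurable_first_child: "measurable_relation (\<lambda>V. first_child V (nearest_higher V))"
  unfolding first_child_def split_def by measurable

lemma first_child_in: "first_child V (nearest_higher V) x y \<Longrightarrow> x \<in> V \<and> y \<in> V"
  by (simp add: first_child_def nearest_higher_def)

lemma equivariant_first_child_iterate:
  "equivariant (\<lambda>V. first_child V (nearest_higher V) ^^ k)"
  by (rule equivariant_relpowp[OF equivariant_first_child]) (rule first_child_in)

lemma measurable_first_child_iterate:
  "measurable_relation (\<lambda>V. first_child V (nearest_higher V) ^^ k)"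
  by (rule measurable_relpowp[OF measurable_first_child]) (rule first_child_in)

lemma equivariant_config_succ: "equivariant config_succ"
  unfolding equivariant_def config_succ_def postorder_succ_def next_sibling_def first_leaf_def leaf_def
  by (simp add: nearest_higher_isometry dist_isometry isometry_mem_iff
      equivariantD[OF equivariant_first_child_iterate])

lemma measurable_config_succ: "measurable_relation config_succ"
proof -
  note [measurable (raw)] = pred_relation[OF measurable_first_child_iterate]
  show ?thesis
    unfolding config_succ_def postorder_succ_def next_sibling_def first_leaf_def leaf_def split_def
    by measurable
qed

lemma config_succ_in: "config_succ V x y \<Longrightarrow> x \<in> V \<and> y \<in> V"
  by (auto simp: config_succ_def postorder_succ_def next_sibling_def first_leaf_def leaf_def
      nearest_higher_def)

lemma equivariant_config_succ_iterate: "equivariant (\<lambda>V. config_succ V ^^ k)"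
  by (rule equivariant_relpowp[OF equivariant_config_succ]) (rule config_succ_in)

lemma measurable_config_succ_iterate: "measurable_relation (\<lambda>V. config_succ V ^^ k)"
  by (rule measurable_relpowp[OF measurable_config_succ]) (rule config_succ_in)

section \<open>Almost sure properties and the factor graphs\<close>

text \<open>
Besides the forest, the postorder successor has to be onto, which is what makes each of its orbits infinite in
both directions.
\<close>

definition good_config :: "'a::euclidean_space set \<Rightarrow> bool" where
  "good_config V \<longleftrightarrow> forest_config V \<and> (\<forall>y\<in>V. \<exists>x\<in>V. config_succ V x y)"

lemma lf_config_isometry_iff:
  assumes "isometry \<theta>" shows "lf_config (\<theta> ` V) \<longleftrightarrow> lf_config V"
proof
  assume lf: "lf_config (\<theta> ` V)"
  show "lf_config V"
    unfolding lf_config_def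
  proof (intro allI impI)
    fix B :: "'a set" assume "bounded B"
    then obtain e where e: "\<And>x y. x \<in> B \<Longrightarrow> y \<in> B \<Longrightarrow> dist x y \<le> e"
      by (auto simp: bounded_two_points)
    then have "bounded (\<theta> ` B)"
      unfolding bounded_two_points
      by (intro exI[of _ e]) (auto simp: dist_isometry[OF assms])
    then have "finite (\<theta> ` V \<inter> \<theta> ` B)" using lf by (simp add: lf_config_def)
    then have "finite (\<theta> ` (V \<inter> B))" by (rule finite_subset[rotated]) auto
    then show "finite (V \<inter> B)" by (simp add: finite_isometry_image[OF assms])
  qed
qed (rule lf_config_isometry_image[OF assms])

lemma distinct_distances_isometry:
  assumes \<theta>: "isometry \<theta>" shows "distinct_distances (\<theta> ` V) \<longleftrightarrow> distinct_distances V"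
proof -
  have "{\<theta> w, \<theta> x} = {\<theta> y, \<theta> z} \<longleftrightarrow> {w, x} = {y, z}" for w x y z
    by (simp add: doubleton_eq_iff isometry_eq_iff[OF \<theta>])
  moreover have "norm (\<theta> x - \<theta> y) = norm (x - y)" for x y
    using dist_isometry[OF \<theta>, of x y] by (simp add: dist_norm)
  ultimately show ?thesis by (simp add: distinct_distances_def isometry_eq_iff[OF \<theta>])
qed

lemma good_config_isometry:
  assumes \<theta>: "isometry \<theta>" shows "good_config (\<theta> ` V) \<longleftrightarrow> good_config V"
  by (simp add: good_config_def forest_config_def lf_config_isometry_iff[OF \<theta>]
      distinct_distances_isometry[OF \<theta>] finite_isometry_image[OF \<theta>] finite_Collect_isometry[OF \<theta>]
      nearest_higher_isometry[OF \<theta>] equivariantD[OF equivariant_config_succ \<theta>])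

lemma pred_distinct_distances: "Measurable.pred configs (distinct_distances :: 'a::euclidean_space set \<Rightarrow> bool)"
  unfolding distinct_distances_def[abs_def] doubleton_eq_iff by measurable

context stationary_config
begin

lemma AE_forest_config:
  assumes "AE V in N. distinct_distances V"
  shows "AE V in N. forest_config V"
proof -
  have "AE V in N. \<forall>y\<in>V. finite {x\<in>V. nearest_higher V x y}"
  proof (rule AE_finite_to_one[OF measurable_nearest_higher])
    show "nearest_higher ((+) t ` V) (t + x) (t + y) = nearest_higher V x y" for V t and x y :: 'a
      using nearest_higher_isometry[OF isometry_translation] .
    show "AE V in N. \<forall>x\<in>V. \<forall>y\<in>V. \<forall>y'\<in>V. nearest_higher V x y \<longrightarrow> nearest_higher V x y' \<longrightarrow> y = y'"
      by (rule AE_mp[OF assms]) (intro AE_I2 impI ballI, rule nearest_higher_unique)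
  qed
  with assms AE_empty_or_infinite AE_space show ?thesis
    by eventually_elim (simp add: forest_config_def space_N)
qed

text \<open>
Vertices reached from a point without predecessor are sent to that point. This rule is a partial map with
infinite fibres, so almost surely there are no such points.
\<close>

lemma AE_good_config:
  assumes "AE V in N. distinct_distances V"
  shows "AE V in N. good_config V"
proof -
  note forest = AE_forest_config[OF assms]
  \<comment> \<open>The point \<open>y\<close> has no predecessor, and \<open>x\<close> is on its orbit.\<close>
  define root where "root V x y \<longleftrightarrow> y \<in> V \<and> \<not> (\<exists>w\<in>V. config_succ V w y) \<and> (\<exists>k. (config_succ V ^^ k) y x)"
    for V and x y :: 'a
  have root: "equivariant root"
    unfolding equivariant_def root_def
    by (simp add: isometry_mem_iff equivariantD[OF equivariant_config_succ]
        equivariantD[OF equivariant_config_succ_iterate])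
  have "AE V in N. \<forall>y\<in>V. finite {x\<in>V. root V x y}"
  proof (rule AE_finite_to_one)
    note [measurable (raw)] = pred_relation[OF measurable_config_succ]
      pred_relation[OF measurable_config_succ_iterate]
    show "measurable_relation root" unfolding root_def split_def by measurable
    show "root ((+) t ` V) (t + x) (t + y) = root V x y" for V t x y
      by (rule equivariantD[OF root isometry_translation])
    show "AE V in N. \<forall>x\<in>V. \<forall>y\<in>V. \<forall>y'\<in>V. root V x y \<longrightarrow> root V x y' \<longrightarrow> y = y'"
    proof (rule AE_mp[OF forest], intro AE_I2 impI ballI)
      fix V x y y' assume V: "forest_config V" and y: "root V x y" "root V x y'"
      interpret metric_forest V "nearest_higher V" "level V" by (rule metric_forest_nearest_higher[OF V])
      show "y = y'"
        using y succ_orbit_root_unique[of _ y x _ y'] unfolding root_def config_succ_def by blast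
    qed
  qed
  with forest show ?thesis
  proof eventually_elim
    case (elim V)
    interpret metric_forest V "nearest_higher V" "level V"
      by (rule metric_forest_nearest_higher[OF elim(1)])
    have "\<exists>x\<in>V. config_succ V x y" if y: "y \<in> V" for y
    proof (rule ccontr)
      assume none: "\<not> (\<exists>x\<in>V. config_succ V x y)"
      then have "{x\<in>V. root V x y} = {x\<in>V. \<exists>k. (config_succ V ^^ k) y x}"
        using y by (auto simp: root_def)
      with elim(2) y infinite_succ_orbit[OF y] show False by (auto simp: config_succ_def)
    qed
    with elim(1) show ?case by (simp add: good_config_def)
  qed
qed

end

theorem theorem2:
  fixes P :: "'w measure" and M :: "'w \<Rightarrow> (real ^ 'n::finite) measure"
  assumes "point_process P M"
    and "simple_process P M"
    and "finite_intensity P M"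
    and "non_equidistant P M"
    and "isometry_invariant P M"
    and "isometry_ergodic P M"
  shows "(\<exists>G. factor_graph P M G \<and> (\<forall>g\<in>ran G. undirected g) \<and>
            (AE \<omega> in P. \<exists>g. G (support (M \<omega>)) = Some g \<and>
               (\<forall>C\<in>graph_components (with_proj g). locally_finite C \<and> one_ended_tree C))) \<and>
         (\<exists>G. factor_graph P M G \<and>
            (AE \<omega> in P. \<exists>g. G (support (M \<omega>)) = Some g \<and>
               (\<forall>C\<in>graph_components (with_proj g). directed_biinfinite_path C))) \<and>
         (\<exists>G. factor_graph P M G \<and> (\<forall>g\<in>ran G. undirected g) \<and>
            (AE \<omega> in P. \<exists>g. G (support (M \<omega>)) = Some g \<and> perfect_matching g))"
proof -
  note supp = measurable_support_process[OF assms(1)]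
  interpret stationary_config "config_law P M"
    by (rule stationary_config_law[OF assms(1,3,5)])
  have "AE \<omega> in P. distinct_distances (support (M \<omega>))"
    using assms(4) unfolding non_equidistant_def distinct_distances_def .
  then have "AE V in config_law P M. distinct_distances V"
    unfolding config_law_def using pred_distinct_distances
    by (subst AE_distr_iff[OF supp]) (simp_all add: pred_def)
  then have good: "AE V in config_law P M. good_config V" by (rule AE_good_config)
  have good_support: "AE \<omega> in P. good_config (support (M \<omega>))"
    using good unfolding config_law_def by (rule AE_distrD[OF supp])
  define graph :: "((real ^ 'n) set \<Rightarrow> real ^ 'n \<Rightarrow> real ^ 'n \<Rightarrow> bool) \<Rightarrow>
      (real ^ 'n) set \<Rightarrow> (real ^ 'n) pair_pre_digraph option"
    where "graph R V = (if good_config V then Some \<lparr>pverts = V, parcs = {(x, y). R V x y}\<rparr> else None)" for R V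
  have factor: "factor_graph P M (graph R)"
    if "measurable_relation R" "equivariant R" "\<And>V x y. R V x y \<Longrightarrow> x \<in> V \<and> y \<in> V" for R
    unfolding graph_def
    by (rule factor_graph_of_relation[OF assms(1) _ good good_config_isometry that(3) equivariantD[OF that(2)] that(1)])
      (simp_all add: good_config_def forest_config_def)
  have graph_AE: "AE \<omega> in P. \<exists>g. graph R (support (M \<omega>)) = Some g \<and> Q g"
    if "\<And>V. good_config V \<Longrightarrow> Q \<lparr>pverts = V, parcs = {(x, y). R V x y}\<rparr>" for R Q
    using good_support by eventually_elim (simp add: graph_def that)
  have graph_ran: "\<forall>g\<in>ran (graph R). Q g"
    if "\<And>V. good_config V \<Longrightarrow> Q \<lparr>pverts = V, parcs = {(x, y). R V x y}\<rparr>" for R Q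
    using that by (auto simp: ran_def graph_def split: if_splits)
  have forest: "metric_forest V (nearest_higher V) (level V)" if "good_config V" for V :: "(real ^ 'n) set"
    using that by (intro metric_forest_nearest_higher) (simp add: good_config_def)
  have leveled: "leveled_forest V (nearest_higher V) (level V)" if "good_config V" for V :: "(real ^ 'n) set"
    using forest[OF that] by (rule metric_forest.axioms(1))
  define edge :: "(real ^ 'n) set \<Rightarrow> real ^ 'n \<Rightarrow> real ^ 'n \<Rightarrow> bool"
    where "edge V x y \<longleftrightarrow> nearest_higher V x y \<or> nearest_higher V y x" for V x y
  have edge_graph: "\<lparr>pverts = V, parcs = {(x, y). edge V x y}\<rparr> = leveled_forest.tree_graph V (nearest_higher V)"
    if "good_config V" for V
    using leveled_forest.tree_graph_def[OF leveled[OF that]] by (simp add: edge_def)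
  have "measurable_relation edge" unfolding edge_def split_def by measurable
  moreover have "equivariant edge"
    by (simp add: equivariant_def edge_def nearest_higher_isometry)
  ultimately have "factor_graph P M (graph edge)"
    by (rule factor) (auto simp: edge_def nearest_higher_def)
  moreover have "\<forall>g\<in>ran (graph edge). undirected g"
    by (rule graph_ran) (simp add: edge_graph leveled_forest.undirected_tree_graph[OF leveled])
  moreover have "AE \<omega> in P. \<exists>g. graph edge (support (M \<omega>)) = Some g \<and>
      (\<forall>C\<in>graph_components (with_proj g). locally_finite C \<and> one_ended_tree C)"
    by (rule graph_AE) (simp add: edge_graph leveled_forest.component_one_ended_tree[OF leveled])
  ultimately have trees: "\<exists>G. factor_graph P M G \<and> (\<forall>g\<in>ran G. undirected g) \<and>
      (AE \<omega> in P. \<exists>g. G (support (M \<omega>)) = Some g \<and>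
         (\<forall>C\<in>graph_components (with_proj g). locally_finite C \<and> one_ended_tree C))"
    by (intro exI[of _ "graph edge"] conjI)
  have "factor_graph P M (graph config_succ)"
    by (rule factor[OF measurable_config_succ equivariant_config_succ config_succ_in])
  moreover have "AE \<omega> in P. \<exists>g. graph config_succ (support (M \<omega>)) = Some g \<and>
      (\<forall>C\<in>graph_components (with_proj g). directed_biinfinite_path C)"
  proof (rule graph_AE, rule ballI)
    fix V :: "(real ^ 'n) set" and C
    assume V: "good_config V"
      and C: "C \<in> graph_components (with_proj \<lparr>pverts = V, parcs = {(x, y). config_succ V x y}\<rparr>)"
    interpret metric_forest V "nearest_higher V" "level V" by (rule forest[OF V])
    note facts = succ_in succ_ex right_unique_succ left_unique_succ succ_aperiodic
    show "directed_biinfinite_path C"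
    proof (rule directed_line_component[OF _ _ _ _ _ _ C])
      show "\<And>y. y \<in> V \<Longrightarrow> \<exists>x. config_succ V x y" using V by (auto simp: good_config_def)
    qed (use facts in \<open>auto simp: config_succ_def\<close>)
  qed
  ultimately have paths: "\<exists>G. factor_graph P M G \<and>
      (AE \<omega> in P. \<exists>g. G (support (M \<omega>)) = Some g \<and>
         (\<forall>C\<in>graph_components (with_proj g). directed_biinfinite_path C))"
    by (intro exI[of _ "graph config_succ"] conjI)
  have mates_in: "x \<in> V \<and> y \<in> V" if "config_mates V x y" for V and x y :: "real ^ 'n"
    using that by (auto simp: config_mates_def mates_def hub_def)
  have matching: "perfect_matching \<lparr>pverts = V, parcs = {(x, y). config_mates V x y}\<rparr>"
    if "good_config V" for V :: "(real ^ 'n) set"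
    unfolding config_mates_def by (rule metric_forest.perfect_matching_mates[OF forest[OF that]])
  have "factor_graph P M (graph config_mates)"
    by (rule factor[OF measurable_config_mates equivariant_config_mates mates_in])
  moreover have "\<forall>g\<in>ran (graph config_mates). undirected g"
    by (rule graph_ran) (use matching in \<open>auto simp: perfect_matching_def\<close>)
  moreover have "AE \<omega> in P. \<exists>g. graph config_mates (support (M \<omega>)) = Some g \<and> perfect_matching g"
    by (rule graph_AE) (rule matching)
  ultimately have matchings: "\<exists>G. factor_graph P M G \<and> (\<forall>g\<in>ran G. undirected g) \<and>
      (AE \<omega> in P. \<exists>g. G (support (M \<omega>)) = Some g \<and> perfect_matching g)"
    by (intro exI[of _ "graph config_mates"] conjI)
  show ?thesis using trees paths matchings by (intro conjI)
qed

end
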